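(* (The case without control delay.) For the controlled backward stochastic system with delay described in the context, in which $f$ and $l$ do not depend on a delayed control, let assumptions (A) and (B') stated there hold. Suppose $u(\cdot)\in\mathcal{U}$, $(y(\cdot),z(\cdot))$ is its corresponding trajectory, $\Theta(t)=(y(t),y_\delta(t),z(t),z_\delta(t))$, and $p(\cdot)$ is the corresponding solution of the adjoint equation. Let the following condition hold: $$H(t,\Theta(t),u(t),p(t))=\max_{v\in U}H(t,\Theta(t),v,p(t))\quad\text{for all }t\in[0,T].$$ Suppose moreover that, for $(t,y,y_\delta,z,z_\delta)\in[0,T]\times\mathbb{R}^n\times\mathbb{R}^n\times\mathbb{R}^{n\times d}\times\mathbb{R}^{n\times d}$, $$\hat H(t,y,y_\delta,z,z_\delta)=\max_{v\in U}H(t,y,y_\delta,z,z_\delta,v,p(t))$$ is a concave function of $(y,y_\delta,z,z_\delta)$, and that $\gamma$ is concave in $y$. Then $u(\cdot)$ is an optimal control, i.e. it maximizes $J$ over $\mathcal{U}$.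
   Context: **Probability setting.** $T>0$; $W$ is a standard $d$-dimensional Brownian motion on a complete probability space $(\Omega,\mathcal{F},\mathbb{P})$; $\mathbb{F}=\{\mathcal{F}_t\}_{t\ge0}$ is the filtration generated by $W$ and augmented by all $\mathbb{P}$-null sets; $\mathbb{E}^{\mathcal{F}_t}=\mathbb{E}[\cdot|\mathcal{F}_t]$. $L^p_{\mathbb{F}}(t_1,t_2;H)$ is the space of $H$-valued $\mathbb{F}$-adapted processes $h$ with $\mathbb{E}\int_{t_1}^{t_2}|h(t)|^pdt<\infty$; $L^2(\Omega,\mathcal{F}_T,\mathbb{P};\mathbb{R}^n)$ is the space of square-integrable $\mathcal{F}_T$-measurable $\mathbb{R}^n$-valued random variables. $\langle\cdot,\cdot\rangle$ is the Euclidean inner product (on $\mathbb{R}^{n\times d}$: $\mathrm{tr}(AB^\top)$). **Delay.** $0\le\delta\le T$ is the time delay; $\phi(t,s)$ is a given bounded $\mathcal{F}_s$-adapted process with $|\phi|\le M$ for a constant $M>0$; $\alpha$ is some $\sigma$-finite measure, and $\frac{\alpha(dt)}{dt}$ denotes the Radon–Nikodym derivative. For a process $x$ put $x_\delta(t)=\int_{t-\delta}^t\phi(t,s)x(s)\alpha(ds)$; this defines $y_\delta,z_\delta$. **Controls.** $U\subset\mathbb{R}^k$ is nonempty and convex; $\eta$ is the given initial path of the control. $\mathcal{U}$ is the set of admissible controls: processes $v(\cdot)$ with $v(t)=\eta(t)$ on $[-\delta,0)$, $v\in L^2_{\mathbb{F}}(0,T;\mathbb{R}^k)$ and $v(t)\in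 U$ a.s. for $t\in[0,T]$. **State equation.** $f:\Omega\times[0,T]\times\mathbb{R}^n\times\mathbb{R}^n\times\mathbb{R}^{n\times d}\times\mathbb{R}^{n\times d}\times\mathbb{R}^k\to\mathbb{R}^n$ is a given measurable, $\mathbb{F}$-adapted function with $\mathbb{E}\int_0^T|f(t,0,\dots,0)|^2dt<\infty$; $\xi\in L^2(\Omega,\mathcal{F}_T,\mathbb{P};\mathbb{R}^n)$; the initial paths $\varphi$ (deterministic) and $\psi$ are given square-integrable functions. For $v\in\mathcal{U}$ the trajectory $(y^v,z^v)$ solves $$\left\{\begin{aligned}-dy(t)&=f(t,y(t),y_\delta(t),z(t),z_\delta(t),v(t))dt-z(t)dW(t),\ t\in[0,T],\\ y(T)&=\xi,\qquad y(t)=\varphi(t),\ z(t)=\psi(t),\ t\in[-\delta,0).\end{aligned}\right.$$ The delay $\delta$ is taken sufficiently small that this equation has a unique solution $(y^v,z^v)\in L^2_{\mathbb{F}}(-\delta,T;\mathbb{R}^n)\times L^2_{\mathbb{F}}(-\delta,T;\mathbb{R}^{n\times d})$ for every $v\in\mathcal{U}$. **Objective** (to be maximized over $\mathcal{U}$): $$J(v(\cdot))=\mathbb{E}\Big[\int_0^Tl(t,y^v(t),y^v_\delta(t),z^v(t),z^v_\delta(t),v(t))dt+\gamma(y^v(0))\Big],$$ with $l$ and $\gamma$ real-valued. **Assumptions.** (A) $f$ is continuously differentiable in $(y,y_\delta,z,z_\delta,v)$, and its partial derivatives with respect to these variables are uniformly bounded. (B') For each $v\in\mathcal{U}$, $l(\cdot,y^v,y^v_\delta,z^v,z^v_\delta,v)\in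 L^1_{\mathbb{F}}(0,T;\mathbb{R})$; $l$ is differentiable in $(y,y_\delta,z,z_\delta)$, $\gamma$ is differentiable in $y$, and all these derivatives are bounded. **Hamiltonian.** $H(t,y,y_\delta,z,z_\delta,v,p)=l(t,y,y_\delta,z,z_\delta,v)-\langle f(t,y,y_\delta,z,z_\delta,v),p\rangle$ for $p\in\mathbb{R}^n$; subscripts on $H$ denote partial derivatives. **Adjoint equation.** For $v\in\mathcal{U}$, with $\Theta^v(t)=(y^v(t),y^v_\delta(t),z^v(t),z^v_\delta(t))$, the adjoint process $p^v$ is the $\mathcal{F}_t$-adapted solution of the advanced stochastic differential equation, for $t\in[0,T]$, $$\left\{\begin{aligned}dp^v(t)=&\Big\{-H_y(t,\Theta^v(t),v(t),p^v(t))-\mathbb{E}^{\mathcal{F}_t}\Big[\int_t^{t+\delta}H_{y_\delta}(s,\Theta^v(s),v(s),p^v(s))\phi(s,t)\chi_{[0,T]}(s)ds\Big]\frac{\alpha(dt)}{dt}\Big\}dt\\&+\Big\{-H_z(t,\Theta^v(t),v(t),p^v(t))-\mathbb{E}^{\mathcal{F}_t}\Big[\int_t^{t+\delta}H_{z_\delta}(s,\Theta^v(s),v(s),p^v(s))\phi(s,t)\chi_{[0,T]}(s)ds\Big]\frac{\alpha(dt)}{dt}\Big\}dW(t),\\ p^v(0)=&-\gamma_y(y^v(0)).\end{aligned}\right.$$ $\chi_{[0,T]}$ is the indicator function of $[0,T]$, so that values of $p^v$ on $(T,T+\delta]$ are not needed. *)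

theory Defs
  imports "HOL-Probability.Probability"
begin

section \<open>Stochastic analysis\<close>

definition complete_prob_space :: "'w measure \<Rightarrow> bool" where
  "complete_prob_space M \<longleftrightarrow> prob_space M \<and> complete_measure M"

definition history :: "'w measure \<Rightarrow> (real \<Rightarrow> 'w \<Rightarrow> real^'d) \<Rightarrow> real \<Rightarrow> 'w set set" where
  "history M W t = {W s -` A \<inter> space M | s A. 0 \<le> s \<and> s \<le> t \<and> A \<in> sets borel}"

text \<open>For \<open>t < 0\<close> the history is empty, so the \<open>\<sigma>\<close>-algebra consists of the null sets and
  their complements, exactly as for \<open>t = 0\<close>.\<close>

definition brownian_filtration ::
  "'w measure \<Rightarrow> (real \<Rightarrow> 'w \<Rightarrow> real^'d) \<Rightarrow> real \<Rightarrow> 'w measure" where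
  "brownian_filtration M W t = sigma (space M) (history M W t \<union> null_sets M)"

definition brownian_motion :: "'w measure \<Rightarrow> (real \<Rightarrow> 'w \<Rightarrow> real^'d) \<Rightarrow> bool" where
  "brownian_motion M W \<longleftrightarrow>
    (\<forall>t\<ge>0. W t \<in> borel_measurable M) \<and>
    (AE \<omega> in M. W 0 \<omega> = 0) \<and>
    (AE \<omega> in M. continuous_on {0..} (\<lambda>t. W t \<omega>)) \<and>
    (\<forall>s t. 0 \<le> s \<and> s < t \<longrightarrow>
      (\<forall>i. distributed M lborel (\<lambda>\<omega>. (W t \<omega> - W s \<omega>) $ i) (normal_density 0 (sqrt (t - s)))) \<and>
      prob_space.indep_vars M (\<lambda>_. borel) (\<lambda>i \<omega>. (W t \<omega> - W s \<omega>) $ i) UNIV \<and>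
      prob_space.indep_set M
        (sigma_sets (space M) (history M W s))
        {(\<lambda>\<omega>. W t \<omega> - W s \<omega>) -` A \<inter> space M | A. A \<in> sets borel})"

text \<open>The space \<open>L\<^sup>p\<close> of measurable adapted processes on \<open>[a, b]\<close>.  The values of a process outside
  \<open>[a, b]\<close> are irrelevant.\<close>

definition Lp_adapted ::
  "'w measure \<Rightarrow> (real \<Rightarrow> 'w measure) \<Rightarrow> nat \<Rightarrow> real \<Rightarrow> real \<Rightarrow> (real \<Rightarrow> 'w \<Rightarrow> 'h::euclidean_space) set"
where
  "Lp_adapted M F p a b = {h.
    (\<lambda>(t, \<omega>). h t \<omega>) \<in> borel_measurable (restrict_space borel {a..b} \<Otimes>\<^sub>M M) \<and>
    (\<forall>t\<in>{a..b}. h t \<in> borel_measurable (F t)) \<and>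
    (\<integral>\<^sup>+ \<omega>. (\<integral>\<^sup>+ t\<in>{a..b}. ennreal (norm (h t \<omega>) ^ p) \<partial>lborel) \<partial>M) < \<infinity>}"

text \<open>Conditional expectation of a vector-valued random variable, coordinate by coordinate.\<close>

definition vec_cond_exp ::
  "'w measure \<Rightarrow> 'w measure \<Rightarrow> ('w \<Rightarrow> 'h::euclidean_space) \<Rightarrow> 'w \<Rightarrow> 'h" where
  "vec_cond_exp M G X \<omega> = (\<Sum>b\<in>Basis. real_cond_exp M G (\<lambda>\<omega>'. X \<omega>' \<bullet> b) \<omega> *\<^sub>R b)"

text \<open>A simple integrand on \<open>[0, T]\<close> is given by a partition \<open>\<tau> 0 \<le> \<dots> \<le> \<tau> m\<close> and bounded
  random matrices \<open>c i\<close>, measurable at time \<open>\<tau> i\<close>, which are its values on \<open>(\<tau> i, \<tau> (i + 1)]\<close>.\<close>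

definition simple_integrand ::
  "'w measure \<Rightarrow> (real \<Rightarrow> 'w measure) \<Rightarrow> real \<Rightarrow> nat \<Rightarrow> (nat \<Rightarrow> real) \<Rightarrow> (nat \<Rightarrow> 'w \<Rightarrow> real^'d^'n) \<Rightarrow> bool"
where
  "simple_integrand M F T m \<tau> c \<longleftrightarrow>
    0 \<le> \<tau> 0 \<and> (\<forall>i<m. \<tau> i \<le> \<tau> (Suc i)) \<and> \<tau> m \<le> T \<and>
    (\<forall>i<m. c i \<in> borel_measurable (F (\<tau> i))) \<and>
    (\<exists>C. \<forall>i<m. \<forall>\<omega>\<in>space M. norm (c i \<omega>) \<le> C)"

definition simple_process ::
  "nat \<Rightarrow> (nat \<Rightarrow> real) \<Rightarrow> (nat \<Rightarrow> 'w \<Rightarrow> real^'d^'n) \<Rightarrow> real \<Rightarrow> 'w \<Rightarrow> real^'d^'n" where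
  "simple_process m \<tau> c t \<omega> = (\<Sum>i<m. indicator {\<tau> i<..\<tau> (Suc i)} t *\<^sub>R c i \<omega>)"

definition simple_ito ::
  "(real \<Rightarrow> 'w \<Rightarrow> real^'d) \<Rightarrow> nat \<Rightarrow> (nat \<Rightarrow> real) \<Rightarrow> (nat \<Rightarrow> 'w \<Rightarrow> real^'d^'n) \<Rightarrow> real \<Rightarrow> 'w \<Rightarrow> real^'n"
where
  "simple_ito W m \<tau> c t \<omega> = (\<Sum>i<m. c i \<omega> *v (W (min t (\<tau> (Suc i))) \<omega> - W (min t (\<tau> i)) \<omega>))"

text \<open>\<open>I t\<close> is a version of the Ito integral of \<open>h\<close> over \<open>[0, t]\<close>, for all \<open>t\<close> in \<open>[0, T]\<close>: the
  integral is the mean-square limit of the elementary integrals along simple integrands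
  converging to \<open>h\<close> in \<open>L\<^sup>2\<close>, and is determined up to a null set for each \<open>t\<close>.\<close>

definition is_ito_integral ::
  "'w measure \<Rightarrow> (real \<Rightarrow> 'w \<Rightarrow> real^'d) \<Rightarrow> real \<Rightarrow>
    (real \<Rightarrow> 'w \<Rightarrow> real^'d^'n) \<Rightarrow> (real \<Rightarrow> 'w \<Rightarrow> real^'n) \<Rightarrow> bool" where
  "is_ito_integral M W T h I \<longleftrightarrow>
    h \<in> Lp_adapted M (brownian_filtration M W) 2 0 T \<and>
    (\<forall>t\<in>{0..T}. I t \<in> borel_measurable (brownian_filtration M W t)) \<and>
    (\<exists>m \<tau> c.
      (\<forall>j. simple_integrand M (brownian_filtration M W) T (m j) (\<tau> j) (c j)) \<and>
      (\<lambda>j. \<integral>\<^sup>+ \<omega>. (\<integral>\<^sup>+ t\<in>{0..T}.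
          ennreal ((norm (simple_process (m j) (\<tau> j) (c j) t \<omega> - h t \<omega>))\<^sup>2) \<partial>lborel) \<partial>M)
        \<longlonglongrightarrow> 0 \<and>
      (\<forall>t\<in>{0..T}.
        (\<lambda>j. \<integral>\<^sup>+ \<omega>. ennreal ((norm (simple_ito W (m j) (\<tau> j) (c j) t \<omega> - I t \<omega>))\<^sup>2) \<partial>M)
          \<longlonglongrightarrow> 0))"

definition grad :: "('a::real_inner \<Rightarrow> real) \<Rightarrow> 'a \<Rightarrow> 'a" where
  "grad g x = (THE D. GDERIV g x :> D)"

definition is_maximum :: "('a \<Rightarrow> real) \<Rightarrow> 'a set \<Rightarrow> real \<Rightarrow> bool" where
  "is_maximum g S m \<longleftrightarrow> m \<in> g ` S \<and> (\<forall>v\<in>S. g v \<le> m)"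


section \<open>The controlled backward system with delay\<close>

text \<open>The points \<open>(y, y\<^sub>\<delta>, z, z\<^sub>\<delta>)\<close>.  The inner product of matrices \<open>A\<close>, \<open>B\<close> of type
  \<open>real^'d^'n\<close> is the sum of the products of the entries, i.e. the trace of \<open>A B\<^sup>T\<close>.\<close>

type_synonym ('n, 'd) state = "(real^'n) \<times> (real^'n) \<times> (real^'d^'n) \<times> (real^'d^'n)"

record ('w, 'n, 'd, 'k) control_system =
  Prob :: "'w measure"
  BM :: "real \<Rightarrow> 'w \<Rightarrow> real^'d"
  Horizon :: real
  Delay :: real
  Kernel :: "real \<Rightarrow> real \<Rightarrow> 'w \<Rightarrow> real"                       \<comment> \<open>\<open>\<phi>(t, s)\<close>\<close>
  Delay_measure :: "real measure"                              \<comment> \<open>\<open>\<alpha>\<close>\<close>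
  Control_set :: "(real^'k) set"                               \<comment> \<open>\<open>U\<close>\<close>
  Control_init :: "real \<Rightarrow> real^'k"                           \<comment> \<open>\<open>\<eta>\<close>\<close>
  Generator :: "'w \<Rightarrow> real \<Rightarrow> ('n, 'd) state \<Rightarrow> real^'k \<Rightarrow> real^'n"  \<comment> \<open>\<open>f\<close>\<close>
  Terminal :: "'w \<Rightarrow> real^'n"                                 \<comment> \<open>\<open>\<xi>\<close>\<close>
  Y_init :: "real \<Rightarrow> real^'n"                                 \<comment> \<open>\<open>\<phi>(t)\<close> on \<open>[-\<delta>, 0)\<close>\<close>
  Z_init :: "real \<Rightarrow> real^'d^'n"                              \<comment> \<open>\<open>\<psi>(t)\<close> on \<open>[-\<delta>, 0)\<close>\<close>
  Running :: "'w \<Rightarrow> real \<Rightarrow> ('n, 'd) state \<Rightarrow> real^'k \<Rightarrow> real"     \<comment> \<open>\<open>l\<close>\<close>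
  Initial_payoff :: "real^'n \<Rightarrow> real"                         \<comment> \<open>\<open>\<gamma>\<close>\<close>

abbreviation Filt ::
  "('w, 'n::finite, 'd::finite, 'k::finite) control_system \<Rightarrow> real \<Rightarrow> 'w measure" where
  "Filt S \<equiv> brownian_filtration (Prob S) (BM S)"

abbreviation Lp ::
  "('w, 'n::finite, 'd::finite, 'k::finite) control_system \<Rightarrow> nat \<Rightarrow> real \<Rightarrow> real \<Rightarrow>
    (real \<Rightarrow> 'w \<Rightarrow> 'h::euclidean_space) set" where
  "Lp S \<equiv> Lp_adapted (Prob S) (Filt S)"

definition measurable_adapted_coefficient ::
  "('w, 'n::finite, 'd::finite, 'k::finite) control_system \<Rightarrow>
    ('w \<Rightarrow> real \<Rightarrow> ('n, 'd) state \<Rightarrow> real^'k \<Rightarrow> 'h::euclidean_space) \<Rightarrow> bool" where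
  "measurable_adapted_coefficient S g \<longleftrightarrow>
    (\<lambda>(\<omega>, t, \<theta>, v). g \<omega> t \<theta> v)
      \<in> borel_measurable (Prob S \<Otimes>\<^sub>M restrict_space borel {0..Horizon S} \<Otimes>\<^sub>M borel \<Otimes>\<^sub>M borel) \<and>
    (\<forall>t\<in>{0..Horizon S}.
      (\<lambda>(\<omega>, \<theta>, v). g \<omega> t \<theta> v) \<in> borel_measurable (Filt S t \<Otimes>\<^sub>M borel \<Otimes>\<^sub>M borel))"

definition delayed ::
  "('w, 'n::finite, 'd::finite, 'k::finite) control_system \<Rightarrow>
    (real \<Rightarrow> 'w \<Rightarrow> 'h::euclidean_space) \<Rightarrow> real \<Rightarrow> 'w \<Rightarrow> 'h" where
  "delayed S x t \<omega> =
    (LINT s:{t - Delay S..t}|Delay_measure S. Kernel S t s \<omega> *\<^sub>R x s \<omega>)"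

text \<open>The integrals defining \<open>x\<^sub>\<delta>\<close> converge absolutely and are square integrable on
  \<open>[0, T] \<times> \<Omega>\<close>.  This has to be required: \<open>\<alpha>\<close> is only \<open>\<sigma>\<close>-finite, its density may be unbounded,
  and the Bochner integral in the definition of \<open>x\<^sub>\<delta>\<close> is \<open>0\<close> by convention where it does not converge.\<close>

definition delay_square_integrable ::
  "('w, 'n::finite, 'd::finite, 'k::finite) control_system \<Rightarrow>
    (real \<Rightarrow> 'w \<Rightarrow> 'h::euclidean_space) \<Rightarrow> bool" where
  "delay_square_integrable S x \<longleftrightarrow>
    (\<integral>\<^sup>+ \<omega>. (\<integral>\<^sup>+ t\<in>{0..Horizon S}.
      (\<integral>\<^sup>+ s\<in>{t - Delay S..t}. ennreal (norm (Kernel S t s \<omega> *\<^sub>R x s \<omega>)) \<partial>Delay_measure S)\<^sup>2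
      \<partial>lborel) \<partial>Prob S) < \<infinity>"

definition admissible ::
  "('w, 'n::finite, 'd::finite, 'k::finite) control_system \<Rightarrow> (real \<Rightarrow> 'w \<Rightarrow> real^'k) set" where
  "admissible S = {v.
    (\<forall>t\<in>{- Delay S..<0}. AE \<omega> in Prob S. v t \<omega> = Control_init S t) \<and>
    v \<in> Lp S 2 0 (Horizon S) \<and>
    (\<forall>t\<in>{0..Horizon S}. AE \<omega> in Prob S. v t \<omega> \<in> Control_set S)}"

definition Theta ::
  "('w, 'n::finite, 'd::finite, 'k::finite) control_system \<Rightarrow>
    (real \<Rightarrow> 'w \<Rightarrow> real^'n) \<Rightarrow> (real \<Rightarrow> 'w \<Rightarrow> real^'d^'n) \<Rightarrow> real \<Rightarrow> 'w \<Rightarrow> ('n, 'd) state" where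
  "Theta S y z t \<omega> = (y t \<omega>, delayed S y t \<omega>, z t \<omega>, delayed S z t \<omega>)"

text \<open>The state equation in integrated form; \<open>I\<close> is the Ito integral of \<open>z\<close>.\<close>

definition state_solution ::
  "('w, 'n::finite, 'd::finite, 'k::finite) control_system \<Rightarrow> (real \<Rightarrow> 'w \<Rightarrow> real^'k) \<Rightarrow>
    (real \<Rightarrow> 'w \<Rightarrow> real^'n) \<Rightarrow> (real \<Rightarrow> 'w \<Rightarrow> real^'d^'n) \<Rightarrow> bool" where
  "state_solution S v y z \<longleftrightarrow>
    y \<in> Lp S 2 (- Delay S) (Horizon S) \<and> z \<in> Lp S 2 (- Delay S) (Horizon S) \<and>
    delay_square_integrable S y \<and> delay_square_integrable S z \<and>
    (\<forall>t\<in>{- Delay S..<0}. AE \<omega> in Prob S. y t \<omega> = Y_init S t \<and> z t \<omega> = Z_init S t) \<and>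
    (\<exists>I. is_ito_integral (Prob S) (BM S) (Horizon S) z I \<and>
      (\<forall>t\<in>{0..Horizon S}. AE \<omega> in Prob S.
        y t \<omega> = Terminal S \<omega>
          + (LINT s:{t..Horizon S}|lborel. Generator S \<omega> s (Theta S y z s \<omega>) (v s \<omega>))
          - (I (Horizon S) \<omega> - I t \<omega>)))"

text \<open>Existence, and uniqueness as elements of \<open>L\<^sup>2\<close>.\<close>

definition uniquely_solvable ::
  "('w, 'n::finite, 'd::finite, 'k::finite) control_system \<Rightarrow> (real \<Rightarrow> 'w \<Rightarrow> real^'k) \<Rightarrow> bool" where
  "uniquely_solvable S v \<longleftrightarrow>
    (\<exists>y z. state_solution S v y z) \<and>
    (\<forall>y z y' z'. state_solution S v y z \<and> state_solution S v y' z' \<longrightarrow>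
      (AE (t, \<omega>) in lborel \<Otimes>\<^sub>M Prob S. t \<in> {- Delay S..Horizon S} \<longrightarrow>
        y t \<omega> = y' t \<omega> \<and> z t \<omega> = z' t \<omega>))"

definition trajectory ::
  "('w, 'n::finite, 'd::finite, 'k::finite) control_system \<Rightarrow> (real \<Rightarrow> 'w \<Rightarrow> real^'k) \<Rightarrow>
    (real \<Rightarrow> 'w \<Rightarrow> real^'n) \<times> (real \<Rightarrow> 'w \<Rightarrow> real^'d^'n)" where
  "trajectory S v = (SOME (y, z). state_solution S v y z)"

definition J ::
  "('w, 'n::finite, 'd::finite, 'k::finite) control_system \<Rightarrow> (real \<Rightarrow> 'w \<Rightarrow> real^'k) \<Rightarrow> real" where
  "J S v = (let (y, z) = trajectory S v in
    LINT \<omega>|Prob S.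
      (LINT t:{0..Horizon S}|lborel. Running S \<omega> t (Theta S y z t \<omega>) (v t \<omega>))
      + Initial_payoff S (y 0 \<omega>))"

definition optimal_control ::
  "('w, 'n::finite, 'd::finite, 'k::finite) control_system \<Rightarrow> (real \<Rightarrow> 'w \<Rightarrow> real^'k) \<Rightarrow> bool" where
  "optimal_control S u \<longleftrightarrow> u \<in> admissible S \<and> (\<forall>v\<in>admissible S. J S v \<le> J S u)"

text \<open>The standing assumptions on the data.  Absolute continuity of \<open>\<alpha>\<close> is what makes
  \<open>\<alpha>(dt)/dt\<close> meaningful.\<close>

definition control_problem ::
  "('w, 'n::finite, 'd::finite, 'k::finite) control_system \<Rightarrow> bool" where
  "control_problem S \<longleftrightarrow>
    complete_prob_space (Prob S) \<and> brownian_motion (Prob S) (BM S) \<and>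
    0 < Horizon S \<and> 0 \<le> Delay S \<and> Delay S \<le> Horizon S \<and>
    (\<lambda>(t, s, \<omega>). Kernel S t s \<omega>) \<in> borel_measurable
      (restrict_space borel {0..Horizon S} \<Otimes>\<^sub>M restrict_space borel {- Delay S..Horizon S} \<Otimes>\<^sub>M Prob S) \<and>
    (\<forall>t\<in>{0..Horizon S}. \<forall>s\<in>{- Delay S..Horizon S}. Kernel S t s \<in> borel_measurable (Filt S s)) \<and>
    (\<exists>C>0. \<forall>t\<in>{0..Horizon S}. \<forall>s\<in>{- Delay S..Horizon S}. \<forall>\<omega>\<in>space (Prob S).
      \<bar>Kernel S t s \<omega>\<bar> \<le> C) \<and>
    sets (Delay_measure S) = sets borel \<and> sigma_finite_measure (Delay_measure S) \<and>
    absolutely_continuous lborel (Delay_measure S) \<and>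
    Control_set S \<noteq> {} \<and> convex (Control_set S) \<and>
    measurable_adapted_coefficient S (Generator S) \<and>
    (\<lambda>t \<omega>. Generator S \<omega> t 0 0) \<in> Lp S 2 0 (Horizon S) \<and>
    Terminal S \<in> borel_measurable (Filt S (Horizon S)) \<and>
    integrable (Prob S) (\<lambda>\<omega>. (norm (Terminal S \<omega>))\<^sup>2) \<and>
    set_borel_measurable borel {- Delay S..<0} (Y_init S) \<and>
    set_integrable lborel {- Delay S..<0} (\<lambda>t. (norm (Y_init S t))\<^sup>2) \<and>
    set_borel_measurable borel {- Delay S..<0} (Z_init S) \<and>
    set_integrable lborel {- Delay S..<0} (\<lambda>t. (norm (Z_init S t))\<^sup>2) \<and>
    measurable_adapted_coefficient S (Running S) \<and>
    (\<forall>v\<in>admissible S. uniquely_solvable S v)"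

definition assumption_A ::
  "('w, 'n::finite, 'd::finite, 'k::finite) control_system \<Rightarrow> bool" where
  "assumption_A S \<longleftrightarrow>
    (\<exists>C. \<forall>\<omega>\<in>space (Prob S). \<forall>t\<in>{0..Horizon S}.
      \<exists>Df :: ('n, 'd) state \<times> (real^'k) \<Rightarrow> (('n, 'd) state \<times> (real^'k)) \<Rightarrow>\<^sub>L (real^'n).
        continuous_on UNIV Df \<and>
        (\<forall>x. ((\<lambda>(\<theta>, v). Generator S \<omega> t \<theta> v) has_derivative blinfun_apply (Df x)) (at x) \<and>
          norm (Df x) \<le> C))"

definition assumption_B' ::
  "('w, 'n::finite, 'd::finite, 'k::finite) control_system \<Rightarrow> bool" where
  "assumption_B' S \<longleftrightarrow>
    (\<forall>v\<in>admissible S. \<forall>y z. state_solution S v y z \<longrightarrow>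
      (\<lambda>t \<omega>. Running S \<omega> t (Theta S y z t \<omega>) (v t \<omega>)) \<in> Lp S 1 0 (Horizon S)) \<and>
    (\<exists>C. \<forall>\<omega>\<in>space (Prob S). \<forall>t\<in>{0..Horizon S}. \<forall>\<theta> v.
      \<exists>D. GDERIV (\<lambda>\<theta>'. Running S \<omega> t \<theta>' v) \<theta> :> D \<and> norm D \<le> C) \<and>
    (\<exists>C. \<forall>y. \<exists>D. GDERIV (Initial_payoff S) y :> D \<and> norm D \<le> C)"


section \<open>Hamiltonian and adjoint equation\<close>

definition Ham ::
  "('w, 'n::finite, 'd::finite, 'k::finite) control_system \<Rightarrow>
    'w \<Rightarrow> real \<Rightarrow> ('n, 'd) state \<Rightarrow> real^'k \<Rightarrow> real^'n \<Rightarrow> real" where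
  "Ham S \<omega> t \<theta> v p = Running S \<omega> t \<theta> v - Generator S \<omega> t \<theta> v \<bullet> p"

fun Ham_y ::
  "('w, 'n::finite, 'd::finite, 'k::finite) control_system \<Rightarrow>
    'w \<Rightarrow> real \<Rightarrow> ('n, 'd) state \<Rightarrow> real^'k \<Rightarrow> real^'n \<Rightarrow> real^'n" where
  "Ham_y S \<omega> t (y, yd, z, zd) v p = grad (\<lambda>x. Ham S \<omega> t (x, yd, z, zd) v p) y"

fun Ham_yd ::
  "('w, 'n::finite, 'd::finite, 'k::finite) control_system \<Rightarrow>
    'w \<Rightarrow> real \<Rightarrow> ('n, 'd) state \<Rightarrow> real^'k \<Rightarrow> real^'n \<Rightarrow> real^'n" where
  "Ham_yd S \<omega> t (y, yd, z, zd) v p = grad (\<lambda>x. Ham S \<omega> t (y, x, z, zd) v p) yd"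

fun Ham_z ::
  "('w, 'n::finite, 'd::finite, 'k::finite) control_system \<Rightarrow>
    'w \<Rightarrow> real \<Rightarrow> ('n, 'd) state \<Rightarrow> real^'k \<Rightarrow> real^'n \<Rightarrow> real^'d^'n" where
  "Ham_z S \<omega> t (y, yd, z, zd) v p = grad (\<lambda>x. Ham S \<omega> t (y, yd, x, zd) v p) z"

fun Ham_zd ::
  "('w, 'n::finite, 'd::finite, 'k::finite) control_system \<Rightarrow>
    'w \<Rightarrow> real \<Rightarrow> ('n, 'd) state \<Rightarrow> real^'k \<Rightarrow> real^'n \<Rightarrow> real^'d^'n" where
  "Ham_zd S \<omega> t (y, yd, z, zd) v p = grad (\<lambda>x. Ham S \<omega> t (y, yd, z, x) v p) zd"

text \<open>For a process \<open>q\<close>: the conditional expectation given time \<open>t\<close> of the integral of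
  \<open>q(s) \<phi>(s, t) \<chi>(s)\<close> over \<open>s \<in> [t, t + \<delta>]\<close>, times \<open>\<alpha>(dt)/dt\<close>.\<close>

definition advanced ::
  "('w, 'n::finite, 'd::finite, 'k::finite) control_system \<Rightarrow>
    (real \<Rightarrow> 'w \<Rightarrow> 'h::euclidean_space) \<Rightarrow> real \<Rightarrow> 'w \<Rightarrow> 'h" where
  "advanced S q t \<omega> =
    enn2real (RN_deriv lborel (Delay_measure S) t) *\<^sub>R
    vec_cond_exp (Prob S) (Filt S t)
      (\<lambda>\<omega>'. LINT s:{t..t + Delay S}|lborel.
        (indicator {0..Horizon S} s * Kernel S s t \<omega>') *\<^sub>R q s \<omega>') \<omega>"

text \<open>The adjoint equation in integrated form for the control \<open>v\<close> with trajectory \<open>(y, z)\<close>;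
  \<open>b\<close> and \<open>\<sigma>\<close> are measurable versions of its drift and diffusion coefficients (conditional
  expectations being determined only up to null sets for each \<open>t\<close>), and \<open>I\<close> is the Ito integral
  of \<open>\<sigma>\<close>.\<close>

definition adjoint_solution ::
  "('w, 'n::finite, 'd::finite, 'k::finite) control_system \<Rightarrow> (real \<Rightarrow> 'w \<Rightarrow> real^'k) \<Rightarrow>
    (real \<Rightarrow> 'w \<Rightarrow> real^'n) \<Rightarrow> (real \<Rightarrow> 'w \<Rightarrow> real^'d^'n) \<Rightarrow> (real \<Rightarrow> 'w \<Rightarrow> real^'n) \<Rightarrow> bool" where
  "adjoint_solution S v y z p \<longleftrightarrow>
    p \<in> Lp S 2 0 (Horizon S) \<and>
    (\<exists>b \<sigma> I.
      b \<in> Lp S 2 0 (Horizon S) \<and> \<sigma> \<in> Lp S 2 0 (Horizon S) \<and>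
      (AE t in lborel. t \<in> {0..Horizon S} \<longrightarrow> (AE \<omega> in Prob S.
        b t \<omega> = - Ham_y S \<omega> t (Theta S y z t \<omega>) (v t \<omega>) (p t \<omega>)
          - advanced S (\<lambda>s \<omega>. Ham_yd S \<omega> s (Theta S y z s \<omega>) (v s \<omega>) (p s \<omega>)) t \<omega> \<and>
        \<sigma> t \<omega> = - Ham_z S \<omega> t (Theta S y z t \<omega>) (v t \<omega>) (p t \<omega>)
          - advanced S (\<lambda>s \<omega>. Ham_zd S \<omega> s (Theta S y z s \<omega>) (v s \<omega>) (p s \<omega>)) t \<omega>)) \<and>
      is_ito_integral (Prob S) (BM S) (Horizon S) \<sigma> I \<and>
      (AE \<omega> in Prob S. p 0 \<omega> = - grad (Initial_payoff S) (y 0 \<omega>)) \<and>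
      (\<forall>t\<in>{0..Horizon S}. AE \<omega> in Prob S.
        p t \<omega> = p 0 \<omega> + (LINT s:{0..t}|lborel. b s \<omega>) + I t \<omega>))"

end

theory Submission
  imports Defs
begin

text \<open>Let \<open>\<Theta>\<close> and \<open>\<Theta>\<^sup>v\<close> be the trajectories of \<open>u\<close> and of another admissible control \<open>v\<close>, and \<open>p\<close> the
  adjoint process of \<open>u\<close>.  Let \<open>Y\<close> and \<open>g\<close> be the differences, for \<open>v\<close> and \<open>u\<close>, of the states \<open>y\<close> and of
  the generators along the trajectories, and \<open>H\<^sub>\<theta>\<close> the gradient of the Hamiltonian in all four state
  variables along \<open>\<Theta>\<close>.

  The maximum condition says that \<open>H(\<cdot>, u, p)\<close> touches its concave upper envelope from below at \<open>\<Theta>\<close>.  At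
  such a point the gradient of \<open>H(\<cdot>, u, p)\<close> is a supergradient of the envelope
  (\<open>concave_envelope_gradient\<close>).  Hence \<open>H(\<Theta>\<^sup>v, v, p) - H(\<Theta>, u, p) \<le> \<langle>H\<^sub>\<theta>, \<Theta>\<^sup>v - \<Theta>\<rangle>\<close> almost surely at
  each time.  The left-hand side is the difference of the running payoffs minus \<open>\<langle>p, g\<rangle>\<close>, while
  concavity of the initial payoff and \<open>p(0) = - \<gamma>\<^sub>y(y(0))\<close> bound the difference of the initial payoffs by
  \<open>- E \<langle>p(0), Y(0)\<rangle>\<close>.  So the theorem follows by integration from the identity
  \<open>E \<integral> \<langle>H\<^sub>\<theta>, \<Theta>\<^sup>v - \<Theta>\<rangle> + \<langle>p, g\<rangle> dt = E \<langle>p(0), Y(0)\<rangle>\<close>, which is \<open>adjoint_duality\<close>.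

  This identity has two ingredients.  The first, \<open>backward_forward_duality\<close>, is the product rule for
  \<open>\<langle>p, Y\<rangle>\<close> in expectation.  It is derived from two properties of the stochastic integral, obtained from
  its approximation by elementary integrals: increments after time \<open>t\<close> are orthogonal to what is known
  at time \<open>t\<close> (\<open>integral_orthogonal\<close>), and the isometry for a pair of integrands (\<open>ito_isometry\<close>).  The
  second, \<open>advance_delay_duality\<close>, says that the advanced operator in the adjoint equation is the adjoint
  of the delay operator; it is Fubini's theorem together with the defining property of conditional
  expectation.

  Two points need separate care.  A delayed process is an integral of adapted processes that are only
  jointly measurable; it is adapted up to null sets (\<open>delay_integral_adapted\<close>), and the orthogonality
  above is therefore stated for random variables that are almost surely equal to one known at time \<open>t\<close>.
  The payoff is defined through some solution of the state equation and evaluates it at time zero,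
  although solutions are unique only almost everywhere in time; \<open>total_payoff_unique\<close> removes this
  dependence.\<close>

section \<open>Square-integrable functions\<close>

text \<open>The same notion serves random variables and processes, the latter as functions on the product of
  a time interval with the probability space.\<close>

definition sq_integrable :: "'a measure \<Rightarrow> ('a \<Rightarrow> 'b::euclidean_space) \<Rightarrow> bool" where
  "sq_integrable N f \<longleftrightarrow> f \<in> borel_measurable N \<and> integrable N (\<lambda>x. (norm (f x))\<^sup>2)"

lemma sq_integrable_measurable [measurable_dest]: "sq_integrable N f \<Longrightarrow> f \<in> borel_measurable N"
  by (simp add: sq_integrable_def)

lemma sq_integrable_norm_square: "sq_integrable N f \<Longrightarrow> integrable N (\<lambda>x. (norm (f x))\<^sup>2)"
  by (simp add: sq_integrable_def)

lemma sq_integrable_iff_nn_integral: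
  assumes "f \<in> borel_measurable N"
  shows "sq_integrable N f \<longleftrightarrow> (\<integral>\<^sup>+x. ennreal ((norm (f x))\<^sup>2) \<partial>N) < \<infinity>"
  using assms by (simp add: sq_integrable_def integrable_iff_bounded)

lemma sq_integrable_bound:
  fixes g :: "'a \<Rightarrow> real"
  assumes "f \<in> borel_measurable N" "integrable N g" "AE x in N. (norm (f x))\<^sup>2 \<le> g x"
  shows "sq_integrable N f"
proof -
  have [measurable]: "f \<in> borel_measurable N" by fact
  have "integrable N (\<lambda>x. (norm (f x))\<^sup>2)"
    by (rule Bochner_Integration.integrable_bound[OF assms(2)]) (use assms(3) in auto)
  then show ?thesis using assms(1) by (simp add: sq_integrable_def)
qed

lemma sq_integrable_norm_bound:
  fixes g :: "'a \<Rightarrow> 'c::euclidean_space"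
  assumes "f \<in> borel_measurable N" "sq_integrable N g" "AE x in N. norm (f x) \<le> norm (g x)"
  shows "sq_integrable N f"
  by (rule sq_integrable_bound[OF assms(1) sq_integrable_norm_square[OF assms(2)]])
     (use assms(3) in \<open>auto simp: power_mono\<close>)

lemma sq_integrable_cong_AE:
  assumes "sq_integrable N f" "g \<in> borel_measurable N" "AE x in N. f x = g x"
  shows "sq_integrable N g"
  by (rule sq_integrable_norm_bound[OF assms(2,1)]) (use assms(3) in auto)

lemma norm_square_add_le: "(norm (a + b))\<^sup>2 \<le> 2 * (norm a)\<^sup>2 + 2 * (norm b)\<^sup>2"
  for a b :: "'b::real_normed_vector"
proof -
  have "(norm (a + b))\<^sup>2 \<le> (norm a + norm b)\<^sup>2"
    by (simp add: norm_triangle_ineq power_mono)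
  also have "\<dots> \<le> 2 * (norm a)\<^sup>2 + 2 * (norm b)\<^sup>2"
    using sum_squares_bound[of "norm a" "norm b"] by (simp add: power2_sum)
  finally show ?thesis .
qed

lemma sq_integrable_add:
  assumes "sq_integrable N f" "sq_integrable N g"
  shows "sq_integrable N (\<lambda>x. f x + g x)"
proof (rule sq_integrable_bound)
  show "integrable N (\<lambda>x. 2 * (norm (f x))\<^sup>2 + 2 * (norm (g x))\<^sup>2)"
    using assms by (auto simp: sq_integrable_def)
qed (use assms in \<open>auto simp: norm_square_add_le sq_integrable_def\<close>)

lemma sq_integrable_minus:
  assumes "sq_integrable N f" shows "sq_integrable N (\<lambda>x. - f x)"
  using assms by (simp add: sq_integrable_def)

lemma sq_integrable_diff:
  assumes "sq_integrable N f" "sq_integrable N g"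
  shows "sq_integrable N (\<lambda>x. f x - g x)"
  using sq_integrable_add[OF assms(1) sq_integrable_minus[OF assms(2)]] by simp

lemma sq_integrable_zero: "sq_integrable N (\<lambda>x. 0)"
  by (simp add: sq_integrable_def)

lemma sq_integrable_sum:
  assumes "\<And>i. i \<in> A \<Longrightarrow> sq_integrable N (f i)"
  shows "sq_integrable N (\<lambda>x. \<Sum>i\<in>A. f i x)"
  using assms by (induction A rule: infinite_finite_induct)
    (auto simp: sq_integrable_zero sq_integrable_add)

lemma sq_integrable_scaleR_bounded:
  assumes "sq_integrable N f" "g \<in> borel_measurable N" "AE x in N. \<bar>g x\<bar> \<le> C"
  shows "sq_integrable N (\<lambda>x. g x *\<^sub>R f x)"
proof (rule sq_integrable_bound)
  show "integrable N (\<lambda>x. C\<^sup>2 * (norm (f x))\<^sup>2)"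
    using assms by (auto simp: sq_integrable_def)
  show "AE x in N. (norm (g x *\<^sub>R f x))\<^sup>2 \<le> C\<^sup>2 * (norm (f x))\<^sup>2"
    using assms(3) by eventually_elim
      (auto simp: power_mult_distrib intro!: mult_right_mono power2_le_iff_abs_le[THEN iffD2])
qed (use assms in \<open>auto simp: sq_integrable_def\<close>)

lemma sq_integrable_norm:
  assumes "sq_integrable N f" shows "sq_integrable N (\<lambda>x. norm (f x))"
  using assms by (auto simp: sq_integrable_def)

lemma sq_integrable_inner_const:
  assumes "sq_integrable N f" shows "sq_integrable N (\<lambda>x. f x \<bullet> c)"
proof (rule sq_integrable_norm_bound)
  show "sq_integrable N (\<lambda>x. norm c *\<^sub>R f x)"
    by (rule sq_integrable_scaleR_bounded[OF assms, of _ "norm c"]) auto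
  show "AE x in N. norm (f x \<bullet> c) \<le> norm (norm c *\<^sub>R f x)"
    using Cauchy_Schwarz_ineq2[of c] by (intro AE_I2) (metis inner_commute norm_scaleR abs_norm_cancel real_norm_def)
qed (use assms in \<open>auto simp: sq_integrable_def\<close>)

lemma vec_nth_measurable [measurable (raw)]:
  "f \<in> borel_measurable N \<Longrightarrow> (\<lambda>x. (f x :: 'b::euclidean_space^'k) $ i) \<in> borel_measurable N"
  by (rule measurable_compose[where g = "\<lambda>x. x $ i", OF _ borel_measurable_continuous_onI])
    (auto intro: continuous_intros)

lemma sq_integrable_scaleR_const:
  fixes f :: "'a \<Rightarrow> real"
  assumes "sq_integrable N f" shows "sq_integrable N (\<lambda>x. f x *\<^sub>R c)"
proof (rule sq_integrable_norm_bound)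
  show "sq_integrable N (\<lambda>x. norm c *\<^sub>R f x)"
    by (rule sq_integrable_scaleR_bounded[OF assms, of _ "norm c"]) auto
qed (use assms in \<open>auto simp: sq_integrable_def abs_mult mult.commute\<close>)

lemma sq_integrable_vecI:
  fixes f :: "'a \<Rightarrow> real^'k"
  assumes "\<And>k. sq_integrable N (\<lambda>x. f x $ k)" shows "sq_integrable N f"
proof -
  have "sq_integrable N (\<lambda>x. \<Sum>k\<in>UNIV. f x $ k *\<^sub>R axis k 1)"
    by (intro sq_integrable_sum sq_integrable_scaleR_const assms)
  also have "(\<lambda>x. \<Sum>k\<in>UNIV. f x $ k *\<^sub>R axis k 1) = f"
    by (simp add: fun_eq_iff vec_eq_iff axis_def if_distrib cong: if_cong)
  finally show ?thesis .
qed

lemma sq_integrable_nth: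
  fixes f :: "'a \<Rightarrow> real^'k"
  assumes "sq_integrable N f" shows "sq_integrable N (\<lambda>x. f x $ k)"
  by (rule sq_integrable_norm_bound[OF _ assms])
    (use assms Finite_Cartesian_Product.norm_nth_le in \<open>auto simp: component_le_norm_cart\<close>)

lemma sq_integrable_Pair:
  assumes "sq_integrable N f" "sq_integrable N g"
  shows "sq_integrable N (\<lambda>x. (f x, g x))"
  using assms by (simp add: sq_integrable_def norm_Pair borel_measurable_Pair)

lemma sq_integrable_fst_snd:
  fixes f :: "'a \<Rightarrow> 'b::euclidean_space \<times> 'c::euclidean_space"
  assumes f: "sq_integrable N f"
  shows "sq_integrable N (\<lambda>x. fst (f x))" "sq_integrable N (\<lambda>x. snd (f x))"
proof -
  have [measurable]: "f \<in> N \<rightarrow>\<^sub>M borel \<Otimes>\<^sub>M borel" using f by (simp add: borel_prod sq_integrable_def)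
  have [measurable]: "(\<lambda>x. fst (f x)) \<in> borel_measurable N" "(\<lambda>x. snd (f x)) \<in> borel_measurable N"
    by measurable
  show "sq_integrable N (\<lambda>x. fst (f x))" "sq_integrable N (\<lambda>x. snd (f x))"
    by (rule sq_integrable_norm_bound[OF _ f];
        auto intro!: AE_I2 simp: norm_prod_def real_sqrt_sum_squares_ge1 real_sqrt_sum_squares_ge2)+
qed

lemma sq_integrable_cong:
  assumes "\<And>x. x \<in> space N \<Longrightarrow> f x = g x"
  shows "sq_integrable N f \<longleftrightarrow> sq_integrable N g"
  unfolding sq_integrable_def
  by (intro arg_cong2[where f = "(\<and>)"] measurable_cong Bochner_Integration.integrable_cong refl)
    (simp_all add: assms)

lemma inner_le_weighted_squares:
  fixes a b :: "'b::real_inner"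
  assumes "\<epsilon> > 0"
  shows "\<bar>a \<bullet> b\<bar> \<le> ((norm a)\<^sup>2 / \<epsilon> + \<epsilon> * (norm b)\<^sup>2) / 2"
proof -
  have "0 \<le> (norm a / sqrt \<epsilon> - sqrt \<epsilon> * norm b)\<^sup>2" by simp
  also have "\<dots> = (norm a)\<^sup>2 / \<epsilon> + \<epsilon> * (norm b)\<^sup>2 - 2 * (norm a * norm b)"
    using assms by (simp add: power2_diff power_divide power_mult_distrib)
  finally have "norm a * norm b \<le> ((norm a)\<^sup>2 / \<epsilon> + \<epsilon> * (norm b)\<^sup>2) / 2"
    by (simp add: field_simps)
  then show ?thesis by (rule order_trans[OF Cauchy_Schwarz_ineq2])
qed

lemma integrable_inner:
  assumes "sq_integrable N f" "sq_integrable N g"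
  shows "integrable N (\<lambda>x. f x \<bullet> g x)"
proof (rule Bochner_Integration.integrable_bound)
  show "integrable N (\<lambda>x. ((norm (f x))\<^sup>2 / 1 + 1 * (norm (g x))\<^sup>2) / 2)"
    using assms by (auto simp: sq_integrable_def)
  show "AE x in N. norm (f x \<bullet> g x) \<le> norm (((norm (f x))\<^sup>2 / 1 + 1 * (norm (g x))\<^sup>2) / 2)"
    using inner_le_weighted_squares[of 1] by (intro AE_I2) (force simp: real_norm_def)
qed (use assms in \<open>auto simp: sq_integrable_def\<close>)

lemma integrable_norm_times_norm:
  assumes "sq_integrable N f" "sq_integrable N g"
  shows "integrable N (\<lambda>x. norm (f x) * norm (g x))"
  using integrable_inner[OF sq_integrable_norm[OF assms(1)] sq_integrable_norm[OF assms(2)]]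
  by (simp add: mult.commute)

lemma (in finite_measure) sq_integrable_bounded:
  assumes "f \<in> borel_measurable M" "AE x in M. norm (f x) \<le> C"
  shows "sq_integrable M f"
  by (rule sq_integrable_bound[OF assms(1), of "\<lambda>_. C\<^sup>2"])
     (use assms(2) in \<open>auto simp: power_mono\<close>)

lemma (in finite_measure) sq_integrable_imp_integrable:
  assumes "sq_integrable M f"
  shows "integrable M f"
proof (rule Bochner_Integration.integrable_bound)
  show "integrable M (\<lambda>x. 1 + (norm (f x))\<^sup>2)"
    using assms by (auto simp: sq_integrable_def)
  have "norm v \<le> 1 + (norm v)\<^sup>2" for v :: 'b
    using sum_squares_bound[of "norm v" 1] by (simp add: ) (smt (verit) zero_le_power2)
  then show "AE x in M. norm (f x) \<le> norm (1 + (norm (f x))\<^sup>2)"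
    by (auto simp: abs_of_nonneg)
qed (use assms in \<open>auto simp: sq_integrable_def\<close>)

text \<open>In the weighted arithmetic-geometric mean inequality the weight \<open>\<epsilon>\<close> is chosen of the order of
  the \<open>L\<^sup>2\<close> distance, so that both terms tend to zero; the summand \<open>1 / (j + 1)\<close> keeps it positive when
  the distance vanishes.\<close>

lemma sq_integrable_limit:
  fixes A :: "nat \<Rightarrow> 'a \<Rightarrow> 'b::euclidean_space"
  assumes A: "\<And>j. sq_integrable N (A j)" and [measurable]: "F \<in> borel_measurable N"
    and lim: "(\<lambda>j. \<integral>\<^sup>+x. ennreal ((norm (A j x - F x))\<^sup>2) \<partial>N) \<longlonglongrightarrow> 0"
  shows "sq_integrable N F"
    and "sq_integrable N B \<Longrightarrow> (\<lambda>j. \<integral>x. A j x \<bullet> B x \<partial>N) \<longlonglongrightarrow> (\<integral>x. F x \<bullet> B x \<partial>N)"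
proof -
  note [measurable] = A[THEN sq_integrable_measurable]
  have "eventually (\<lambda>j. (\<integral>\<^sup>+x. ennreal ((norm (A j x - F x))\<^sup>2) \<partial>N) < 1) sequentially"
    using lim by (rule order_tendstoD) simp
  then obtain j where "(\<integral>\<^sup>+x. ennreal ((norm (A j x - F x))\<^sup>2) \<partial>N) < 1"
    by (auto simp: eventually_sequentially)
  then have "(\<integral>\<^sup>+x. ennreal ((norm (A j x - F x))\<^sup>2) \<partial>N) < \<infinity>"
    by (rule less_trans) simp
  then have "sq_integrable N (\<lambda>x. A j x - F x)"
    by (subst sq_integrable_iff_nn_integral) auto
  from sq_integrable_diff[OF A[of j] this] show F: "sq_integrable N F" by simp
  assume B: "sq_integrable N B"
  have D: "sq_integrable N (\<lambda>x. A j x - F x)" for j by (rule sq_integrable_diff[OF A F])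
  define d where "d j = (\<integral>x. (norm (A j x - F x))\<^sup>2 \<partial>N)" for j
  define K where "K = (\<integral>x. (norm (B x))\<^sup>2 \<partial>N)"
  have d0: "d j \<ge> 0" for j by (simp add: d_def)
  have dnn: "ennreal (d j) = (\<integral>\<^sup>+x. ennreal ((norm (A j x - F x))\<^sup>2) \<partial>N)" for j
    unfolding d_def using D[of j] by (subst nn_integral_eq_integral) (auto simp: sq_integrable_def)
  have dlim: "d \<longlonglongrightarrow> 0"
    using lim d0 unfolding dnn[symmetric] by (simp flip: ennreal_0)
  define \<epsilon> where "\<epsilon> j = sqrt (d j) + 1 / real (Suc j)" for j
  have \<epsilon>0: "\<epsilon> j > 0" for j using d0[of j] by (auto simp: \<epsilon>_def intro!: add_nonneg_pos)
  have bound: "norm ((\<integral>x. A j x \<bullet> B x \<partial>N) - (\<integral>x. F x \<bullet> B x \<partial>N)) \<le> (sqrt (d j) + \<epsilon> j * K) / 2" for j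
  proof -
    have "(\<integral>x. A j x \<bullet> B x \<partial>N) - (\<integral>x. F x \<bullet> B x \<partial>N) = (\<integral>x. (A j x - F x) \<bullet> B x \<partial>N)"
      using integrable_inner[OF A B] integrable_inner[OF F B]
      by (simp add: inner_diff_left)
    also have "norm \<dots> \<le> (\<integral>x. norm ((A j x - F x) \<bullet> B x) \<partial>N)" by (rule integral_norm_bound)
    also have "\<dots> \<le> (\<integral>x. ((norm (A j x - F x))\<^sup>2 / \<epsilon> j + \<epsilon> j * (norm (B x))\<^sup>2) / 2 \<partial>N)"
      by (rule integral_mono)
        (use D[of j] B integrable_inner[OF D B] inner_le_weighted_squares[OF \<epsilon>0] in
          \<open>auto simp: sq_integrable_def\<close>)
    also have "\<dots> = (d j / \<epsilon> j + \<epsilon> j * K) / 2"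
      using D[of j] B by (simp add: sq_integrable_def d_def K_def)
    also have "d j / \<epsilon> j \<le> sqrt (d j)"
    proof -
      have "sqrt (d j) * sqrt (d j) \<le> sqrt (d j) * \<epsilon> j"
        by (rule mult_left_mono) (auto simp: \<epsilon>_def d0)
      then show ?thesis using \<epsilon>0[of j] d0[of j] by (simp add: divide_le_eq)
    qed
    finally show ?thesis by simp
  qed
  have \<epsilon>lim: "\<epsilon> \<longlonglongrightarrow> sqrt 0 + 0"
    unfolding \<epsilon>_def
    by (intro tendsto_add tendsto_real_sqrt dlim LIMSEQ_Suc[OF lim_1_over_n])
  have "(\<lambda>j. (sqrt (d j) + \<epsilon> j * K) / 2) \<longlonglongrightarrow> (sqrt 0 + (sqrt 0 + 0) * K) / 2"
    by (intro tendsto_intros dlim \<epsilon>lim) simp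
  then have "(\<lambda>j. (sqrt (d j) + \<epsilon> j * K) / 2) \<longlonglongrightarrow> 0" by simp
  then have "(\<lambda>j. (\<integral>x. A j x \<bullet> B x \<partial>N) - (\<integral>x. F x \<bullet> B x \<partial>N)) \<longlonglongrightarrow> 0"
    by (rule Lim_null_comparison[rotated]) (use bound in auto)
  then show "(\<lambda>j. \<integral>x. A j x \<bullet> B x \<partial>N) \<longlonglongrightarrow> (\<integral>x. F x \<bullet> B x \<partial>N)"
    by (simp add: LIM_zero_iff)
qed

section \<open>Auxiliary facts on measures and sums\<close>

lemma integral_double_sum:
  fixes f :: "'i \<Rightarrow> 'j \<Rightarrow> 'a \<Rightarrow> 'b::{banach, second_countable_topology}"
  assumes "\<And>i j. i \<in> A \<Longrightarrow> j \<in> B \<Longrightarrow> integrable N (f i j)"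
  shows "(\<integral>x. (\<Sum>j\<in>B. \<Sum>i\<in>A. f i j x) \<partial>N) = (\<Sum>j\<in>B. \<Sum>i\<in>A. \<integral>x. f i j x \<partial>N)"
proof -
  have "(\<integral>x. (\<Sum>j\<in>B. \<Sum>i\<in>A. f i j x) \<partial>N) = (\<Sum>j\<in>B. \<integral>x. (\<Sum>i\<in>A. f i j x) \<partial>N)"
    by (rule Bochner_Integration.integral_sum) (intro Bochner_Integration.integrable_sum assms)
  also have "\<dots> = (\<Sum>j\<in>B. \<Sum>i\<in>A. \<integral>x. f i j x \<partial>N)"
    by (intro sum.cong refl Bochner_Integration.integral_sum assms)
  finally show ?thesis .
qed

text \<open>The set of exceptional points need not be measurable, so the exchange is made for a null set that
  contains it.\<close>

lemma AE_pair_swap: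
  assumes "sigma_finite_measure M1" "sigma_finite_measure M2" "AE x in M1 \<Otimes>\<^sub>M M2. P x"
  shows "AE y in M2. AE x in M1. P (x, y)"
proof -
  interpret M1: sigma_finite_measure M1 by fact
  interpret M2: sigma_finite_measure M2 by fact
  interpret pair_sigma_finite M1 M2 ..
  from assms(3) obtain N where N: "{x \<in> space (M1 \<Otimes>\<^sub>M M2). \<not> P x} \<subseteq> N" "N \<in> null_sets (M1 \<Otimes>\<^sub>M M2)"
    by (auto simp: eventually_ae_filter)
  have "AE x in M1 \<Otimes>\<^sub>M M2. x \<notin> N" using N(2) by (rule AE_not_in)
  then have "AE x in M1. AE y in M2. (x, y) \<notin> N" by (rule AE_pair)
  moreover have [measurable]: "N \<in> sets (M1 \<Otimes>\<^sub>M M2)" using N(2) by auto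
  moreover have "{x \<in> space (M1 \<Otimes>\<^sub>M M2). (fst x, snd x) \<notin> N} \<in> sets (M1 \<Otimes>\<^sub>M M2)" by simp measurable
  ultimately have "AE y in M2. AE x in M1. (x, y) \<notin> N" by (subst (asm) AE_commute) auto
  with AE_space show ?thesis
  proof eventually_elim
    case (elim y)
    from AE_space[of M1] elim(2) show ?case
      by eventually_elim (use N(1) elim(1) in \<open>auto simp: space_pair_measure\<close>)
  qed
qed

section \<open>Processes on a time interval\<close>

text \<open>A process on \<open>[a, b]\<close> is treated as one function on the product of this measure with the
  probability measure.\<close>

abbreviation interval_measure :: "real \<Rightarrow> real \<Rightarrow> real measure" where
  "interval_measure a b \<equiv> restrict_space lborel {a..b}"

lemma finite_interval_measure: "finite_measure (interval_measure a b)"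
  by (rule finite_measureI) (simp add: emeasure_restrict_space emeasure_lborel_Icc_eq)

lemma space_interval_measure [simp]: "space (interval_measure a b) = {a..b}"
  by (simp add: space_restrict_space)

lemma sets_interval_measure:
  "sets (interval_measure a b) = sets (restrict_space borel {a..b})"
  by (rule sets_restrict_space_cong) simp

lemma step_process_measurable:
  fixes e :: "'a \<Rightarrow> 'b::euclidean_space"
  assumes "e \<in> borel_measurable M"
  shows "(\<lambda>(t, \<omega>). indicator {p<..q} t *\<^sub>R e \<omega>) \<in> borel_measurable (interval_measure a b \<Otimes>\<^sub>M M)"
proof -
  have "(\<lambda>x. indicator {p<..q} (fst x) :: real) \<in> borel_measurable (interval_measure a b \<Otimes>\<^sub>M M)"
    by (rule measurable_compose[OF measurable_fst measurable_restrict_space1]) simp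
  moreover have "(\<lambda>x. e (snd x)) \<in> borel_measurable (interval_measure a b \<Otimes>\<^sub>M M)"
    by (rule measurable_compose[OF measurable_snd assms])
  ultimately show ?thesis
    unfolding split_beta' by (rule borel_measurable_scaleR)
qed

lemma AE_interval_measure:
  "(AE t in interval_measure a b. P t) \<longleftrightarrow> (AE t in lborel. t \<in> {a..b} \<longrightarrow> P t)"
  by (rule AE_restrict_space_iff) simp

lemma set_lebesgue_integral_interval:
  fixes f :: "real \<Rightarrow> 'b::{banach, second_countable_topology}"
  shows "(LINT t:{a..b}|lborel. f t) = (LINT t|interval_measure a b. f t)"
  unfolding set_lebesgue_integral_def by (rule integral_restrict_space[symmetric]) simp

text \<open>Time enters through a finite measure \<open>L\<close>; the instance used later is Lebesgue measure on \<open>[0, T]\<close>.\<close>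

locale prob_time = prob_space M + fin_L: finite_measure L for M :: "'w measure" and L :: "real measure"
begin

sublocale LM: pair_sigma_finite L M ..
sublocale LMf: finite_measure "L \<Otimes>\<^sub>M M"
  by (rule finite_measure_pair_measure) unfold_locales

abbreviation "LM \<equiv> L \<Otimes>\<^sub>M M"

abbreviation sq_process :: "(real \<Rightarrow> 'w \<Rightarrow> 'h::euclidean_space) \<Rightarrow> bool" where
  "sq_process f \<equiv> sq_integrable (L \<Otimes>\<^sub>M M) (case_prod f)"

end

lemma prob_time_interval: "prob_space M \<Longrightarrow> prob_time M (interval_measure a b)"
  by (simp add: prob_time_def finite_interval_measure)

lemma nn_integral_interval_product:
  assumes "prob_space M" and [measurable]: "f \<in> borel_measurable (interval_measure a b \<Otimes>\<^sub>M M)"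
  shows "(\<integral>\<^sup>+x. f x \<partial>(interval_measure a b \<Otimes>\<^sub>M M)) = (\<integral>\<^sup>+\<omega>. (\<integral>\<^sup>+t\<in>{a..b}. f (t, \<omega>) \<partial>lborel) \<partial>M)"
proof -
  interpret prob_time M "interval_measure a b" by (rule prob_time_interval[OF assms(1)])
  show ?thesis
    by (subst LM.nn_integral_snd[symmetric]) (simp_all add: nn_integral_restrict_space)
qed

lemma Lp_adapted_measurable:
  assumes "h \<in> Lp_adapted M F p a b"
  shows "(\<lambda>(t, \<omega>). h t \<omega>) \<in> borel_measurable (interval_measure a b \<Otimes>\<^sub>M M)"
proof -
  have "(\<lambda>(t, \<omega>). h t \<omega>) \<in> borel_measurable (restrict_space borel {a..b} \<Otimes>\<^sub>M M)"
    using assms by (simp add: Lp_adapted_def)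
  also have "borel_measurable (restrict_space borel {a..b} \<Otimes>\<^sub>M M) =
      borel_measurable (interval_measure a b \<Otimes>\<^sub>M M)"
    by (intro measurable_cong_sets sets_pair_measure_cong) (simp_all add: sets_interval_measure)
  finally show ?thesis .
qed

lemma Lp_adapted_adapted:
  "h \<in> Lp_adapted M F p a b \<Longrightarrow> t \<in> {a..b} \<Longrightarrow> h t \<in> borel_measurable (F t)"
  by (simp add: Lp_adapted_def)

lemma Lp_adapted_2_sq_integrable:
  assumes "prob_space M" "h \<in> Lp_adapted M F 2 a b"
  shows "sq_integrable (interval_measure a b \<Otimes>\<^sub>M M) (\<lambda>(t, \<omega>). h t \<omega>)"
proof -
  note [measurable] = Lp_adapted_measurable[OF assms(2)]
  show ?thesis
    using assms(2) nn_integral_interval_product[OF assms(1), of "\<lambda>(t, \<omega>). ennreal ((norm (h t \<omega>))\<^sup>2)" a b]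
    by (subst sq_integrable_iff_nn_integral) (simp_all add: Lp_adapted_def split_beta')
qed

lemma Lp_adapted_1_integrable:
  assumes "prob_space M" "h \<in> Lp_adapted M F 1 a b"
  shows "integrable (interval_measure a b \<Otimes>\<^sub>M M) (\<lambda>(t, \<omega>). h t \<omega>)"
proof -
  note [measurable] = Lp_adapted_measurable[OF assms(2)]
  show ?thesis
    using assms(2) nn_integral_interval_product[OF assms(1), of "\<lambda>(t, \<omega>). ennreal (norm (h t \<omega>))" a b]
    by (simp add: integrable_iff_bounded Lp_adapted_def split_beta')
qed

context prob_time
begin

lemma AE_sq_integrable_slice:
  assumes "sq_integrable LM (\<lambda>(t, \<omega>). f t \<omega>)"
  shows "AE t in L. sq_integrable M (f t)"
proof -
  have [measurable]: "(\<lambda>(t, \<omega>). f t \<omega>) \<in> borel_measurable LM"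
    using assms by (rule sq_integrable_measurable)
  have "AE t in L. integrable M (\<lambda>\<omega>. (norm (f t \<omega>))\<^sup>2)"
    using LM.AE_integrable_fst'[OF sq_integrable_norm_square[OF assms]] by simp
  with AE_space show ?thesis
    by eventually_elim (auto simp: sq_integrable_def)
qed

text \<open>The Cauchy-Schwarz inequality \<open>(\<integral> \<bar>f\<bar>)\<^sup>2 \<le> c \<integral> \<bar>f\<bar>\<^sup>2\<close> in time, where \<open>c\<close> is the total mass.\<close>

lemma sq_integrable_integral_time:
  assumes "sq_integrable LM (\<lambda>(t, \<omega>). f t \<omega>)"
  shows "sq_integrable M (\<lambda>\<omega>. \<integral>t. norm (f t \<omega>) \<partial>L)" "sq_integrable M (\<lambda>\<omega>. \<integral>t. f t \<omega> \<partial>L)"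
proof -
  have [measurable]: "(\<lambda>(t, \<omega>). f t \<omega>) \<in> borel_measurable LM"
    using assms by (rule sq_integrable_measurable)
  have f2: "integrable LM (\<lambda>(t, \<omega>). (norm (f t \<omega>))\<^sup>2)"
    using sq_integrable_norm_square[OF assms] by (simp add: split_beta')
  define c where "c = measure L (space L)"
  show *: "sq_integrable M (\<lambda>\<omega>. \<integral>t. norm (f t \<omega>) \<partial>L)"
  proof (rule sq_integrable_bound)
    show "integrable M (\<lambda>\<omega>. c * (\<integral>t. (norm (f t \<omega>))\<^sup>2 \<partial>L))"
      using LM.integrable_snd[OF f2] by simp
    have "AE \<omega> in M. integrable L (\<lambda>t. (norm (f t \<omega>))\<^sup>2)"
      using LM.AE_integrable_snd[OF f2] .
    with AE_space show "AE \<omega> in M. (norm (\<integral>t. norm (f t \<omega>) \<partial>L))\<^sup>2 \<le> c * (\<integral>t. (norm (f t \<omega>))\<^sup>2 \<partial>L)"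
    proof eventually_elim
      case (elim \<omega>)
      have sq: "sq_integrable L (\<lambda>t. f t \<omega>)"
        using elim by (auto simp: sq_integrable_def)
      define a where "a = (\<integral>t. norm (f t \<omega>) \<partial>L)"
      define q where "q = (\<integral>t. (norm (f t \<omega>))\<^sup>2 \<partial>L)"
      have i: "integrable L (\<lambda>t. norm (f t \<omega>))"
        using fin_L.sq_integrable_imp_integrable[OF sq] by simp
      \<comment> \<open>nonnegativity of the variance, with denominators cleared because \<open>c\<close> may be zero\<close>
      have "0 \<le> (\<integral>t. (c * norm (f t \<omega>) - a)\<^sup>2 \<partial>L)" by simp
      also have "\<dots> = (\<integral>t. c\<^sup>2 * (norm (f t \<omega>))\<^sup>2 + a\<^sup>2 - 2 * c * a * norm (f t \<omega>) \<partial>L)"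
        by (rule Bochner_Integration.integral_cong) (auto simp: power2_diff power_mult_distrib)
      also have "\<dots> = c\<^sup>2 * q + a\<^sup>2 * c - 2 * c * a * a"
        using i sq by (simp add: sq_integrable_def a_def q_def c_def)
      finally have ineq: "0 \<le> c * (c * q - a\<^sup>2)"
        by (simp add: power2_eq_square algebra_simps)
      have c0: "c \<ge> 0" by (simp add: c_def)
      show ?case
      proof (cases "c = 0")
        case True
        then have "emeasure L (space L) = 0"
          by (simp add: c_def fin_L.emeasure_eq_measure)
        then have "AE t in L. False"
          by (intro AE_I[of _ _ "space L"]) auto
        then have "AE t in L. norm (f t \<omega>) = 0" by eventually_elim simp
        then have "a = 0" unfolding a_def by (simp add: integral_eq_zero_AE)
        then show ?thesis using True unfolding a_def by simp
      next
        case False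
        with c0 ineq have "a\<^sup>2 \<le> c * q" by (simp add: zero_le_mult_iff)
        then show ?thesis by (simp add: a_def q_def)
      qed
    qed
  qed measurable
  show "sq_integrable M (\<lambda>\<omega>. \<integral>t. f t \<omega> \<partial>L)"
  proof (rule sq_integrable_norm_bound[OF _ *])
    show "AE \<omega> in M. norm (\<integral>t. f t \<omega> \<partial>L) \<le> norm (\<integral>t. norm (f t \<omega>) \<partial>L)"
      using integral_norm_bound[of L] by (intro AE_I2) (auto intro: order_trans[OF integral_norm_bound])
  qed measurable
qed

end

section \<open>Brownian increments and the augmented filtration\<close>

locale brownian = prob_space M for M :: "'w measure" +
  fixes W :: "real \<Rightarrow> 'w \<Rightarrow> real^'d"
  assumes brownian: "brownian_motion M W"
begin

abbreviation "F \<equiv> brownian_filtration M W"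

lemma W_measurable [measurable]: "t \<ge> 0 \<Longrightarrow> W t \<in> borel_measurable M"
  using brownian by (simp add: brownian_motion_def)

lemma history_subset: "history M W t \<subseteq> sets M"
  using W_measurable by (auto simp: history_def intro: measurable_sets)

lemma sets_filtration: "sets (F t) = sigma_sets (space M) (history M W t \<union> null_sets M)"
  unfolding brownian_filtration_def
proof (rule sets_measure_of)
  have "history M W t \<union> null_sets M \<subseteq> sets M"
    using history_subset by (blast dest: null_setsD2)
  then show "history M W t \<union> null_sets M \<subseteq> Pow (space M)"
    using sets.space_closed[of M] by (rule subset_trans)
qed

lemma space_filtration: "space (F t) = space M"
  by (simp add: brownian_filtration_def space_measure_of_conv)

lemma subalgebra_filtration: "subalgebra M (F t)"
proof -
  have "history M W t \<union> null_sets M \<subseteq> sets M"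
    using history_subset by (blast dest: null_setsD2)
  then show ?thesis
    unfolding subalgebra_def sets_filtration space_filtration
    by (intro conjI refl sets.sigma_sets_subset)
qed

lemma sets_filtration_mono: "s \<le> t \<Longrightarrow> sets (F s) \<subseteq> sets (F t)"
  unfolding sets_filtration
proof (intro sigma_sets_mono' Un_mono subset_refl)
  assume "s \<le> t"
  then show "history M W s \<subseteq> history M W t"
    unfolding history_def by (fastforce intro: order_trans)
qed

lemma filtration_measurable_mono:
  "f \<in> borel_measurable (F s) \<Longrightarrow> s \<le> t \<Longrightarrow> f \<in> borel_measurable (F t)"
  using sets_filtration_mono[of s t] by (auto simp: measurable_def space_filtration)

lemma filtration_measurable_imp_measurable:
  "f \<in> borel_measurable (F s) \<Longrightarrow> f \<in> borel_measurable M"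
  using measurable_from_subalg[OF subalgebra_filtration] by blast

text \<open>Independence of the increments is given for the raw history only; it passes to the augmented
  filtration because augmentation changes no event by more than a null set.\<close>

lemma filtration_set_eq_history_set:
  assumes "A \<in> sets (F t)"
  shows "\<exists>B\<in>sigma_sets (space M) (history M W t). AE \<omega> in M. \<omega> \<in> A \<longleftrightarrow> \<omega> \<in> B"
  using assms unfolding sets_filtration
proof (induction rule: sigma_sets.induct)
  case (Basic a)
  then show ?case
  proof
    assume "a \<in> null_sets M"
    then have "AE \<omega> in M. \<omega> \<in> a \<longleftrightarrow> \<omega> \<in> {}" using AE_not_in by auto
    then show ?thesis by (intro bexI[of _ "{}"]) (auto intro: sigma_sets.Empty)
  qed auto
next
  case Empty
  show ?case by (intro bexI[of _ "{}"]) (auto intro: sigma_sets.Empty)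
next
  case (Compl a)
  then obtain B where B: "B\<in>sigma_sets (space M) (history M W t)" "AE \<omega> in M. \<omega> \<in> a \<longleftrightarrow> \<omega> \<in> B"
    by blast
  have "AE \<omega> in M. \<omega> \<in> space M - a \<longleftrightarrow> \<omega> \<in> space M - B" using B(2) by eventually_elim auto
  then show ?case using B(1) by (intro bexI[of _ "space M - B"]) (auto intro: sigma_sets.Compl)
next
  case (Union a)
  then have "\<forall>i. \<exists>B. B\<in>sigma_sets (space M) (history M W t) \<and> (AE \<omega> in M. \<omega> \<in> a i \<longleftrightarrow> \<omega> \<in> B)"
    by blast
  then obtain B where B: "\<And>i::nat. B i \<in>sigma_sets (space M) (history M W t)"
    "\<And>i. AE \<omega> in M. \<omega> \<in> a i \<longleftrightarrow> \<omega> \<in> B i"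
    by metis
  have "AE \<omega> in M. \<forall>i. \<omega> \<in> a i \<longleftrightarrow> \<omega> \<in> B i" using B(2) by (simp add: AE_all_countable)
  then have "AE \<omega> in M. \<omega> \<in> \<Union> (range a) \<longleftrightarrow> \<omega> \<in> \<Union> (range B)" by eventually_elim auto
  then show ?case using B(1) by (intro bexI[of _ "\<Union> (range B)"]) (auto intro: sigma_sets.Union)
qed

lemma increment_indep_var:
  fixes X :: "'w \<Rightarrow> real" and \<phi> :: "real^'d \<Rightarrow> real"
  assumes st: "0 \<le> s" "s < t" and X: "X \<in> borel_measurable (F s)" and [measurable]: "\<phi> \<in> borel_measurable borel"
  shows "indep_var borel X borel (\<lambda>\<omega>. \<phi> (W t \<omega> - W s \<omega>))"
proof -
  have [measurable]: "X \<in> borel_measurable M" "W t \<in> borel_measurable M" "W s \<in> borel_measurable M"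
    using filtration_measurable_imp_measurable[OF X] st by auto
  let ?X = "{X -` A \<inter> space M | A. A \<in> sets borel}"
  let ?V = "{(\<lambda>\<omega>. \<phi> (W t \<omega> - W s \<omega>)) -` A \<inter> space M | A. A \<in> sets borel}"
  have bm: "indep_set (sigma_sets (space M) (history M W s))
        {(\<lambda>\<omega>. W t \<omega> - W s \<omega>) -` A \<inter> space M | A. A \<in> sets borel}"
    using brownian st by (auto simp: brownian_motion_def)
  have "indep_set ?X ?V"
  proof (rule indep_setI)
    fix a b assume "a \<in> ?X" "b \<in> ?V"
    then obtain A C where A: "A \<in> sets borel" "a = X -` A \<inter> space M"
      and C: "C \<in> sets borel" "b = (\<lambda>\<omega>. \<phi> (W t \<omega> - W s \<omega>)) -` C \<inter> space M" by auto
    have a: "a \<in> sets (F s)" using measurable_sets[OF X A(1)] A(2) by (simp add: space_filtration)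
    obtain B where B: "B\<in>sigma_sets (space M) (history M W s)" "AE \<omega> in M. \<omega> \<in> a \<longleftrightarrow> \<omega> \<in> B"
      using filtration_set_eq_history_set[OF a] by blast
    have B': "B \<in> events" using B(1) indep_setD_ev1[OF bm] by auto
    have a': "a \<in> events" unfolding A(2) using A(1) by measurable
    have b': "b \<in> events" unfolding C(2) using C(1) by measurable
    have b: "b \<in> {(\<lambda>\<omega>. W t \<omega> - W s \<omega>) -` A \<inter> space M | A. A \<in> sets borel}"
      unfolding C(2) using C(1) by (intro CollectI exI[of _ "\<phi> -` C"]) (use measurable_sets[OF assms(4) C(1)] in auto)
    have "prob (a \<inter> b) = prob (B \<inter> b)"
      by (rule finite_measure_eq_AE) (use B(2) a' b' B' in auto)
    also have "\<dots> = prob B * prob b" by (rule indep_setD[OF bm B(1) b])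
    also have "prob B = prob a"
      by (rule finite_measure_eq_AE) (use B(2) a' B' in auto)
    finally show "prob (a \<inter> b) = prob a * prob b" .
  next
    show "?X \<subseteq> events" "?V \<subseteq> events" by auto
  qed
  then have "indep_set (sigma_sets (space M) ?X) (sigma_sets (space M) ?V)"
  proof (rule indep_set_sigma_sets)
    have "Int_stable {f -` A \<inter> space M | A. A \<in> sets borel}" for f :: "'w \<Rightarrow> real"
    proof (rule Int_stableI)
      fix a b assume "a \<in> {f -` A \<inter> space M | A. A \<in> sets borel}" "b \<in> {f -` A \<inter> space M | A. A \<in> sets borel}"
      then obtain A B where "A \<in> sets borel" "a = f -` A \<inter> space M" "B \<in> sets borel" "b = f -` B \<inter> space M"
        by blast
      then show "a \<inter> b \<in> {f -` A \<inter> space M | A. A \<in> sets borel}"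
        by (intro CollectI exI[of _ "A \<inter> B"]) auto
    qed
    then show "Int_stable ?X" "Int_stable ?V" by auto
  qed
  then show ?thesis unfolding indep_var_eq by auto
qed

lemma increment_moments:
  assumes st: "0 \<le> s" "s \<le> t"
  shows "sq_integrable M (\<lambda>\<omega>. (W t \<omega> - W s \<omega>) $ i)"
    and "expectation (\<lambda>\<omega>. (W t \<omega> - W s \<omega>) $ i) = 0"
    and "expectation (\<lambda>\<omega>. (W t \<omega> - W s \<omega>) $ i * (W t \<omega> - W s \<omega>) $ j) = (if i = j then t - s else 0)"
proof -
  have [measurable]: "W t \<in> borel_measurable M" "W s \<in> borel_measurable M" using st by auto
  have "sq_integrable M (\<lambda>\<omega>. (W t \<omega> - W s \<omega>) $ i) \<and>
    expectation (\<lambda>\<omega>. (W t \<omega> - W s \<omega>) $ i) = 0 \<and>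
    expectation (\<lambda>\<omega>. (W t \<omega> - W s \<omega>) $ i * (W t \<omega> - W s \<omega>) $ j) = (if i = j then t - s else 0)"
  proof (cases "s = t")
    case True then show ?thesis by (simp add: sq_integrable_zero)
  next
    case False
    then have lt: "s < t" and pos: "0 < sqrt (t - s)" using st by auto
    have D: "distributed M lborel (\<lambda>\<omega>. (W t \<omega> - W s \<omega>) $ i) (normal_density 0 (sqrt (t - s)))" for i
      using brownian st lt by (auto simp: brownian_motion_def)
    have sq: "sq_integrable M (\<lambda>\<omega>. (W t \<omega> - W s \<omega>) $ i)" for i
      using distributed_integrable[OF D, of "\<lambda>x. x\<^sup>2" i] integrable_normal_moment[OF pos, of 0 2]
      using distributed_measurable[OF D[of i]] by (simp add: sq_integrable_def del: vector_minus_component)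
    have mean: "expectation (\<lambda>\<omega>. (W t \<omega> - W s \<omega>) $ i) = 0" for i
      using normal_distributed_expectation[OF pos D] .
    have var: "expectation (\<lambda>\<omega>. (W t \<omega> - W s \<omega>) $ i * (W t \<omega> - W s \<omega>) $ i) = t - s"
      using normal_distributed_variance[OF pos D[of i]] mean st by (simp add: power2_eq_square)
    have "expectation (\<lambda>\<omega>. (W t \<omega> - W s \<omega>) $ i * (W t \<omega> - W s \<omega>) $ j) = 0" if "i \<noteq> j"
    proof -
      have "indep_vars (\<lambda>_. borel) (\<lambda>i \<omega>. (W t \<omega> - W s \<omega>) $ i) UNIV"
        using brownian st lt by (auto simp: brownian_motion_def)
      then have "indep_vars (\<lambda>_. borel) (\<lambda>i \<omega>. (W t \<omega> - W s \<omega>) $ i) {i, j}"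
        by (rule indep_vars_subset) simp
      then have "expectation (\<lambda>\<omega>. \<Prod>k\<in>{i,j}. (W t \<omega> - W s \<omega>) $ k) = (\<Prod>k\<in>{i,j}. expectation (\<lambda>\<omega>. (W t \<omega> - W s \<omega>) $ k))"
        by (intro indep_vars_lebesgue_integral)
            (auto intro!: sq_integrable_imp_integrable sq simp del: vector_minus_component)
      then show ?thesis using that mean by simp
    qed
    with sq mean var show ?thesis by auto
  qed
  then show "sq_integrable M (\<lambda>\<omega>. (W t \<omega> - W s \<omega>) $ i)"
    "expectation (\<lambda>\<omega>. (W t \<omega> - W s \<omega>) $ i) = 0"
    "expectation (\<lambda>\<omega>. (W t \<omega> - W s \<omega>) $ i * (W t \<omega> - W s \<omega>) $ j) = (if i = j then t - s else 0)"
    by auto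
qed

lemma increment_orthogonal:
  fixes X :: "'w \<Rightarrow> real"
  assumes st: "0 \<le> s" "s \<le> t" and X: "X \<in> borel_measurable (F s)" "integrable M X"
  shows "expectation (\<lambda>\<omega>. X \<omega> * (W t \<omega> - W s \<omega>) $ i) = 0"
proof (cases "s = t")
  case False
  then have "s < t" using st by simp
  have "expectation (\<lambda>\<omega>. X \<omega> * (W t \<omega> - W s \<omega>) $ i) = expectation X * expectation (\<lambda>\<omega>. (W t \<omega> - W s \<omega>) $ i)"
    by (rule indep_var_lebesgue_integral[OF increment_indep_var[OF st(1) \<open>s < t\<close> X(1)] X(2)])
      (auto intro!: sq_integrable_imp_integrable increment_moments st simp del: vector_minus_component)
  then show ?thesis using increment_moments[OF st] by simp
qed simp

lemma increment_product:
  fixes X :: "'w \<Rightarrow> real"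
  assumes st: "0 \<le> s" "s \<le> t" and X: "X \<in> borel_measurable (F s)" "integrable M X"
  shows "expectation (\<lambda>\<omega>. X \<omega> * ((W t \<omega> - W s \<omega>) $ i * (W t \<omega> - W s \<omega>) $ j)) =
    (if i = j then t - s else 0) * expectation X"
proof (cases "s = t")
  case False
  then have "s < t" using st by simp
  have "expectation (\<lambda>\<omega>. X \<omega> * ((W t \<omega> - W s \<omega>) $ i * (W t \<omega> - W s \<omega>) $ j)) =
      expectation X * expectation (\<lambda>\<omega>. (W t \<omega> - W s \<omega>) $ i * (W t \<omega> - W s \<omega>) $ j)"
    using integrable_inner[OF increment_moments(1)[OF st, of i] increment_moments(1)[OF st, of j]]
    by (intro indep_var_lebesgue_integral[OF increment_indep_var[OF st(1) \<open>s < t\<close> X(1),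
          of "\<lambda>x. x $ i * x $ j"] X(2)]) auto
  then show ?thesis using increment_moments[OF st] by simp
qed simp

definition inc :: "real \<Rightarrow> real \<Rightarrow> 'd \<Rightarrow> 'w \<Rightarrow> real" where
  "inc s t i \<omega> = W t \<omega> $ i - W s \<omega> $ i"

lemma inc_refl [simp]: "inc s s i \<omega> = 0"
  by (simp add: inc_def)

lemma W_adapted: "0 \<le> s \<Longrightarrow> s \<le> t \<Longrightarrow> W s \<in> borel_measurable (F t)"
proof (rule measurableI)
  fix A :: "(real^'d) set" assume "0 \<le> s" "s \<le> t" "A \<in> sets borel"
  then have "W s -` A \<inter> space M \<in> history M W t" by (auto simp: history_def)
  then show "W s -` A \<inter> space (F t) \<in> sets (F t)"
    unfolding sets_filtration space_filtration by blast
qed simp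

lemma inc_adapted: "0 \<le> s \<Longrightarrow> s \<le> t \<Longrightarrow> t \<le> r \<Longrightarrow> inc s t i \<in> borel_measurable (F r)"
proof -
  assume *: "0 \<le> s" "s \<le> t" "t \<le> r"
  then have [measurable]: "W s \<in> borel_measurable (F r)" "W t \<in> borel_measurable (F r)"
    using W_adapted by auto
  show ?thesis unfolding inc_def by measurable
qed

lemma inc_sq: "0 \<le> s \<Longrightarrow> s \<le> t \<Longrightarrow> sq_integrable M (inc s t i)"
  using increment_moments(1)[of s t i] by (simp add: inc_def[abs_def])

lemma inc_orthogonal:
  assumes "0 \<le> s" "s \<le> t" "X \<in> borel_measurable (F s)" "integrable M X"
  shows "expectation (\<lambda>\<omega>. X \<omega> * inc s t i \<omega>) = 0"
  using increment_orthogonal[OF assms, of i] by (simp add: inc_def)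

lemma inc_product:
  assumes "0 \<le> s" "s \<le> t" "X \<in> borel_measurable (F s)" "integrable M X"
  shows "expectation (\<lambda>\<omega>. X \<omega> * (inc s t i \<omega> * inc s t j \<omega>)) = (if i = j then t - s else 0) * expectation X"
  using increment_product[OF assms, of i j] by (simp add: inc_def)

lemma bounded_mult_sq:
  fixes X :: "'w \<Rightarrow> real"
  assumes "X \<in> borel_measurable M" "\<forall>\<omega>\<in>space M. \<bar>X \<omega>\<bar> \<le> C" "sq_integrable M Y"
  shows "sq_integrable M (\<lambda>\<omega>. X \<omega> * Y \<omega>)"
  using sq_integrable_scaleR_bounded[OF assms(3,1), of C] assms(2) by simp

text \<open>The common part of the two intervals carries all the correlation.  Every other pair of pieces
  consists of disjoint intervals, and the increment over the later one is independent of all the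
  remaining factors and has mean zero.\<close>

lemma inc_overlap_aux:
  fixes X X' :: "'w \<Rightarrow> real"
  assumes ab: "0 \<le> a" "a \<le> b" "a \<le> a'" "a' \<le> b'"
    and X: "X \<in> borel_measurable (F a)" "\<forall>\<omega>\<in>space M. \<bar>X \<omega>\<bar> \<le> C"
    and X': "X' \<in> borel_measurable (F a')" "\<forall>\<omega>\<in>space M. \<bar>X' \<omega>\<bar> \<le> C'"
  shows "expectation (\<lambda>\<omega>. (X \<omega> * inc a b i \<omega>) * (X' \<omega> * inc a' b' j \<omega>)) =
    (if i = j then measure lborel ({a<..b} \<inter> {a'<..b'}) else 0) * expectation (\<lambda>\<omega>. X \<omega> * X' \<omega>)"
proof -
  have Xm: "X \<in> borel_measurable M" "X' \<in> borel_measurable M"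
    using X X' filtration_measurable_imp_measurable by auto
  have XF: "X \<in> borel_measurable (F r)" if "a \<le> r" for r
    using filtration_measurable_mono[OF X(1) that] .
  have X'F: "X' \<in> borel_measurable (F r)" if "a' \<le> r" for r
    using filtration_measurable_mono[OF X'(1) that] .
  have sX: "sq_integrable M (\<lambda>\<omega>. X \<omega> * inc s t k \<omega>)" if "0 \<le> s" "s \<le> t" for s t k
    by (rule bounded_mult_sq[OF Xm(1) X(2) inc_sq[OF that]])
  have sX': "sq_integrable M (\<lambda>\<omega>. X' \<omega> * inc s t k \<omega>)" if "0 \<le> s" "s \<le> t" for s t k
    by (rule bounded_mult_sq[OF Xm(2) X'(2) inc_sq[OF that]])
  have sq0: "sq_integrable M X" "sq_integrable M X'"
    using sq_integrable_bounded[OF Xm(1), of C] sq_integrable_bounded[OF Xm(2), of C'] X(2) X'(2) by auto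
  have int: "integrable M (\<lambda>\<omega>. (X \<omega> * inc s t k \<omega>) * (X' \<omega> * inc s' t' k' \<omega>))"
    if "0 \<le> s" "s \<le> t" "0 \<le> s'" "s' \<le> t'" for s t k s' t' k'
    using integrable_inner[OF sX[OF that(1,2)] sX'[OF that(3,4)]] by simp
  have int1: "integrable M (\<lambda>\<omega>. (X \<omega> * inc s t k \<omega>) * X' \<omega>)"
    if "0 \<le> s" "s \<le> t" for s t k
    using integrable_inner[OF sX[OF that] sq0(2)] by simp
  have int2: "integrable M (\<lambda>\<omega>. X \<omega> * (X' \<omega> * inc s t k \<omega>))"
    if "0 \<le> s" "s \<le> t" for s t k
    using integrable_inner[OF sq0(1) sX'[OF that]] by simp
  have int0: "integrable M (\<lambda>\<omega>. X \<omega> * X' \<omega>)"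
    using integrable_inner[OF sq0] by simp
  have past: "expectation (\<lambda>\<omega>. (X \<omega> * inc s t k \<omega>) * (X' \<omega> * inc s' t' k' \<omega>)) = 0"
    if "a \<le> s" "s \<le> t" "t \<le> s'" "a' \<le> s'" "s' \<le> t'" for s t k s' t' k'
  proof -
    have [measurable]: "X \<in> borel_measurable (F s')" "X' \<in> borel_measurable (F s')" "inc s t k \<in>
        borel_measurable (F s')"
      using XF[of s'] X'F[of s'] inc_adapted[of s t s' k] ab that by auto
    have "expectation (\<lambda>\<omega>. ((X \<omega> * inc s t k \<omega>) * X' \<omega>) * inc s' t' k' \<omega>) = 0"
      by (rule inc_orthogonal) (use that ab int1 in auto)
    then show ?thesis by (simp add: mult.assoc)
  qed
  show ?thesis
  proof (cases "b \<le> a'")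
    case True
    then have "{a<..b} \<inter> {a'<..b'} = {}" by auto
    then show ?thesis using past[of a b a' b' i j] True ab by simp
  next
    case False
    define m where "m = min b b'"
    have m: "a' \<le> m" "m \<le> b" "m \<le> b'" using False ab by (auto simp: m_def)
    have "{a<..b} \<inter> {a'<..b'} = {a'<..m}" using ab False by (auto simp: m_def)
    then have ov: "measure lborel ({a<..b} \<inter> {a'<..b'}) = m - a'" using m by simp
    have XX'F: "(\<lambda>\<omega>. X \<omega> * X' \<omega>) \<in> borel_measurable (F a')"
      using XF[OF ab(3)] X'(1) by measurable
    have t1: "expectation (\<lambda>\<omega>. (X \<omega> * inc a a' i \<omega>) * (X' \<omega> * inc a' b' j \<omega>)) = 0"
      by (rule past) (use ab in auto)
    have t2: "expectation (\<lambda>\<omega>. (X \<omega> * inc a' m i \<omega>) * (X' \<omega> * inc a' m j \<omega>)) =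
        (if i = j then m - a' else 0) * expectation (\<lambda>\<omega>. X \<omega> * X' \<omega>)"
      using inc_product[OF _ m(1) XX'F int0, of i j] ab by (simp add: mult_ac)
    have t3: "expectation (\<lambda>\<omega>. (X \<omega> * inc a' m i \<omega>) * (X' \<omega> * inc m b' j \<omega>)) = 0"
      by (rule past) (use ab m in auto)
    have t4: "expectation (\<lambda>\<omega>. (X \<omega> * inc m b i \<omega>) * (X' \<omega> * inc a' b' j \<omega>)) = 0"
    proof (cases "b \<le> b'")
      case True then show ?thesis by (simp add: m_def)
    next
      case False
      then have mb: "m = b'" by (simp add: m_def)
      have [measurable]: "X \<in> borel_measurable (F m)" "X' \<in> borel_measurable (F m)" "inc a' b' j \<in>
          borel_measurable (F m)"
        using XF[of m] X'F[of m] inc_adapted[of a' b' m j] ab m mb by auto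
      have "expectation (\<lambda>\<omega>. (X \<omega> * (X' \<omega> * inc a' b' j \<omega>)) * inc m b i \<omega>) = 0"
        by (rule inc_orthogonal) (use m ab int2 in auto)
      then show ?thesis by (simp add: mult_ac)
    qed
    have "expectation (\<lambda>\<omega>. (X \<omega> * inc a b i \<omega>) * (X' \<omega> * inc a' b' j \<omega>)) =
      expectation (\<lambda>\<omega>. (X \<omega> * inc a a' i \<omega>) * (X' \<omega> * inc a' b' j \<omega>)
        + (X \<omega> * inc a' m i \<omega>) * (X' \<omega> * inc a' m j \<omega>)
        + (X \<omega> * inc a' m i \<omega>) * (X' \<omega> * inc m b' j \<omega>)
        + (X \<omega> * inc m b i \<omega>) * (X' \<omega> * inc a' b' j \<omega>))"
      by (intro Bochner_Integration.integral_cong refl) (simp add: inc_def algebra_simps)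
    also have "\<dots> = (if i = j then m - a' else 0) * expectation (\<lambda>\<omega>. X \<omega> * X' \<omega>)"
      using t1 t2 t3 t4 int ab m by simp
    finally show ?thesis using ov by simp
  qed
qed

lemma inc_overlap:
  fixes X X' :: "'w \<Rightarrow> real"
  assumes "0 \<le> a" "a \<le> b" "0 \<le> a'" "a' \<le> b'"
    and "X \<in> borel_measurable (F a)" "\<forall>\<omega>\<in>space M. \<bar>X \<omega>\<bar> \<le> C"
    and "X' \<in> borel_measurable (F a')" "\<forall>\<omega>\<in>space M. \<bar>X' \<omega>\<bar> \<le> C'"
  shows "expectation (\<lambda>\<omega>. (X \<omega> * inc a b i \<omega>) * (X' \<omega> * inc a' b' j \<omega>)) =
    (if i = j then measure lborel ({a<..b} \<inter> {a'<..b'}) else 0) * expectation (\<lambda>\<omega>. X \<omega> * X' \<omega>)"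
proof (cases "a \<le> a'")
  case True then show ?thesis using inc_overlap_aux assms by blast
next
  case False
  then have "expectation (\<lambda>\<omega>. (X' \<omega> * inc a' b' j \<omega>) * (X \<omega> * inc a b i \<omega>)) =
    (if j = i then measure lborel ({a'<..b'} \<inter> {a<..b}) else 0) * expectation (\<lambda>\<omega>. X' \<omega> * X \<omega>)"
    using assms by (intro inc_overlap_aux) auto
  then show ?thesis by (simp add: mult.commute Int_commute eq_commute[of j])
qed

section \<open>The Ito integral\<close>

lemma matrix_increment_nth:
  "((c::real^'d^'n) *v (W b \<omega> - W a \<omega>)) $ k = (\<Sum>l\<in>UNIV. c $ k $ l * inc a b l \<omega>)"
  by (simp add: matrix_vector_mult_def inc_def)

lemma bounded_entry:
  fixes c :: "'w \<Rightarrow> real^'d^'n"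
  assumes "\<forall>\<omega>\<in>space M. norm (c \<omega>) \<le> C"
  shows "\<forall>\<omega>\<in>space M. \<bar>c \<omega> $ k $ l\<bar> \<le> C"
proof
  fix \<omega> assume "\<omega> \<in> space M"
  have "\<bar>c \<omega> $ k $ l\<bar> \<le> norm (c \<omega> $ k)" by (rule component_le_norm_cart)
  also have "\<dots> \<le> norm (c \<omega>)" by (rule Finite_Cartesian_Product.norm_nth_le)
  finally show "\<bar>c \<omega> $ k $ l\<bar> \<le> C" using assms \<open>\<omega> \<in> space M\<close> by force
qed

lemma step_sq:
  fixes c :: "'w \<Rightarrow> real^'d^'n"
  assumes "0 \<le> a" "a \<le> b" "c \<in> borel_measurable M" "\<forall>\<omega>\<in>space M. norm (c \<omega>) \<le> C"
  shows "sq_integrable M (\<lambda>\<omega>. c \<omega> *v (W b \<omega> - W a \<omega>))"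
  unfolding matrix_increment_nth
proof (rule sq_integrable_vecI, unfold matrix_increment_nth, rule sq_integrable_sum)
  fix k l
  show "sq_integrable M (\<lambda>\<omega>. c \<omega> $ k $ l * inc a b l \<omega>)"
    by (rule bounded_mult_sq[OF _ bounded_entry[OF assms(4)] inc_sq]) (use assms in auto)
qed

text \<open>Both sides are the length of the overlap of the two intervals times the expected inner product of
  the coefficients.\<close>

lemma step_product:
  fixes c c' :: "'w \<Rightarrow> real^'d^'n"
  assumes ab: "0 \<le> a" "a \<le> b" "b \<le> T" "0 \<le> a'" "a' \<le> b'" "b' \<le> T"
    and c: "c \<in> borel_measurable (F a)" "\<forall>\<omega>\<in>space M. norm (c \<omega>) \<le> C"
    and c': "c' \<in> borel_measurable (F a')" "\<forall>\<omega>\<in>space M. norm (c' \<omega>) \<le> C'"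
  shows "expectation (\<lambda>\<omega>. (c \<omega> *v (W b \<omega> - W a \<omega>)) \<bullet> (c' \<omega> *v (W b' \<omega> - W a' \<omega>))) =
    (\<integral>(t, \<omega>). (indicator {a<..b} t *\<^sub>R c \<omega>) \<bullet> (indicator {a'<..b'} t *\<^sub>R c' \<omega>) \<partial>(interval_measure 0 T \<Otimes>\<^sub>M M))"
proof -
  interpret prob_time M "interval_measure 0 T" by (rule prob_time_interval) unfold_locales
  have cm [measurable]: "c \<in> borel_measurable M" "c' \<in> borel_measurable M"
    using c c' filtration_measurable_imp_measurable by auto
  have cF: "(\<lambda>\<omega>. c \<omega> $ k $ l) \<in> borel_measurable (F a)" "(\<lambda>\<omega>. c' \<omega> $ k $ l) \<in> borel_measurable (F a')" for k l
    using c(1) c'(1) by measurable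
  define ov where "ov = measure lborel ({a<..b} \<inter> {a'<..b'})"
  have s: "sq_integrable M (\<lambda>\<omega>. c \<omega> $ k $ l * inc a b l \<omega>)" "sq_integrable M (\<lambda>\<omega>. c' \<omega> $ k $ l * inc a' b' l \<omega>)"
      for k l
    by (rule bounded_mult_sq[OF _ bounded_entry[OF c(2)] inc_sq]
        bounded_mult_sq[OF _ bounded_entry[OF c'(2)] inc_sq]; use ab in simp)+
  have i: "integrable M (\<lambda>\<omega>. (c \<omega> $ k $ l * inc a b l \<omega>) * (c' \<omega> $ k $ l' * inc a' b' l' \<omega>))" for k l l'
    using integrable_inner[OF s] by simp
  have sqc: "sq_integrable M c" "sq_integrable M c'"
    using c(2) c'(2) by (auto intro!: sq_integrable_bounded cm)
  have icc: "integrable M (\<lambda>\<omega>. c \<omega> $ k $ l * c' \<omega> $ k $ l)" for k l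
  proof -
    have "sq_integrable M (\<lambda>\<omega>. c \<omega> $ k $ l)"
      by (rule sq_integrable_bounded[where C = C]) (use bounded_entry[OF c(2)] in auto)
    moreover have "sq_integrable M (\<lambda>\<omega>. c' \<omega> $ k $ l)"
      by (rule sq_integrable_bounded[where C = C']) (use bounded_entry[OF c'(2)] in auto)
    ultimately have "sq_integrable M (\<lambda>\<omega>. c \<omega> $ k $ l)" "sq_integrable M (\<lambda>\<omega>. c' \<omega> $ k $ l)"
      by auto
    from integrable_inner[OF this] show ?thesis by simp
  qed
  have "expectation (\<lambda>\<omega>. (c \<omega> *v (W b \<omega> - W a \<omega>)) \<bullet> (c' \<omega> *v (W b' \<omega> - W a' \<omega>))) =
    expectation (\<lambda>\<omega>. \<Sum>k\<in>UNIV. \<Sum>l\<in>UNIV. \<Sum>l'\<in>UNIV. (c \<omega> $ k $ l * inc a b l \<omega>) * (c' \<omega> $ k $ l' * inc a' b' l' \<omega>))"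
    by (simp add: inner_vec_def matrix_increment_nth sum_product)
  also have "\<dots> = (\<Sum>k\<in>UNIV. \<Sum>l\<in>UNIV. \<Sum>l'\<in>UNIV. expectation
      (\<lambda>\<omega>. (c \<omega> $ k $ l * inc a b l \<omega>) * (c' \<omega> $ k $ l' * inc a' b' l' \<omega>)))"
    using i by (simp add: Bochner_Integration.integral_sum Bochner_Integration.integrable_sum)
  also have "\<dots> = (\<Sum>k\<in>UNIV. \<Sum>l\<in>UNIV. \<Sum>l'\<in>UNIV. (if l = l' then ov else 0) * expectation
      (\<lambda>\<omega>. c \<omega> $ k $ l * c' \<omega> $ k $ l'))"
    unfolding ov_def
    by (intro sum.cong refl inc_overlap[OF ab(1,2,4,5) cF(1) bounded_entry[OF c(2)] cF(2) bounded_entry[OF c'(2)]])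
  also have "\<dots> = (\<Sum>k\<in>UNIV. \<Sum>l\<in>UNIV. ov * expectation (\<lambda>\<omega>. c \<omega> $ k $ l * c' \<omega> $ k $ l))"
    by (simp add: if_distrib[of "\<lambda>x. x * _"] cong: if_cong)
  also have "\<dots> = ov * expectation (\<lambda>\<omega>. c \<omega> \<bullet> c' \<omega>)"
    using icc by (simp add: inner_vec_def sum_distrib_left Bochner_Integration.integral_sum
      Bochner_Integration.integrable_sum)
  also have "\<dots> = (\<integral>(t, \<omega>). (indicator {a<..b} t *\<^sub>R c \<omega>) \<bullet>
      (indicator {a'<..b'} t *\<^sub>R c' \<omega>) \<partial>(interval_measure 0 T \<Otimes>\<^sub>M M))"
  proof -
    have [measurable]: "{a<..b} \<in> sets (borel :: real measure)" by simp
    have si: "sq_integrable (interval_measure 0 T \<Otimes>\<^sub>M M) (\<lambda>(t, \<omega>). indicator {p<..q} t *\<^sub>R e \<omega>)"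
      if [measurable]: "e \<in> borel_measurable M" and "\<forall>\<omega>\<in>space M. norm (e \<omega>) \<le> C" for e :: "'w \<Rightarrow> real^'d^'n" and p q C
    proof (rule LMf.sq_integrable_bounded)
      show "(\<lambda>(t, \<omega>). indicator {p<..q} t *\<^sub>R e \<omega>) \<in> borel_measurable (interval_measure 0 T \<Otimes>\<^sub>M M)"
        by (rule step_process_measurable[OF that(1)])
      show "AE x in interval_measure 0 T \<Otimes>\<^sub>M M. norm (case x of (t, \<omega>) \<Rightarrow> indicator {p<..q} t *\<^sub>R e \<omega>) \<le> \<bar>C\<bar>"
        using that(2) by (intro AE_I2) (force simp: space_pair_measure indicator_def)
    qed
    have "(\<integral>(t, \<omega>). (indicator {a<..b} t *\<^sub>R c \<omega>) \<bullet> (indicator {a'<..b'} t *\<^sub>R c' \<omega>) \<partial>(interval_measure 0 T \<Otimes>\<^sub>M M))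
      = (\<integral>t. (\<integral>\<omega>. (indicator {a<..b} t *\<^sub>R c \<omega>) \<bullet> (indicator {a'<..b'} t *\<^sub>R c' \<omega>) \<partial>M) \<partial>interval_measure 0 T)"
      using integrable_inner[OF si[OF cm(1) c(2), of a b] si[OF cm(2) c'(2), of a' b']]
      by (subst LM.integral_fst) (simp_all add: split_beta')
    also have "\<dots> = (\<integral>t. indicator ({a<..b} \<inter> {a'<..b'}) t * expectation (\<lambda>\<omega>. c \<omega> \<bullet> c' \<omega>) \<partial>interval_measure 0 T)"
      by (intro Bochner_Integration.integral_cong refl) (auto simp: indicator_def)
    also have "\<dots> = measure (interval_measure 0 T) ({a<..b} \<inter> {a'<..b'}) * expectation (\<lambda>\<omega>. c \<omega> \<bullet> c' \<omega>)"
    proof -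
      have "{a<..b} \<inter> {a'<..b'} \<inter> {0..T} = {a<..b} \<inter> {a'<..b'}" using ab by auto
      then show ?thesis by (simp del: Int_greaterThanAtMost)
    qed
    also have "measure (interval_measure 0 T) ({a<..b} \<inter> {a'<..b'}) = ov"
      unfolding ov_def using ab by (intro measure_restrict_space) auto
    finally show ?thesis by simp
  qed
  finally show ?thesis .
qed

lemma simple_integrand_times:
  assumes "simple_integrand M F T m \<tau> c"
  shows "i \<le> m \<Longrightarrow> 0 \<le> \<tau> i" "i \<le> m \<Longrightarrow> \<tau> i \<le> T" "i < m \<Longrightarrow> \<tau> i \<le> \<tau> (Suc i)"
proof -
  have mono: "i < m \<Longrightarrow> \<tau> i \<le> \<tau> (Suc i)" for i using assms by (simp add: simple_integrand_def)
  then show "i < m \<Longrightarrow> \<tau> i \<le> \<tau> (Suc i)" .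
  have "i \<le> m \<Longrightarrow> \<tau> 0 \<le> \<tau> i" for i
  proof (induction i)
    case (Suc i) then show ?case using mono[of i] by simp
  qed simp
  then show "i \<le> m \<Longrightarrow> 0 \<le> \<tau> i" using assms by (force simp: simple_integrand_def)
  assume "i \<le> m" then have "\<tau> i \<le> \<tau> m"
  proof (induction i rule: inc_induct)
    case (step n) then show ?case using mono[of n] by simp
  qed simp
  then show "\<tau> i \<le> T" using assms by (simp add: simple_integrand_def)
qed

lemma simple_integrand_bound:
  assumes "simple_integrand M F T m \<tau> c"
  shows "\<exists>C. \<forall>i<m. \<forall>\<omega>\<in>space M. norm (c i \<omega>) \<le> C"
  using assms by (auto simp: simple_integrand_def)

lemma simple_integrand_adapted:
  "simple_integrand M F T m \<tau> c \<Longrightarrow> i < m \<Longrightarrow> c i \<in> borel_measurable (F (\<tau> i))"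
  by (simp add: simple_integrand_def)

lemma simple_ito_sq:
  assumes "simple_integrand M F T m \<tau> c" "0 \<le> t"
  shows "sq_integrable M (simple_ito W m \<tau> c t)"
proof -
  obtain C where C: "\<And>i. i < m \<Longrightarrow> \<forall>\<omega>\<in>space M. norm (c i \<omega>) \<le> C"
    using simple_integrand_bound[OF assms(1)] by blast
  show ?thesis
    unfolding simple_ito_def[abs_def]
  proof (rule sq_integrable_sum)
    fix i assume "i \<in> {..<m}"
    then have i: "i < m" by simp
    show "sq_integrable M (\<lambda>\<omega>. c i \<omega> *v (W (min t (\<tau> (Suc i))) \<omega> - W (min t (\<tau> i)) \<omega>))"
      using i simple_integrand_times[OF assms(1), of i] simple_integrand_times(1)[OF assms(1), of "Suc i"] assms(2)
      by (intro step_sq[OF _ _ _ C[OF i]]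
          filtration_measurable_imp_measurable[OF simple_integrand_adapted[OF assms(1) i]]) auto
  qed
qed

lemma simple_process_sq:
  assumes "simple_integrand M F T m \<tau> c"
  shows "sq_integrable (interval_measure 0 T \<Otimes>\<^sub>M M) (\<lambda>(t, \<omega>). simple_process m \<tau> c t \<omega>)"
    and "\<And>i. i < m \<Longrightarrow>
      sq_integrable (interval_measure 0 T \<Otimes>\<^sub>M M) (\<lambda>(t, \<omega>). indicator {\<tau> i<..\<tau> (Suc i)} t *\<^sub>R c i \<omega>)"
proof -
  interpret prob_time M "interval_measure 0 T" by (rule prob_time_interval) unfold_locales
  obtain C where C: "\<And>i. i < m \<Longrightarrow> \<forall>\<omega>\<in>space M. norm (c i \<omega>) \<le> C"
    using simple_integrand_bound[OF assms(1)] by blast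
  show *: "sq_integrable (interval_measure 0 T \<Otimes>\<^sub>M M) (\<lambda>(t, \<omega>). indicator {\<tau> i<..\<tau> (Suc i)} t *\<^sub>R c i \<omega>)"
    if i: "i < m" for i
  proof (rule LMf.sq_integrable_bounded)
    have [measurable]: "c i \<in> borel_measurable M"
      by (rule filtration_measurable_imp_measurable[OF simple_integrand_adapted[OF assms(1) i]])
    show "(\<lambda>(t, \<omega>). indicator {\<tau> i<..\<tau> (Suc i)} t *\<^sub>R c i \<omega>) \<in> borel_measurable (interval_measure 0 T \<Otimes>\<^sub>M M)"
      by (rule step_process_measurable) measurable
    show "AE x in interval_measure 0 T \<Otimes>\<^sub>M M.
        norm (case x of (t, \<omega>) \<Rightarrow> indicator {\<tau> i<..\<tau> (Suc i)} t *\<^sub>R c i \<omega>) \<le> \<bar>C\<bar>"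
      using C[OF i] by (intro AE_I2) (force simp: space_pair_measure indicator_def)
  qed
  have "sq_integrable (interval_measure 0 T \<Otimes>\<^sub>M M)
      (\<lambda>x. \<Sum>i<m. case x of (t, \<omega>) \<Rightarrow> indicator {\<tau> i<..\<tau> (Suc i)} t *\<^sub>R c i \<omega>)"
    by (rule sq_integrable_sum) (use * in simp)
  then show "sq_integrable (interval_measure 0 T \<Otimes>\<^sub>M M) (\<lambda>(t, \<omega>). simple_process m \<tau> c t \<omega>)"
    by (simp add: simple_process_def split_beta')
qed

lemma simple_ito_product:
  fixes c c' :: "nat \<Rightarrow> 'w \<Rightarrow> real^'d^'n"
  assumes S: "simple_integrand M F T m \<tau> c" and S': "simple_integrand M F T m' \<tau>' c'"
  shows "expectation (\<lambda>\<omega>. simple_ito W m \<tau> c T \<omega> \<bullet> simple_ito W m' \<tau>' c' T \<omega>) =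
    (\<integral>(t, \<omega>). simple_process m \<tau> c t \<omega> \<bullet> simple_process m' \<tau>' c' t \<omega> \<partial>(interval_measure 0 T \<Otimes>\<^sub>M M))"
proof -
  obtain C where C: "\<And>i. i < m \<Longrightarrow> \<forall>\<omega>\<in>space M. norm (c i \<omega>) \<le> C"
    using simple_integrand_bound[OF S] by blast
  obtain C' where C': "\<And>i. i < m' \<Longrightarrow> \<forall>\<omega>\<in>space M. norm (c' i \<omega>) \<le> C'"
    using simple_integrand_bound[OF S'] by blast
  have step_T: "simple_ito W m \<tau> c T \<omega> = (\<Sum>i<m. c i \<omega> *v (W (\<tau> (Suc i)) \<omega> - W (\<tau> i) \<omega>))"
    if "simple_integrand M F T m \<tau> c" for m \<tau> \<omega> and c :: "nat \<Rightarrow> 'w \<Rightarrow> real^'d^'n"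
    unfolding simple_ito_def
  proof (intro sum.cong refl)
    fix i assume "i \<in> {..<m}"
    then have "min T (\<tau> (Suc i)) = \<tau> (Suc i)" "min T (\<tau> i) = \<tau> i"
      using simple_integrand_times(2)[OF that, of i] simple_integrand_times(2)[OF that, of "Suc i"] by auto
    then show "c i \<omega> *v (W (min T (\<tau> (Suc i))) \<omega> - W (min T (\<tau> i)) \<omega>) =
        c i \<omega> *v (W (\<tau> (Suc i)) \<omega> - W (\<tau> i) \<omega>)" by simp
  qed
  have sq: "sq_integrable M (\<lambda>\<omega>. c i \<omega> *v (W (\<tau> (Suc i)) \<omega> - W (\<tau> i) \<omega>))"
    if "simple_integrand M F T m \<tau> c" "i < m" "\<forall>\<omega>\<in>space M. norm (c i \<omega>) \<le> C"
    for m \<tau> i C and c :: "nat \<Rightarrow> 'w \<Rightarrow> real^'d^'n"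
    using that(2) simple_integrand_times[OF that(1), of i]
    by (intro step_sq[OF _ _ _ that(3)]
        filtration_measurable_imp_measurable[OF simple_integrand_adapted[OF that(1,2)]]) auto
  have int: "integrable M (\<lambda>\<omega>. (c i \<omega> *v (W (\<tau> (Suc i)) \<omega> - W (\<tau> i) \<omega>)) \<bullet>
      (c' j \<omega> *v (W (\<tau>' (Suc j)) \<omega> - W (\<tau>' j) \<omega>)))"
    if "i < m" "j < m'" for i j
    by (rule integrable_inner[OF sq[OF S that(1) C[OF that(1)]] sq[OF S' that(2) C'[OF that(2)]]])
  have int2: "integrable (interval_measure 0 T \<Otimes>\<^sub>M M)
      (\<lambda>x. case x of (t, \<omega>) \<Rightarrow> (indicator {\<tau> i<..\<tau> (Suc i)} t *\<^sub>R c i \<omega>) \<bullet>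
      (indicator {\<tau>' j<..\<tau>' (Suc j)} t *\<^sub>R c' j \<omega>))"
    if "i < m" "j < m'" for i j
    using integrable_inner[OF simple_process_sq(2)[OF S that(1)] simple_process_sq(2)[OF S' that(2)]]
    by (simp add: split_beta')
  have "expectation (\<lambda>\<omega>. simple_ito W m \<tau> c T \<omega> \<bullet> simple_ito W m' \<tau>' c' T \<omega>) =
    expectation (\<lambda>\<omega>. \<Sum>j<m'. \<Sum>i<m. (c i \<omega> *v (W (\<tau> (Suc i)) \<omega> - W (\<tau> i) \<omega>)) \<bullet>
    (c' j \<omega> *v (W (\<tau>' (Suc j)) \<omega> - W (\<tau>' j) \<omega>)))"
    unfolding step_T[OF S] step_T[OF S'] inner_sum_left inner_sum_right ..
  also have "\<dots> = (\<Sum>j<m'. \<Sum>i<m. expectation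
      (\<lambda>\<omega>. (c i \<omega> *v (W (\<tau> (Suc i)) \<omega> - W (\<tau> i) \<omega>)) \<bullet> (c' j \<omega> *v (W (\<tau>' (Suc j)) \<omega> - W (\<tau>' j) \<omega>))))"
    by (rule integral_double_sum) (use int in simp)
  also have "\<dots> = (\<Sum>j<m'. \<Sum>i<m. \<integral>(t, \<omega>). (indicator {\<tau> i<..\<tau> (Suc i)} t *\<^sub>R c i \<omega>) \<bullet>
      (indicator {\<tau>' j<..\<tau>' (Suc j)} t *\<^sub>R c' j \<omega>) \<partial>(interval_measure 0 T \<Otimes>\<^sub>M M))"
    using simple_integrand_times[OF S] simple_integrand_times[OF S'] C C'
      simple_integrand_adapted[OF S] simple_integrand_adapted[OF S']
    by (intro sum.cong refl step_product[where C = C and C' = C']) auto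
  also have "\<dots> = (\<integral>x. (\<Sum>j<m'. \<Sum>i<m. case x of (t, \<omega>) \<Rightarrow> (indicator {\<tau> i<..\<tau> (Suc i)} t *\<^sub>R c i \<omega>) \<bullet>
      (indicator {\<tau>' j<..\<tau>' (Suc j)} t *\<^sub>R c' j \<omega>)) \<partial>(interval_measure 0 T \<Otimes>\<^sub>M M))"
    by (rule integral_double_sum[symmetric]) (use int2 in simp)
  also have "\<dots> = (\<integral>(t, \<omega>). simple_process m \<tau> c t \<omega> \<bullet> simple_process m' \<tau>' c' t \<omega> \<partial>(interval_measure 0 T \<Otimes>\<^sub>M M))"
    by (intro Bochner_Integration.integral_cong refl)
      (simp only: simple_process_def inner_sum_left inner_sum_right split_beta')
  finally show ?thesis .
qed

text \<open>Moving every partition point before \<open>t\<close> to \<open>t\<close> writes the integral over \<open>[t, T]\<close> as a sum of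
  increments after \<open>t\<close>, each with a coefficient known when it begins.\<close>

lemma simple_ito_orthogonal:
  fixes c :: "nat \<Rightarrow> 'w \<Rightarrow> real^'d^'n"
  assumes S: "simple_integrand M F T m \<tau> c" and t: "0 \<le> t" "t \<le> T"
    and X: "X \<in> borel_measurable (F t)" "sq_integrable M X"
  shows "expectation (\<lambda>\<omega>. (simple_ito W m \<tau> c T \<omega> - simple_ito W m \<tau> c t \<omega>) \<bullet> X \<omega>) = 0"
proof -
  obtain C where C: "\<And>i. i < m \<Longrightarrow> \<forall>\<omega>\<in>space M. norm (c i \<omega>) \<le> C"
    using simple_integrand_bound[OF S] by blast
  have diff: "simple_ito W m \<tau> c T \<omega> - simple_ito W m \<tau> c t \<omega> =
      (\<Sum>i<m. c i \<omega> *v (W (max t (\<tau> (Suc i))) \<omega> - W (max t (\<tau> i)) \<omega>))" for \<omega>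
    unfolding simple_ito_def sum_subtractf[symmetric]
  proof (intro sum.cong refl)
    fix i assume "i \<in> {..<m}"
    then have "\<tau> (Suc i) \<le> T" "\<tau> i \<le> T"
      using simple_integrand_times(2)[OF S, of i] simple_integrand_times(2)[OF S, of "Suc i"] by auto
    then have "W (min T (\<tau> (Suc i))) \<omega> - W (min T (\<tau> i)) \<omega> - (W (min t (\<tau> (Suc i))) \<omega> - W (min t (\<tau> i)) \<omega>)
       = W (max t (\<tau> (Suc i))) \<omega> - W (max t (\<tau> i)) \<omega>"
      by (auto simp: min_def max_def)
    then show "c i \<omega> *v (W (min T (\<tau> (Suc i))) \<omega> - W (min T (\<tau> i)) \<omega>) -
        c i \<omega> *v (W (min t (\<tau> (Suc i))) \<omega> - W (min t (\<tau> i)) \<omega>) =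
        c i \<omega> *v (W (max t (\<tau> (Suc i))) \<omega> - W (max t (\<tau> i)) \<omega>)"
      unfolding matrix_vector_mult_diff_distrib[symmetric] by simp
  qed
  have one: "integrable M (\<lambda>\<omega>. (X \<omega> $ k * c i \<omega> $ k $ l) * inc (max t (\<tau> i)) (max t (\<tau> (Suc i))) l \<omega>) \<and>
      expectation (\<lambda>\<omega>. (X \<omega> $ k * c i \<omega> $ k $ l) * inc (max t (\<tau> i)) (max t (\<tau> (Suc i))) l \<omega>) = 0"
    if i: "i < m" for i k l
  proof -
    let ?a = "max t (\<tau> i)" and ?b = "max t (\<tau> (Suc i))"
    have ab: "0 \<le> ?a" "?a \<le> ?b" using t simple_integrand_times[OF S, of i] i by auto
    have [measurable]: "X \<in> borel_measurable (F ?a)" "c i \<in> borel_measurable (F ?a)"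
      using filtration_measurable_mono[OF X(1), of ?a]
        filtration_measurable_mono[OF simple_integrand_adapted[OF S i], of ?a] by auto
    have sq: "sq_integrable M (\<lambda>\<omega>. c i \<omega> $ k $ l * X \<omega> $ k)"
      by (rule bounded_mult_sq[OF filtration_measurable_imp_measurable bounded_entry[OF C[OF i]]
          sq_integrable_nth[OF X(2)]])
        measurable
    have sq': "sq_integrable M (\<lambda>\<omega>. X \<omega> $ k * c i \<omega> $ k $ l)"
      using sq by (simp add: mult.commute)
    show ?thesis
      using integrable_inner[OF sq' inc_sq[OF ab, of l]] sq_integrable_imp_integrable[OF sq']
      by (intro conjI inc_orthogonal[OF ab]) (simp_all add: mult.commute)
  qed
  have "expectation (\<lambda>\<omega>. (simple_ito W m \<tau> c T \<omega> - simple_ito W m \<tau> c t \<omega>) \<bullet> X \<omega>) =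
     expectation (\<lambda>\<omega>. \<Sum>i<m. \<Sum>k\<in>UNIV. \<Sum>l\<in>UNIV. (X \<omega> $ k * c i \<omega> $ k $ l) * inc (max t (\<tau> i)) (max t (\<tau> (Suc i))) l \<omega>)"
    unfolding diff inner_sum_left
    by (simp add: inner_vec_def matrix_increment_nth sum_distrib_left mult_ac)
  also have "\<dots> = 0"
    using one by (simp add: Bochner_Integration.integral_sum Bochner_Integration.integrable_sum)
  finally show ?thesis .
qed

end

text \<open>The approximation that defines the integral, with the distance of the integrands written as one
  integral over the product space, as \<open>sq_integrable_limit\<close> takes it.\<close>

definition ito_approximation ::
  "'w measure \<Rightarrow> (real \<Rightarrow> 'w \<Rightarrow> real^'d) \<Rightarrow> real \<Rightarrow> (real \<Rightarrow> 'w \<Rightarrow> real^'d^'n) \<Rightarrow> (real \<Rightarrow> 'w \<Rightarrow> real^'n) \<Rightarrow>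
    (nat \<Rightarrow> nat) \<Rightarrow> (nat \<Rightarrow> nat \<Rightarrow> real) \<Rightarrow> (nat \<Rightarrow> nat \<Rightarrow> 'w \<Rightarrow> real^'d^'n) \<Rightarrow> bool" where
  "ito_approximation M W T h I m \<tau> c \<longleftrightarrow>
    (\<forall>j. simple_integrand M (brownian_filtration M W) T (m j) (\<tau> j) (c j)) \<and>
    (\<lambda>j. \<integral>\<^sup>+x. ennreal ((norm ((case x of (t, \<omega>) \<Rightarrow> simple_process (m j) (\<tau> j) (c j) t \<omega>) -
        (case x of (t, \<omega>) \<Rightarrow> h t \<omega>)))\<^sup>2) \<partial>(interval_measure 0 T \<Otimes>\<^sub>M M)) \<longlonglongrightarrow> 0 \<and>
    (\<forall>t\<in>{0..T}.
      (\<lambda>j. \<integral>\<^sup>+\<omega>. ennreal ((norm (simple_ito W (m j) (\<tau> j) (c j) t \<omega> - I t \<omega>))\<^sup>2) \<partial>M) \<longlonglongrightarrow> 0)"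

lemma ito_approximationD:
  assumes "ito_approximation M W T h I m \<tau> c"
  shows "\<And>j. simple_integrand M (brownian_filtration M W) T (m j) (\<tau> j) (c j)"
    "(\<lambda>j. \<integral>\<^sup>+x. ennreal ((norm ((case x of (t, \<omega>) \<Rightarrow> simple_process (m j) (\<tau> j) (c j) t \<omega>) -
        (case x of (t, \<omega>) \<Rightarrow> h t \<omega>)))\<^sup>2) \<partial>(interval_measure 0 T \<Otimes>\<^sub>M M)) \<longlonglongrightarrow> 0"
    "\<And>t. t \<in> {0..T} \<Longrightarrow>
      (\<lambda>j. \<integral>\<^sup>+\<omega>. ennreal ((norm (simple_ito W (m j) (\<tau> j) (c j) t \<omega> - I t \<omega>))\<^sup>2) \<partial>M) \<longlonglongrightarrow> 0"
  using assms by (auto simp: ito_approximation_def)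

locale ito_integral = brownian M W for M :: "'w measure" and W :: "real \<Rightarrow> 'w \<Rightarrow> real^'d" +
  fixes T :: real and h :: "real \<Rightarrow> 'w \<Rightarrow> real^'d^'n" and I :: "real \<Rightarrow> 'w \<Rightarrow> real^'n"
  assumes ito: "is_ito_integral M W T h I"
begin

lemma integrand_sq: "sq_integrable (interval_measure 0 T \<Otimes>\<^sub>M M) (\<lambda>(t, \<omega>). h t \<omega>)"
  using ito by (intro Lp_adapted_2_sq_integrable) (auto simp: is_ito_integral_def prob_space_axioms)

lemma integral_adapted: "t \<in> {0..T} \<Longrightarrow> I t \<in> borel_measurable (F t)"
  using ito by (auto simp: is_ito_integral_def)

lemma integral_measurable: "t \<in> {0..T} \<Longrightarrow> I t \<in> borel_measurable M"
  using filtration_measurable_imp_measurable[OF integral_adapted] .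

lemma approximation: "\<exists>m \<tau> c. ito_approximation M W T h I m \<tau> c"
proof -
  obtain m \<tau> c where a: "\<And>j. simple_integrand M F T (m j) (\<tau> j) (c j)"
    "(\<lambda>j. \<integral>\<^sup>+ \<omega>. (\<integral>\<^sup>+ t\<in>{0..T}.
          ennreal ((norm (simple_process (m j) (\<tau> j) (c j) t \<omega> - h t \<omega>))\<^sup>2) \<partial>lborel) \<partial>M) \<longlonglongrightarrow> 0"
    "\<And>t. t \<in> {0..T} \<Longrightarrow>
      (\<lambda>j. \<integral>\<^sup>+\<omega>. ennreal ((norm (simple_ito W (m j) (\<tau> j) (c j) t \<omega> - I t \<omega>))\<^sup>2) \<partial>M) \<longlonglongrightarrow> 0"
    using ito unfolding is_ito_integral_def by blast
  have [measurable]: "(\<lambda>(t, \<omega>). h t \<omega>) \<in> borel_measurable (interval_measure 0 T \<Otimes>\<^sub>M M)"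
    using integrand_sq by (rule sq_integrable_measurable)
  have [measurable]: "(\<lambda>(t, \<omega>). simple_process (m j) (\<tau> j) (c j) t \<omega>) \<in>
      borel_measurable (interval_measure 0 T \<Otimes>\<^sub>M M)" for j
    using simple_process_sq(1)[OF a(1)] by (rule sq_integrable_measurable)
  have "(\<integral>\<^sup>+x. ennreal ((norm ((case x of (t, \<omega>) \<Rightarrow> simple_process (m j) (\<tau> j) (c j) t \<omega>) -
        (case x of (t, \<omega>) \<Rightarrow> h t \<omega>)))\<^sup>2) \<partial>(interval_measure 0 T \<Otimes>\<^sub>M M)) =
     (\<integral>\<^sup>+ \<omega>. (\<integral>\<^sup>+ t\<in>{0..T}.
          ennreal ((norm (simple_process (m j) (\<tau> j) (c j) t \<omega> - h t \<omega>))\<^sup>2) \<partial>lborel) \<partial>M)" for j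
    by (subst nn_integral_interval_product[OF prob_space_axioms]) auto
  then show ?thesis using a unfolding ito_approximation_def by (intro exI[of _ m] exI[of _ \<tau>] exI[of _ c]) simp
qed

lemma integral_sq:
  assumes "t \<in> {0..T}" shows "sq_integrable M (I t)"
proof -
  obtain m \<tau> c where
    a0: "ito_approximation M W T h I m \<tau> c"
    using approximation by blast
  note a = ito_approximationD[OF a0]
  show ?thesis
    by (rule sq_integrable_limit(1)[OF simple_ito_sq[OF a(1)] integral_measurable a(3)]) (use assms in auto)
qed

lemma integral_start:
  assumes "0 \<le> T" shows "AE \<omega> in M. I 0 \<omega> = 0"
proof -
  obtain m \<tau> c where
    a0: "ito_approximation M W T h I m \<tau> c"
    using approximation by blast
  note a = ito_approximationD[OF a0]
  have "simple_ito W (m j) (\<tau> j) (c j) 0 \<omega> = 0" for j \<omega>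
    using simple_integrand_times(1)[OF a(1), of _ j]
    by (auto simp: simple_ito_def min_def intro!: sum.neutral)
  then have "(\<lambda>j::nat. \<integral>\<^sup>+\<omega>. ennreal ((norm (I 0 \<omega>))\<^sup>2) \<partial>M) \<longlonglongrightarrow> 0"
    using a(3)[of 0] assms by simp
  then have "(\<integral>\<^sup>+\<omega>. ennreal ((norm (I 0 \<omega>))\<^sup>2) \<partial>M) = 0"
    by (simp add: LIMSEQ_const_iff)
  moreover have [measurable]: "I 0 \<in> borel_measurable M" using integral_measurable[of 0] assms by simp
  ultimately show ?thesis by (subst (asm) nn_integral_0_iff_AE) auto
qed

text \<open>The martingale property.  It is stated for \<open>X\<close> that agree almost surely with a random variable known
  at time \<open>t\<close>, because delayed processes are adapted only in this sense.\<close>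

lemma integral_orthogonal:
  assumes t: "t \<in> {0..T}" and X: "sq_integrable M X" "X' \<in> borel_measurable (F t)" "AE \<omega> in M. X \<omega> = X' \<omega>"
  shows "expectation (\<lambda>\<omega>. I T \<omega> \<bullet> X \<omega>) = expectation (\<lambda>\<omega>. I t \<omega> \<bullet> X \<omega>)"
proof -
  have TT: "T \<in> {0..T}" using t by auto
  obtain m \<tau> c where
    a0: "ito_approximation M W T h I m \<tau> c"
    using approximation by blast
  note a = ito_approximationD[OF a0]
  have lim: "(\<lambda>j. expectation (\<lambda>\<omega>. simple_ito W (m j) (\<tau> j) (c j) s \<omega> \<bullet> X \<omega>)) \<longlonglongrightarrow> expectation (\<lambda>\<omega>. I s \<omega> \<bullet> X \<omega>)"
    if "s \<in> {0..T}" for s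
    by (rule sq_integrable_limit(2)[OF simple_ito_sq[OF a(1)] integral_measurable a(3) X(1)]) (use that in auto)
  have X'm: "X' \<in> borel_measurable M" using filtration_measurable_imp_measurable[OF X(2)] .
  have X': "sq_integrable M X'" by (rule sq_integrable_cong_AE[OF X(1) X'm X(3)])
  have "expectation (\<lambda>\<omega>. simple_ito W (m j) (\<tau> j) (c j) T \<omega> \<bullet> X \<omega>) =
      expectation (\<lambda>\<omega>. simple_ito W (m j) (\<tau> j) (c j) t \<omega> \<bullet> X \<omega>)" for j
  proof -
    have s: "sq_integrable M (simple_ito W (m j) (\<tau> j) (c j) T)" "sq_integrable M (simple_ito W (m j) (\<tau> j) (c j) t)"
      using simple_ito_sq[OF a(1)] t by auto
    note [measurable] = s[THEN sq_integrable_measurable] X(1)[THEN sq_integrable_measurable] X'm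
    have "expectation (\<lambda>\<omega>. (simple_ito W (m j) (\<tau> j) (c j) T \<omega> - simple_ito W (m j) (\<tau> j) (c j) t \<omega>) \<bullet> X \<omega>) =
      expectation (\<lambda>\<omega>. (simple_ito W (m j) (\<tau> j) (c j) T \<omega> - simple_ito W (m j) (\<tau> j) (c j) t \<omega>) \<bullet> X' \<omega>)"
      by (rule integral_cong_AE) (use X(3) in auto)
    also have "\<dots> = 0" using simple_ito_orthogonal[OF a(1) _ _ X(2) X'] t by simp
    finally show ?thesis
      using integrable_inner[OF s(1) X(1)] integrable_inner[OF s(2) X(1)] by (simp add: inner_diff_left)
  qed
  then show ?thesis
    using lim[OF TT] lim[OF t] by (simp add: LIMSEQ_unique)
qed

end

text \<open>The limit is taken in one integrand after the other, so that each step is a limit of inner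
  products with a fixed square-integrable function.\<close>

lemma (in brownian) ito_isometry:
  fixes h h' :: "real \<Rightarrow> 'w \<Rightarrow> real^'d^'n"
  assumes T: "0 \<le> T" and "is_ito_integral M W T h I" "is_ito_integral M W T h' I'"
  shows "expectation (\<lambda>\<omega>. I T \<omega> \<bullet> I' T \<omega>) =
    (\<integral>(t, \<omega>). h t \<omega> \<bullet> h' t \<omega> \<partial>(interval_measure 0 T \<Otimes>\<^sub>M M))"
proof -
  interpret A: ito_integral M W T h I by unfold_locales fact
  interpret B: ito_integral M W T h' I' by unfold_locales fact
  let ?N = "interval_measure 0 T \<Otimes>\<^sub>M M"
  have TT: "T \<in> {0..T}" using T by auto
  obtain m \<tau> c where a0: "ito_approximation M W T h I m \<tau> c"
    using A.approximation by blast
  note a = ito_approximationD[OF a0]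
  obtain m' \<tau>' c' where a0': "ito_approximation M W T h' I' m' \<tau>' c'"
    using B.approximation by blast
  note a' = ito_approximationD[OF a0']
  let ?S = "\<lambda>j \<omega>. simple_ito W (m j) (\<tau> j) (c j) T \<omega>" and ?S' = "\<lambda>j \<omega>. simple_ito W (m' j) (\<tau>' j) (c' j) T \<omega>"
  let ?P = "\<lambda>j (t, \<omega>). simple_process (m j) (\<tau> j) (c j) t \<omega>" and ?P' =
      "\<lambda>j (t, \<omega>). simple_process (m' j) (\<tau>' j) (c' j) t \<omega>"
  have one: "expectation (\<lambda>\<omega>. I T \<omega> \<bullet> ?S' k \<omega>) = (\<integral>x. (case x of (t, \<omega>) \<Rightarrow> h t \<omega>) \<bullet> ?P' k x \<partial>?N)" for k
  proof -
    have l1: "(\<lambda>j. expectation (\<lambda>\<omega>. ?S j \<omega> \<bullet> ?S' k \<omega>)) \<longlonglongrightarrow> expectation (\<lambda>\<omega>. I T \<omega> \<bullet> ?S' k \<omega>)"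
      by (rule sq_integrable_limit(2)[OF simple_ito_sq[OF a(1) T] A.integral_measurable[OF TT] a(3)[OF TT]
            simple_ito_sq[OF a'(1) T]])
    have l2: "(\<lambda>j. \<integral>x. ?P j x \<bullet> ?P' k x \<partial>?N) \<longlonglongrightarrow> (\<integral>x. (case x of (t, \<omega>) \<Rightarrow> h t \<omega>) \<bullet> ?P' k x \<partial>?N)"
      by (rule sq_integrable_limit(2)[OF simple_process_sq(1)[OF a(1)]
          sq_integrable_measurable[OF A.integrand_sq] a(2)
            simple_process_sq(1)[OF a'(1)]])
    have "expectation (\<lambda>\<omega>. ?S j \<omega> \<bullet> ?S' k \<omega>) = (\<integral>x. ?P j x \<bullet> ?P' k x \<partial>?N)" for j
      using simple_ito_product[OF a(1) a'(1), of j k] by (simp add: split_beta')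
    with l1 l2 show ?thesis by (simp add: LIMSEQ_unique)
  qed
  have l1: "(\<lambda>k. expectation (\<lambda>\<omega>. ?S' k \<omega> \<bullet> I T \<omega>)) \<longlonglongrightarrow> expectation (\<lambda>\<omega>. I' T \<omega> \<bullet> I T \<omega>)"
    by (rule sq_integrable_limit(2)[OF simple_ito_sq[OF a'(1) T] B.integral_measurable[OF TT] a'(3)[OF TT]
          A.integral_sq[OF TT]])
  have l2: "(\<lambda>k. \<integral>x. ?P' k x \<bullet> (case x of (t, \<omega>) \<Rightarrow> h t \<omega>) \<partial>?N) \<longlonglongrightarrow>
      (\<integral>x. (case x of (t, \<omega>) \<Rightarrow> h' t \<omega>) \<bullet> (case x of (t, \<omega>) \<Rightarrow> h t \<omega>) \<partial>?N)"
    by (rule sq_integrable_limit(2)[OF simple_process_sq(1)[OF a'(1)]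
        sq_integrable_measurable[OF B.integrand_sq] a'(2)
          A.integrand_sq])
  have "expectation (\<lambda>\<omega>. I' T \<omega> \<bullet> I T \<omega>) =
      (\<integral>x. (case x of (t, \<omega>) \<Rightarrow> h' t \<omega>) \<bullet> (case x of (t, \<omega>) \<Rightarrow> h t \<omega>) \<partial>?N)"
    using LIMSEQ_unique[OF l1] l2 one by (simp add: inner_commute)
  then show ?thesis by (simp add: inner_commute split_beta')
qed

section \<open>Integration in time\<close>

context prob_time
begin

lemma inner_process_integrable:
  assumes "sq_process f" "sq_process g"
  shows "integrable LM (\<lambda>(t, \<omega>). f t \<omega> \<bullet> g t \<omega>)"
  using integrable_inner[OF assms] by (simp add: split_beta')

lemma sq_integrable_lift:
  assumes "sq_integrable M X"
  shows "sq_integrable LM (\<lambda>(t, \<omega>). X \<omega>)"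
proof -
  have "integrable LM (\<lambda>(t, \<omega>). (norm (X \<omega>))\<^sup>2)"
    using assms by (intro LM.Fubini_integrable) (auto simp: sq_integrable_def)
  moreover have "(\<lambda>x. X (snd x)) \<in> borel_measurable LM"
    by (rule measurable_compose[OF measurable_snd]) (use assms in \<open>simp add: sq_integrable_def\<close>)
  ultimately show ?thesis by (simp add: sq_integrable_def split_beta')
qed

lemma AE_lift:
  assumes "AE \<omega> in M. P \<omega>" shows "AE x in LM. P (snd x)"
proof -
  from assms obtain N where N: "{\<omega> \<in> space M. \<not> P \<omega>} \<subseteq> N" "emeasure M N = 0" "N \<in> sets M"
    by (rule AE_E)
  show ?thesis
  proof (rule AE_I)
    show "{x \<in> space LM. \<not> P (snd x)} \<subseteq> space L \<times> N"
      using N(1) by (auto simp: space_pair_measure)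
    show "emeasure LM (space L \<times> N) = 0"
      using N by (simp add: emeasure_pair_measure_Times)
  qed (use N in auto)
qed

text \<open>The relation \<open>R\<close> selects the range of integration: \<open>t \<le> s\<close> and \<open>s \<le> t\<close> give the indefinite
  integrals from either end.\<close>

lemma sq_integrable_partial_integral:
  assumes f: "sq_process f" and R: "Measurable.pred (L \<Otimes>\<^sub>M L) (\<lambda>(t, s). R t s)"
  shows "sq_integrable LM (\<lambda>(t, \<omega>). \<integral>s. of_bool (R t s) *\<^sub>R f s \<omega> \<partial>L)"
    and "t \<in> space L \<Longrightarrow> sq_integrable M (\<lambda>\<omega>. \<integral>s. of_bool (R t s) *\<^sub>R f s \<omega> \<partial>L)"
proof -
  have [measurable]: "case_prod f \<in> borel_measurable LM"
    using f by (rule sq_integrable_measurable)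
  have [measurable]: "(\<lambda>x. f (snd x) (snd (fst x))) \<in> borel_measurable (LM \<Otimes>\<^sub>M L)"
    using measurable_compose[of "\<lambda>x. (snd x, snd (fst x))" "LM \<Otimes>\<^sub>M L" "LM" "case_prod f" borel]
    by simp
  have R1 [measurable]: "Measurable.pred (LM \<Otimes>\<^sub>M L) (\<lambda>x. R (fst (fst x)) (snd x))"
    using measurable_compose[of "\<lambda>x. (fst (fst x), snd x)" "LM \<Otimes>\<^sub>M L" "L \<Otimes>\<^sub>M L" "case_prod R", OF _ R]
    by simp
  have m: "(\<lambda>x. \<integral>s. of_bool (R (fst x) s) *\<^sub>R f s (snd x) \<partial>L) \<in> borel_measurable LM"
    by (rule fin_L.borel_measurable_lebesgue_integral) (simp add: split_beta', measurable)
  have sq: "sq_integrable M (\<lambda>\<omega>. \<integral>s. norm (f s \<omega>) \<partial>L)" using sq_integrable_integral_time[OF f] by simp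
  have ae: "AE \<omega> in M. integrable L (\<lambda>s. f s \<omega>)"
    using LM.AE_integrable_snd[of f] LMf.sq_integrable_imp_integrable[OF f] by simp
  have b: "norm (\<integral>s. of_bool (R t s) *\<^sub>R f s \<omega> \<partial>L) \<le> norm (\<integral>s. norm (f s \<omega>) \<partial>L)"
    if i: "integrable L (\<lambda>s. f s \<omega>)" and t: "t \<in> space L" and w: "\<omega> \<in> space M" for t \<omega>
  proof -
    have [measurable]: "Measurable.pred L (R t)"
      using measurable_compose[of "\<lambda>s. (t, s)" L "L \<Otimes>\<^sub>M L", OF _ R] t by simp
    have [measurable]: "(\<lambda>s. f s \<omega>) \<in> borel_measurable L" using i by auto
    have "norm (\<integral>s. of_bool (R t s) *\<^sub>R f s \<omega> \<partial>L) \<le> (\<integral>s. norm (of_bool (R t s) *\<^sub>R f s \<omega>) \<partial>L)"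
      by (rule integral_norm_bound)
    also have "\<dots> \<le> (\<integral>s. norm (f s \<omega>) \<partial>L)"
      by (rule integral_mono_AE)
        (auto intro!: Bochner_Integration.integrable_bound[OF i] AE_I2 integrable_norm i)
    finally show ?thesis by simp
  qed
  show "sq_integrable LM (\<lambda>(t, \<omega>). \<integral>s. of_bool (R t s) *\<^sub>R f s \<omega> \<partial>L)"
  proof (rule sq_integrable_norm_bound[OF _ sq_integrable_lift[OF sq]])
    show "(\<lambda>(t, \<omega>). \<integral>s. of_bool (R t s) *\<^sub>R f s \<omega> \<partial>L) \<in> borel_measurable LM"
      using m by (simp add: split_beta')
    have "AE x in LM. integrable L (\<lambda>s. f s (snd x))"
      by (rule AE_lift[OF ae])
    with AE_space show "AE x in LM. norm (case x of (t, \<omega>) \<Rightarrow> \<integral>s. of_bool (R t s) *\<^sub>R f s \<omega> \<partial>L)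
        \<le> norm (case x of (t, \<omega>) \<Rightarrow> \<integral>s. norm (f s \<omega>) \<partial>L)"
      by eventually_elim (use b in \<open>auto simp: space_pair_measure\<close>)
  qed
  assume t: "t \<in> space L"
  show "sq_integrable M (\<lambda>\<omega>. \<integral>s. of_bool (R t s) *\<^sub>R f s \<omega> \<partial>L)"
  proof (rule sq_integrable_norm_bound[OF _ sq])
    show "(\<lambda>\<omega>. \<integral>s. of_bool (R t s) *\<^sub>R f s \<omega> \<partial>L) \<in> borel_measurable M"
      using measurable_compose[of "\<lambda>\<omega>. (t, \<omega>)" M "LM", OF _ m] t by simp
    show "AE \<omega> in M. norm (\<integral>s. of_bool (R t s) *\<^sub>R f s \<omega> \<partial>L) \<le> norm (\<integral>s. norm (f s \<omega>) \<partial>L)"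
      using ae AE_space by eventually_elim (use b t in auto)
  qed
qed

text \<open>Fubini's theorem.  For the relation \<open>t \<le> s\<close> this is integration by parts for two indefinite
  integrals that vanish at opposite ends of the interval.\<close>

lemma inner_partial_integrals:
  assumes f: "sq_process f" and g: "sq_process g"
    and R: "Measurable.pred (L \<Otimes>\<^sub>M L) (\<lambda>(t, s). R t s)"
  shows "(\<integral>(t, \<omega>). f t \<omega> \<bullet> (\<integral>s. of_bool (R t s) *\<^sub>R g s \<omega> \<partial>L) \<partial>LM) =
    (\<integral>(t, \<omega>). (\<integral>s. of_bool (R s t) *\<^sub>R f s \<omega> \<partial>L) \<bullet> g t \<omega> \<partial>LM)"
proof -
  interpret LL: pair_sigma_finite L L ..
  have R': "Measurable.pred (L \<Otimes>\<^sub>M L) (\<lambda>(t, s). R s t)"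
    using measurable_compose[OF measurable_pair_swap' R] by (simp add: split_beta' comp_def)
  have "(\<integral>(t, \<omega>). f t \<omega> \<bullet> (\<integral>s. of_bool (R t s) *\<^sub>R g s \<omega> \<partial>L) \<partial>LM) =
      (\<integral>\<omega>. \<integral>t. f t \<omega> \<bullet> (\<integral>s. of_bool (R t s) *\<^sub>R g s \<omega> \<partial>L) \<partial>L \<partial>M)"
    by (rule LM.integral_snd[symmetric])
      (rule inner_process_integrable[OF f sq_integrable_partial_integral(1)[OF g R]])
  also have "\<dots> = (\<integral>\<omega>. \<integral>t. (\<integral>s. of_bool (R s t) *\<^sub>R f s \<omega> \<partial>L) \<bullet> g t \<omega> \<partial>L \<partial>M)"
  proof (rule integral_cong_AE)
    show "(\<lambda>\<omega>. \<integral>t. f t \<omega> \<bullet> (\<integral>s. of_bool (R t s) *\<^sub>R g s \<omega> \<partial>L) \<partial>L) \<in> borel_measurable M"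
      using LM.integrable_snd[OF inner_process_integrable[OF f sq_integrable_partial_integral(1)[OF g R]]]
      by simp
    show "(\<lambda>\<omega>. \<integral>t. (\<integral>s. of_bool (R s t) *\<^sub>R f s \<omega> \<partial>L) \<bullet> g t \<omega> \<partial>L) \<in> borel_measurable M"
      using LM.integrable_snd[OF inner_process_integrable[OF sq_integrable_partial_integral(1)[OF f R'] g]]
      by simp
    have "AE \<omega> in M. integrable L (\<lambda>s. f s \<omega>)" "AE \<omega> in M. integrable L (\<lambda>s. g s \<omega>)"
      using LM.AE_integrable_snd[of f] LMf.sq_integrable_imp_integrable[OF f]
        LM.AE_integrable_snd[of g] LMf.sq_integrable_imp_integrable[OF g] by auto
    then show "AE \<omega> in M. (\<integral>t. f t \<omega> \<bullet> (\<integral>s. of_bool (R t s) *\<^sub>R g s \<omega> \<partial>L) \<partial>L) =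
        (\<integral>t. (\<integral>s. of_bool (R s t) *\<^sub>R f s \<omega> \<partial>L) \<bullet> g t \<omega> \<partial>L)"
    proof eventually_elim
      case (elim \<omega>)
      have [measurable]: "(\<lambda>s. f s \<omega>) \<in> borel_measurable L" "(\<lambda>s. g s \<omega>) \<in> borel_measurable L"
        using elim by auto
      have Rp [measurable]: "Measurable.pred (L \<Otimes>\<^sub>M L) (\<lambda>x. R (fst x) (snd x))" using R by (simp add: split_beta')
      have Rs: "Measurable.pred L (R t)" "Measurable.pred L (\<lambda>s. R s t)" if "t \<in> space L" for t
        using measurable_compose[of "\<lambda>s. (t, s)" L "L \<Otimes>\<^sub>M L", OF _ R]
          measurable_compose[of "\<lambda>s. (s, t)" L "L \<Otimes>\<^sub>M L", OF _ R] that by auto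
      have ig: "integrable L (\<lambda>s. of_bool (R t s) *\<^sub>R g s \<omega>)" and if': "integrable L (\<lambda>s. of_bool (R s t) *\<^sub>R f s \<omega>)"
        if "t \<in> space L" for t
        by (rule Bochner_Integration.integrable_bound[OF elim(2)] Bochner_Integration.integrable_bound[OF elim(1)];
            use Rs[OF that] in auto)+
      have int: "integrable (L \<Otimes>\<^sub>M L) (\<lambda>(t, s). of_bool (R t s) * (f t \<omega> \<bullet> g s \<omega>))"
      proof (rule Bochner_Integration.integrable_bound)
        show "integrable (L \<Otimes>\<^sub>M L) (\<lambda>(t, s). norm (f t \<omega>) * norm (g s \<omega>))"
          using elim by (intro LL.Fubini_integrable) auto
        show "(\<lambda>(t, s). of_bool (R t s) * (f t \<omega> \<bullet> g s \<omega>)) \<in> borel_measurable (L \<Otimes>\<^sub>M L)"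
          by (simp add: split_beta')
        show "AE x in L \<Otimes>\<^sub>M L. norm (case x of (t, s) \<Rightarrow> of_bool (R t s) * (f t \<omega> \<bullet> g s \<omega>)) \<le>
            norm (case x of (t, s) \<Rightarrow> norm (f t \<omega>) * norm (g s \<omega>))"
          by (intro AE_I2) (auto simp: Cauchy_Schwarz_ineq2)
      qed
      have "(\<integral>t. f t \<omega> \<bullet> (\<integral>s. of_bool (R t s) *\<^sub>R g s \<omega> \<partial>L) \<partial>L) =
          (\<integral>t. \<integral>s. of_bool (R t s) * (f t \<omega> \<bullet> g s \<omega>) \<partial>L \<partial>L)"
        by (intro Bochner_Integration.integral_cong refl)
            (simp add: integral_inner_right[OF ig, symmetric] mult.commute)
      also have "\<dots> = (\<integral>s. \<integral>t. of_bool (R t s) * (f t \<omega> \<bullet> g s \<omega>) \<partial>L \<partial>L)"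
        by (rule LL.Fubini_integral[symmetric, OF int])
      also have "\<dots> = (\<integral>t. (\<integral>s. of_bool (R s t) *\<^sub>R f s \<omega> \<partial>L) \<bullet> g t \<omega> \<partial>L)"
        by (intro Bochner_Integration.integral_cong refl)
            (simp add: integral_inner_left[OF if', symmetric] mult.commute)
      finally show ?case .
    qed
  qed
  also have "\<dots> = (\<integral>(t, \<omega>). (\<integral>s. of_bool (R s t) *\<^sub>R f s \<omega> \<partial>L) \<bullet> g t \<omega> \<partial>LM)"
    by (rule LM.integral_snd)
      (rule inner_process_integrable[OF sq_integrable_partial_integral(1)[OF f R'] g])
  finally show ?thesis .
qed

text \<open>The equations for \<open>p\<close> and \<open>Y\<close> hold at each time outside a null set that depends on the time.  They are
  used through expectations at fixed times, which is enough to compare integrals over the product.\<close>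

lemma inner_process_cong:
  assumes f: "sq_process f" and g: "sq_process g"
    and f': "sq_process f'" and g': "sq_process g'"
    and eq: "AE t in L. expectation (\<lambda>\<omega>. f t \<omega> \<bullet> g t \<omega>) = expectation (\<lambda>\<omega>. f' t \<omega> \<bullet> g' t \<omega>)"
  shows "(\<integral>(t, \<omega>). f t \<omega> \<bullet> g t \<omega> \<partial>LM) = (\<integral>(t, \<omega>). f' t \<omega> \<bullet> g' t \<omega> \<partial>LM)"
proof -
  note i = inner_process_integrable[OF f g] inner_process_integrable[OF f' g']
  have "(\<integral>t. expectation (\<lambda>\<omega>. f t \<omega> \<bullet> g t \<omega>) \<partial>L) = (\<integral>t. expectation (\<lambda>\<omega>. f' t \<omega> \<bullet> g' t \<omega>) \<partial>L)"
    by (rule integral_cong_AE[OF _ _ eq]) (use LM.integrable_fst[OF i(1)] LM.integrable_fst[OF i(2)] in auto)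
  then show ?thesis
    using LM.integral_fst[OF i(1)] LM.integral_fst[OF i(2)] by simp
qed

lemma inner_process_lift:
  assumes X: "sq_integrable M X" and g: "sq_process g"
  shows "(\<integral>(t, \<omega>). X \<omega> \<bullet> g t \<omega> \<partial>LM) = expectation (\<lambda>\<omega>. X \<omega> \<bullet> (\<integral>t. g t \<omega> \<partial>L))"
proof -
  note i = inner_process_integrable[OF sq_integrable_lift[OF X] g]
  have "(\<integral>(t, \<omega>). X \<omega> \<bullet> g t \<omega> \<partial>LM) = expectation (\<lambda>\<omega>. \<integral>t. X \<omega> \<bullet> g t \<omega> \<partial>L)"
    by (rule LM.integral_snd[symmetric, OF i])
  also have "\<dots> = expectation (\<lambda>\<omega>. X \<omega> \<bullet> (\<integral>t. g t \<omega> \<partial>L))"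
  proof (rule integral_cong_AE)
    show "(\<lambda>\<omega>. \<integral>t. X \<omega> \<bullet> g t \<omega> \<partial>L) \<in> borel_measurable M" using LM.integrable_snd[OF i] by simp
    show "(\<lambda>\<omega>. X \<omega> \<bullet> (\<integral>t. g t \<omega> \<partial>L)) \<in> borel_measurable M"
      using X sq_integrable_integral_time(2)[OF g] by (intro borel_measurable_inner) (auto simp: sq_integrable_def)
    have "AE \<omega> in M. integrable L (\<lambda>s. g s \<omega>)"
      using LM.AE_integrable_snd[of g] LMf.sq_integrable_imp_integrable[OF g] by auto
    then show "AE \<omega> in M. (\<integral>t. X \<omega> \<bullet> g t \<omega> \<partial>L) = X \<omega> \<bullet> (\<integral>t. g t \<omega> \<partial>L)"
      by eventually_elim simp
  qed
  finally show ?thesis .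
qed

end

section \<open>Duality of forward and backward equations\<close>

lemma interval_id_measurable: "(\<lambda>x. x) \<in> borel_measurable (interval_measure a b)"
  by (rule measurable_restrict_space1) simp

lemma interval_le_pred:
  "Measurable.pred (interval_measure a b \<Otimes>\<^sub>M interval_measure a b) (\<lambda>(t, s). t \<le> s)"
  "Measurable.pred (interval_measure a b \<Otimes>\<^sub>M interval_measure a b) (\<lambda>(t, s). s \<le> t)"
proof -
  have [measurable]: "(\<lambda>x. fst x) \<in> borel_measurable (interval_measure a b \<Otimes>\<^sub>M interval_measure a b)"
    "(\<lambda>x. snd x) \<in> borel_measurable (interval_measure a b \<Otimes>\<^sub>M interval_measure a b)"
    by (rule measurable_compose[OF measurable_fst interval_id_measurable]
        measurable_compose[OF measurable_snd interval_id_measurable])+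
  show "Measurable.pred (interval_measure a b \<Otimes>\<^sub>M interval_measure a b) (\<lambda>(t, s). t \<le> s)"
    "Measurable.pred (interval_measure a b \<Otimes>\<^sub>M interval_measure a b) (\<lambda>(t, s). s \<le> t)"
    unfolding split_beta' by measurable
qed

locale brownian_interval = brownian M W for M :: "'w measure" and W :: "real \<Rightarrow> 'w \<Rightarrow> real^'d" +
  fixes T :: real
  assumes horizon_nonneg: "0 \<le> T"
begin

sublocale prob_time M "interval_measure 0 T"
  by (rule prob_time_interval) unfold_locales

abbreviation "L \<equiv> interval_measure 0 T"

text \<open>The product rule for \<open>\<langle>p, Y\<rangle>\<close> in expectation, for \<open>Y(T) = 0\<close>.  Paired with a random variable
  known at time \<open>t\<close>, a stochastic integral up to \<open>t\<close> may be replaced by the integral up to \<open>T\<close>.  This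
  replaces \<open>Y(t)\<close> in \<open>E \<langle>b(t), Y(t)\<rangle>\<close> by the integral of \<open>g\<close> over \<open>[t, T]\<close>,
  and \<open>I(t)\<close> in \<open>E \<langle>p(t), g(t)\<rangle>\<close> by \<open>I(T)\<close>.
  The double integrals of \<open>b\<close> against \<open>g\<close> then cancel by integration by parts.  What is left is
  \<open>E \<langle>p(0) + I(T), \<integral> g\<rangle>\<close> where, by the backward equation at time zero, \<open>\<integral> g\<close> is \<open>Y(0)\<close> plus a stochastic
  integral, to which the isometry applies.\<close>

lemma backward_forward_duality:
  fixes p b g Y :: "real \<Rightarrow> 'w \<Rightarrow> real^'n" and \<sigma> z1 z2 :: "real \<Rightarrow> 'w \<Rightarrow> real^'d^'n"
  assumes p: "sq_process p"
    and b: "sq_process b" "\<And>t. t \<in> {0..T} \<Longrightarrow> b t \<in> borel_measurable (F t)"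
    and g: "sq_process g"
      "AE t in L. \<exists>g'\<in>borel_measurable (F t). AE \<omega> in M. g t \<omega> = g' \<omega>"
    and Y: "sq_process Y"
    and Y0: "Y 0 \<in> borel_measurable (F 0)"
    and p0: "sq_integrable M (p 0)" "p 0 \<in> borel_measurable (F 0)"
    and ito: "is_ito_integral M W T \<sigma> I" "is_ito_integral M W T z1 I1" "is_ito_integral M W T z2 I2"
    and forward: "\<And>t. t \<in> {0..T} \<Longrightarrow>
      AE \<omega> in M. p t \<omega> = p 0 \<omega> + (\<integral>s. of_bool (s \<le> t) *\<^sub>R b s \<omega> \<partial>L) + I t \<omega>"
    and backward: "\<And>t. t \<in> {0..T} \<Longrightarrow>
      AE \<omega> in M. Y t \<omega> = (\<integral>s. of_bool (t \<le> s) *\<^sub>R g s \<omega> \<partial>L) - ((I1 T \<omega> - I2 T \<omega>) - (I1 t \<omega> - I2 t \<omega>))"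
  shows "(\<integral>(t, \<omega>). b t \<omega> \<bullet> Y t \<omega> \<partial>LM) - (\<integral>(t, \<omega>). p t \<omega> \<bullet> g t \<omega> \<partial>LM)
    + (\<integral>(t, \<omega>). \<sigma> t \<omega> \<bullet> (z1 t \<omega> - z2 t \<omega>) \<partial>LM) = - expectation (\<lambda>\<omega>. p 0 \<omega> \<bullet> Y 0 \<omega>)"
    and "sq_integrable M (Y 0)"
proof -
  interpret A: ito_integral M W T \<sigma> I by unfold_locales fact
  interpret B1: ito_integral M W T z1 I1 by unfold_locales fact
  interpret B2: ito_integral M W T z2 I2 by unfold_locales fact
  have TT: "T \<in> {0..T}" "0 \<in> {0..T}" using horizon_nonneg by auto
  define Gt where "Gt t \<omega> = (\<integral>s. of_bool (t \<le> s) *\<^sub>R g s \<omega> \<partial>L)" for t \<omega>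
  define Bt where "Bt t \<omega> = (\<integral>s. of_bool (s \<le> t) *\<^sub>R b s \<omega> \<partial>L)" for t \<omega>
  define G where "G \<omega> = (\<integral>s. g s \<omega> \<partial>L)" for \<omega>
  define Z where "Z t \<omega> = I1 t \<omega> - I2 t \<omega>" for t \<omega>
  have Gt: "sq_process Gt" "t \<in> {0..T} \<Longrightarrow> sq_integrable M (Gt t)" for t
    using sq_integrable_partial_integral[OF g(1) interval_le_pred(1)] by (auto simp: Gt_def[abs_def])
  have Bt: "sq_process Bt" "t \<in> {0..T} \<Longrightarrow> sq_integrable M (Bt t)" for t
    using sq_integrable_partial_integral[OF b(1) interval_le_pred(2)] by (auto simp: Bt_def[abs_def])
  have G: "sq_integrable M G" using sq_integrable_integral_time(2)[OF g(1)] by (simp add: G_def[abs_def])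
  have Z: "sq_integrable M (Z t)" if "t \<in> {0..T}" for t
    unfolding Z_def[abs_def] by (rule sq_integrable_diff[OF B1.integral_sq[OF that] B2.integral_sq[OF that]])
  have I: "sq_integrable M (I t)" if "t \<in> {0..T}" for t using A.integral_sq[OF that] .
  have Zorth: "expectation (\<lambda>\<omega>. Z T \<omega> \<bullet> X \<omega>) = expectation (\<lambda>\<omega>. Z t \<omega> \<bullet> X \<omega>)"
    if t: "t \<in> {0..T}" and X: "sq_integrable M X" "X \<in> borel_measurable (F t)" for t X
    using B1.integral_orthogonal[OF t X] B2.integral_orthogonal[OF t X]
      integrable_inner[OF B1.integral_sq[OF t] X(1)] integrable_inner[OF B2.integral_sq[OF t] X(1)]
      integrable_inner[OF B1.integral_sq[OF TT(1)] X(1)] integrable_inner[OF B2.integral_sq[OF TT(1)] X(1)]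
    by (simp add: Z_def inner_diff_left)
  have Z0: "AE \<omega> in M. Z 0 \<omega> = 0"
    using B1.integral_start[OF horizon_nonneg] B2.integral_start[OF horizon_nonneg]
    by eventually_elim (simp add: Z_def)
  have I0: "AE \<omega> in M. I 0 \<omega> = 0" by (rule A.integral_start[OF horizon_nonneg])
  have YGt: "AE \<omega> in M. Y 0 \<omega> = Gt 0 \<omega> - Z T \<omega>"
    using backward[OF TT(2)] Z0 by eventually_elim (simp add: Gt_def Z_def)
  have G0: "Gt 0 \<omega> = G \<omega>" for \<omega>
    unfolding Gt_def G_def by (intro Bochner_Integration.integral_cong refl) simp
  from YGt have YG: "AE \<omega> in M. G \<omega> = Y 0 \<omega> + Z T \<omega>" by eventually_elim (simp add: G0)
  have Y0m: "Y 0 \<in> borel_measurable M" using filtration_measurable_imp_measurable[OF Y0] .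
  show sqY0: "sq_integrable M (Y 0)"
  proof (rule sq_integrable_cong_AE[OF sq_integrable_diff[OF G Z[OF TT(1)]] Y0m])
    show "AE \<omega> in M. G \<omega> - Z T \<omega> = Y 0 \<omega>" using YG by eventually_elim simp
  qed

  have bY: "(\<integral>(t, \<omega>). b t \<omega> \<bullet> Y t \<omega> \<partial>LM) = (\<integral>(t, \<omega>). b t \<omega> \<bullet> Gt t \<omega> \<partial>LM)"
  proof (rule inner_process_cong[OF b(1) Y b(1) Gt(1)])
    show "AE t in L. expectation (\<lambda>\<omega>. b t \<omega> \<bullet> Y t \<omega>) = expectation (\<lambda>\<omega>. b t \<omega> \<bullet> Gt t \<omega>)"
      using AE_sq_integrable_slice[OF b(1)] AE_space
    proof eventually_elim
      case (elim t)
      then have t: "t \<in> {0..T}" by simp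
      have Ym: "(\<lambda>\<omega>. b t \<omega> \<bullet> Y t \<omega>) \<in> borel_measurable M"
      proof -
        have "Y t \<in> borel_measurable M"
          using measurable_Pair2[OF sq_integrable_measurable[OF Y], of t] t by simp
        then show ?thesis using elim(1) by (intro borel_measurable_inner) (auto simp: sq_integrable_def)
      qed
      note ints = integrable_inner[OF elim(1) Gt(2)[OF t]] integrable_inner[OF elim(1) Z[OF t]]
        integrable_inner[OF elim(1) Z[OF TT(1)]]
      have "expectation (\<lambda>\<omega>. b t \<omega> \<bullet> Y t \<omega>) =
          expectation (\<lambda>\<omega>. b t \<omega> \<bullet> Gt t \<omega> - b t \<omega> \<bullet> Z T \<omega> + b t \<omega> \<bullet> Z t \<omega>)"
      proof (rule integral_cong_AE[OF Ym])
        show "(\<lambda>\<omega>. b t \<omega> \<bullet> Gt t \<omega> - b t \<omega> \<bullet> Z T \<omega> + b t \<omega> \<bullet> Z t \<omega>) \<in> borel_measurable M"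
          using ints by auto
        show "AE \<omega> in M. b t \<omega> \<bullet> Y t \<omega> = b t \<omega> \<bullet> Gt t \<omega> - b t \<omega> \<bullet> Z T \<omega> + b t \<omega> \<bullet> Z t \<omega>"
          using backward[OF t] by eventually_elim (simp add: Gt_def Z_def inner_diff_right)
      qed
      also have "\<dots> = expectation (\<lambda>\<omega>. b t \<omega> \<bullet> Gt t \<omega>)"
        using ints Zorth[OF t elim(1) b(2)[OF t]] by (simp add: inner_commute)
      finally show ?case .
    qed
  qed

  define p' where "p' t \<omega> = (p 0 \<omega> + I T \<omega>) + Bt t \<omega>" for t \<omega>
  have pI: "sq_integrable M (\<lambda>\<omega>. p 0 \<omega> + I T \<omega>)" by (rule sq_integrable_add[OF p0(1) I[OF TT(1)]])
  have p': "sq_process p'"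
    using sq_integrable_add[OF sq_integrable_lift[OF pI] Bt(1)] by (simp add: p'_def[abs_def] split_beta')
  have pg: "(\<integral>(t, \<omega>). p t \<omega> \<bullet> g t \<omega> \<partial>LM) = (\<integral>(t, \<omega>). p' t \<omega> \<bullet> g t \<omega> \<partial>LM)"
  proof (rule inner_process_cong[OF p g(1) p' g(1)])
    show "AE t in L. expectation (\<lambda>\<omega>. p t \<omega> \<bullet> g t \<omega>) = expectation (\<lambda>\<omega>. p' t \<omega> \<bullet> g t \<omega>)"
      using AE_sq_integrable_slice[OF g(1)] AE_sq_integrable_slice[OF p] g(2) AE_space
    proof eventually_elim
      case (elim t)
      then have t: "t \<in> {0..T}" by simp
      obtain g' where g': "g' \<in> borel_measurable (F t)" "AE \<omega> in M. g t \<omega> = g' \<omega>" using elim(3) by blast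
      note ints = integrable_inner[OF p0(1) elim(1)] integrable_inner[OF Bt(2)[OF t] elim(1)]
        integrable_inner[OF I[OF t] elim(1)] integrable_inner[OF I[OF TT(1)] elim(1)]
      have "expectation (\<lambda>\<omega>. p t \<omega> \<bullet> g t \<omega>) =
          expectation (\<lambda>\<omega>. p 0 \<omega> \<bullet> g t \<omega> + Bt t \<omega> \<bullet> g t \<omega> + I t \<omega> \<bullet> g t \<omega>)"
      proof (rule integral_cong_AE)
        show "(\<lambda>\<omega>. p t \<omega> \<bullet> g t \<omega>) \<in> borel_measurable M"
          using integrable_inner[OF elim(2,1)] by auto
        show "(\<lambda>\<omega>. p 0 \<omega> \<bullet> g t \<omega> + Bt t \<omega> \<bullet> g t \<omega> + I t \<omega> \<bullet> g t \<omega>) \<in> borel_measurable M"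
          using ints by auto
        show "AE \<omega> in M. p t \<omega> \<bullet> g t \<omega> = p 0 \<omega> \<bullet> g t \<omega> + Bt t \<omega> \<bullet> g t \<omega> + I t \<omega> \<bullet> g t \<omega>"
          using forward[OF t] by eventually_elim (simp add: Bt_def inner_add_left)
      qed
      also have "\<dots> = expectation (\<lambda>\<omega>. p' t \<omega> \<bullet> g t \<omega>)"
        using ints A.integral_orthogonal[OF t elim(1) g'] by (simp add: p'_def inner_add_left)
      finally show ?case .
    qed
  qed
  have split: "(\<integral>(t, \<omega>). p' t \<omega> \<bullet> g t \<omega> \<partial>LM) =
      (\<integral>(t, \<omega>). (p 0 \<omega> + I T \<omega>) \<bullet> g t \<omega> \<partial>LM) + (\<integral>(t, \<omega>). Bt t \<omega> \<bullet> g t \<omega> \<partial>LM)"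
    using inner_process_integrable[OF sq_integrable_lift[OF pI] g(1)] inner_process_integrable[OF Bt(1) g(1)]
    by (subst Bochner_Integration.integral_add[symmetric])
      (simp_all add: p'_def split_beta' inner_add_left[of "p 0 _ + I T _"])
  have parts: "(\<integral>(t, \<omega>). b t \<omega> \<bullet> Gt t \<omega> \<partial>LM) = (\<integral>(t, \<omega>). Bt t \<omega> \<bullet> g t \<omega> \<partial>LM)"
    unfolding Gt_def Bt_def by (rule inner_partial_integrals[OF b(1) g(1) interval_le_pred(1)])
  have lift: "(\<integral>(t, \<omega>). (p 0 \<omega> + I T \<omega>) \<bullet> g t \<omega> \<partial>LM) = expectation (\<lambda>\<omega>. (p 0 \<omega> + I T \<omega>) \<bullet> G \<omega>)"
    unfolding G_def by (rule inner_process_lift[OF pI g(1)])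
  have iso: "expectation (\<lambda>\<omega>. I T \<omega> \<bullet> Z T \<omega>) = (\<integral>(t, \<omega>). \<sigma> t \<omega> \<bullet> (z1 t \<omega> - z2 t \<omega>) \<partial>LM)"
    using ito_isometry[OF horizon_nonneg ito(1,2)] ito_isometry[OF horizon_nonneg ito(1,3)]
      integrable_inner[OF I[OF TT(1)] B1.integral_sq[OF TT(1)]]
      integrable_inner[OF I[OF TT(1)] B2.integral_sq[OF TT(1)]]
      inner_process_integrable[OF A.integrand_sq B1.integrand_sq]
      inner_process_integrable[OF A.integrand_sq B2.integrand_sq]
    by (simp add: Z_def inner_diff_right split_beta')
  have "expectation (\<lambda>\<omega>. (p 0 \<omega> + I T \<omega>) \<bullet> G \<omega>) =
      expectation (\<lambda>\<omega>. p 0 \<omega> \<bullet> Y 0 \<omega> + p 0 \<omega> \<bullet> Z T \<omega> + I T \<omega> \<bullet> Y 0 \<omega> + I T \<omega> \<bullet> Z T \<omega>)"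
  proof (rule integral_cong_AE)
    show "(\<lambda>\<omega>. (p 0 \<omega> + I T \<omega>) \<bullet> G \<omega>) \<in> borel_measurable M" using integrable_inner[OF pI G] by auto
    show "(\<lambda>\<omega>. p 0 \<omega> \<bullet> Y 0 \<omega> + p 0 \<omega> \<bullet> Z T \<omega> + I T \<omega> \<bullet> Y 0 \<omega> + I T \<omega> \<bullet> Z T \<omega>) \<in> borel_measurable M"
      using p0(1) I[OF TT(1)] Z[OF TT(1)] sqY0
      by (intro borel_measurable_add borel_measurable_inner) (auto simp: sq_integrable_def)
    show "AE \<omega> in M. (p 0 \<omega> + I T \<omega>) \<bullet> G \<omega> = p 0 \<omega> \<bullet> Y 0 \<omega> + p 0 \<omega> \<bullet> Z T \<omega> + I T \<omega> \<bullet> Y 0 \<omega> + I T \<omega> \<bullet> Z T \<omega>"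
      using YG by eventually_elim (simp add: inner_add_left inner_add_right)
  qed
  also have "\<dots> = expectation (\<lambda>\<omega>. p 0 \<omega> \<bullet> Y 0 \<omega>) + expectation (\<lambda>\<omega>. p 0 \<omega> \<bullet> Z T \<omega>)
      + expectation (\<lambda>\<omega>. I T \<omega> \<bullet> Y 0 \<omega>) + expectation (\<lambda>\<omega>. I T \<omega> \<bullet> Z T \<omega>)"
    using integrable_inner[OF p0(1) sqY0] integrable_inner[OF p0(1) Z[OF TT(1)]]
      integrable_inner[OF I[OF TT(1)] sqY0] integrable_inner[OF I[OF TT(1)] Z[OF TT(1)]] by simp
  also have "expectation (\<lambda>\<omega>. p 0 \<omega> \<bullet> Z T \<omega>) = 0"
  proof -
    have "expectation (\<lambda>\<omega>. p 0 \<omega> \<bullet> Z T \<omega>) = expectation (\<lambda>\<omega>. Z 0 \<omega> \<bullet> p 0 \<omega>)"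
      using Zorth[OF TT(2) p0] by (simp add: inner_commute)
    also have "\<dots> = 0" by (rule integral_eq_zero_AE) (use Z0 in auto)
    finally show ?thesis .
  qed
  also have "expectation (\<lambda>\<omega>. I T \<omega> \<bullet> Y 0 \<omega>) = 0"
  proof -
    have "expectation (\<lambda>\<omega>. I T \<omega> \<bullet> Y 0 \<omega>) = expectation (\<lambda>\<omega>. I 0 \<omega> \<bullet> Y 0 \<omega>)"
      by (rule A.integral_orthogonal[OF TT(2) sqY0 Y0]) simp
    also have "\<dots> = 0" by (rule integral_eq_zero_AE) (use I0 in auto)
    finally show ?thesis .
  qed
  finally have "expectation (\<lambda>\<omega>. (p 0 \<omega> + I T \<omega>) \<bullet> G \<omega>) =
      expectation (\<lambda>\<omega>. p 0 \<omega> \<bullet> Y 0 \<omega>) + expectation (\<lambda>\<omega>. I T \<omega> \<bullet> Z T \<omega>)" by simp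
  with bY pg split parts lift iso show "(\<integral>(t, \<omega>). b t \<omega> \<bullet> Y t \<omega> \<partial>LM) - (\<integral>(t, \<omega>). p t \<omega> \<bullet> g t \<omega> \<partial>LM)
    + (\<integral>(t, \<omega>). \<sigma> t \<omega> \<bullet> (z1 t \<omega> - z2 t \<omega>) \<partial>LM) = - expectation (\<lambda>\<omega>. p 0 \<omega> \<bullet> Y 0 \<omega>)"
    by linarith
qed

text \<open>By the isometry, the three terms of the expanded square \<open>E \<bar>I\<^sub>1 - I\<^sub>2\<bar>\<^sup>2\<close> cancel.\<close>

lemma ito_integral_unique:
  fixes z1 z2 :: "real \<Rightarrow> 'w \<Rightarrow> real^'d^'n"
  assumes ito: "is_ito_integral M W T z1 I1" "is_ito_integral M W T z2 I2"
    and eq: "AE x in LM. case_prod z1 x = case_prod z2 x"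
  shows "AE \<omega> in M. I1 T \<omega> = I2 T \<omega>"
proof -
  interpret B1: ito_integral M W T z1 I1 by unfold_locales fact
  interpret B2: ito_integral M W T z2 I2 by unfold_locales fact
  have TT: "T \<in> {0..T}" using horizon_nonneg by auto
  note s1 = B1.integral_sq[OF TT] and s2 = B2.integral_sq[OF TT]
  have eq': "(\<integral>(t, \<omega>). z1 t \<omega> \<bullet> z1 t \<omega> \<partial>LM) = (\<integral>(t, \<omega>). z1 t \<omega> \<bullet> z2 t \<omega> \<partial>LM)"
    "(\<integral>(t, \<omega>). z2 t \<omega> \<bullet> z2 t \<omega> \<partial>LM) = (\<integral>(t, \<omega>). z1 t \<omega> \<bullet> z2 t \<omega> \<partial>LM)"
    using inner_process_integrable[OF B1.integrand_sq B1.integrand_sq]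
      inner_process_integrable[OF B1.integrand_sq B2.integrand_sq]
      inner_process_integrable[OF B2.integrand_sq B2.integrand_sq]
    by (auto intro!: integral_cong_AE simp: split_beta' intro: eventually_mono[OF eq])
  have "expectation (\<lambda>\<omega>. (norm (I1 T \<omega> - I2 T \<omega>))\<^sup>2) =
      expectation (\<lambda>\<omega>. I1 T \<omega> \<bullet> I1 T \<omega> - 2 * (I1 T \<omega> \<bullet> I2 T \<omega>) + I2 T \<omega> \<bullet> I2 T \<omega>)"
    by (intro Bochner_Integration.integral_cong refl)
      (simp add: power2_norm_eq_inner inner_diff_left inner_diff_right inner_commute)
  also have "\<dots> = expectation (\<lambda>\<omega>. I1 T \<omega> \<bullet> I1 T \<omega>) - 2 * expectation (\<lambda>\<omega>. I1 T \<omega> \<bullet> I2 T \<omega>)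
      + expectation (\<lambda>\<omega>. I2 T \<omega> \<bullet> I2 T \<omega>)"
    using integrable_inner[OF s1 s1] integrable_inner[OF s1 s2] integrable_inner[OF s2 s2] by simp
  also have "\<dots> = 0"
    using ito_isometry[OF horizon_nonneg ito(1,1)] ito_isometry[OF horizon_nonneg ito(1,2)]
      ito_isometry[OF horizon_nonneg ito(2,2)] eq' by simp
  finally have "AE \<omega> in M. (norm (I1 T \<omega> - I2 T \<omega>))\<^sup>2 = 0"
    using sq_integrable_norm_square[OF sq_integrable_diff[OF s1 s2]]
    by (subst (asm) integral_nonneg_eq_0_iff_AE) auto
  then show ?thesis by eventually_elim simp
qed

end

section \<open>Conditional expectations\<close>

lemma (in finite_measure_subalgebra) real_cond_exp_bounded:
  assumes "integrable M f" "AE x in M. \<bar>f x\<bar> \<le> C"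
  shows "AE x in M. \<bar>real_cond_exp M F f x\<bar> \<le> C"
proof -
  have "AE x in M. real_cond_exp M F f x \<le> C" "AE x in M. real_cond_exp M F f x \<ge> - C"
    by (rule real_cond_exp_le_c real_cond_exp_ge_c; use assms in auto)+
  then show ?thesis by eventually_elim auto
qed

text \<open>An integral of random variables that are all measurable with respect to the sub-algebra \<open>F\<close> is
  measurable with respect to \<open>F\<close> only up to a null set, since the integrand is jointly measurable only
  with respect to the large algebra.  For the sign \<open>\<zeta>\<close> of the difference between the integral and its
  conditional expectation, Fubini's theorem lets \<open>\<zeta>\<close> be replaced by its conditional expectation under
  the integral; hence \<open>\<zeta>\<close> is orthogonal to the difference, which is therefore zero.\<close>

lemma (in finite_measure_subalgebra) integral_of_measurable_eq_cond_exp: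
  fixes \<psi> :: "'b \<Rightarrow> 'a \<Rightarrow> real"
  assumes "sigma_finite_measure A" and int: "integrable (M \<Otimes>\<^sub>M A) (\<lambda>(\<omega>, s). \<psi> s \<omega>)"
    and adapted: "\<And>s. s \<in> space A \<Longrightarrow> \<psi> s \<in> borel_measurable F"
  shows "AE \<omega> in M. (\<integral>s. \<psi> s \<omega> \<partial>A) = real_cond_exp M F (\<lambda>\<omega>. \<integral>s. \<psi> s \<omega> \<partial>A) \<omega>"
proof -
  interpret A: sigma_finite_measure A by fact
  interpret P: pair_sigma_finite M A ..
  have m [measurable]: "(\<lambda>x. \<psi> (snd x) (fst x)) \<in> borel_measurable (M \<Otimes>\<^sub>M A)"
    using int by (auto simp: split_beta')
  define D where "D \<omega> = (\<integral>s. \<psi> s \<omega> \<partial>A)" for \<omega>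
  have D: "integrable M D" using P.integrable_fst[OF int] by (simp add: D_def[abs_def])
  define E where "E = real_cond_exp M F D"
  have E: "integrable M E" "E \<in> borel_measurable F" using D by (auto simp: E_def)
  have Em [measurable]: "E \<in> borel_measurable M" "D \<in> borel_measurable M" using E D by auto
  define \<zeta> where "\<zeta> \<omega> = sgn (D \<omega> - E \<omega>)" for \<omega>
  have zm [measurable]: "\<zeta> \<in> borel_measurable M" unfolding \<zeta>_def by measurable
  have zb: "\<bar>\<zeta> \<omega>\<bar> \<le> 1" for \<omega> by (simp add: \<zeta>_def sgn_if)
  have zi: "integrable M \<zeta>" by (rule integrable_const_bound[of _ 1]) (use zb in auto)
  define \<eta> where "\<eta> = real_cond_exp M F \<zeta>"
  have \<eta>b: "AE \<omega> in M. \<bar>\<eta> \<omega>\<bar> \<le> 1"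
    unfolding \<eta>_def by (rule real_cond_exp_bounded[OF zi]) (use zb in auto)
  have \<eta>F: "\<eta> \<in> borel_measurable F" by (simp add: \<eta>_def)
  then have \<eta>m [measurable]: "\<eta> \<in> borel_measurable M" using measurable_from_subalg[OF subalg] by blast
  have mult_int: "integrable M (\<lambda>\<omega>. k \<omega> * f \<omega>)"
    if "integrable M f" "k \<in> borel_measurable M" "AE \<omega> in M. \<bar>k \<omega>\<bar> \<le> 1" for k f :: "'a \<Rightarrow> real"
  proof (rule Bochner_Integration.integrable_bound[OF that(1)])
    show "AE \<omega> in M. norm (k \<omega> * f \<omega>) \<le> norm (f \<omega>)"
      using that(3) by eventually_elim (simp add: abs_mult mult_left_le_one_le)
  qed (use that in auto)
  have zb': "AE \<omega> in M. \<bar>\<zeta> \<omega>\<bar> \<le> 1" using zb by auto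
  have ki: "integrable (M \<Otimes>\<^sub>M A) (\<lambda>(\<omega>, s). k \<omega> * \<psi> s \<omega>)"
    if [measurable]: "k \<in> borel_measurable M" and b: "AE \<omega> in M. \<bar>k \<omega>\<bar> \<le> 1" for k
  proof -
    have "AE x in M \<Otimes>\<^sub>M A. \<bar>k (fst x)\<bar> \<le> 1"
    proof (rule P.AE_pair_measure)
      show "{x \<in> space (M \<Otimes>\<^sub>M A). \<bar>k (fst x)\<bar> \<le> 1} \<in> sets (M \<Otimes>\<^sub>M A)" by measurable
      show "AE \<omega> in M. AE s in A. \<bar>k (fst (\<omega>, s))\<bar> \<le> 1" using b by eventually_elim simp
    qed
    then show ?thesis
      by (intro Bochner_Integration.integrable_bound[OF int])
        (auto simp: split_beta' abs_mult mult_left_le_one_le elim: eventually_mono)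
  qed
  have step: "(\<integral>\<omega>. k \<omega> * D \<omega> \<partial>M) = (\<integral>s. \<integral>\<omega>. k \<omega> * \<psi> s \<omega> \<partial>M \<partial>A)"
    if "k \<in> borel_measurable M" "AE \<omega> in M. \<bar>k \<omega>\<bar> \<le> 1" for k
  proof -
    have "(\<integral>\<omega>. k \<omega> * D \<omega> \<partial>M) = (\<integral>\<omega>. \<integral>s. k \<omega> * \<psi> s \<omega> \<partial>A \<partial>M)" by (simp add: D_def)
    also have "\<dots> = (\<integral>s. \<integral>\<omega>. k \<omega> * \<psi> s \<omega> \<partial>M \<partial>A)" by (rule P.Fubini_integral[symmetric, OF ki[OF that]])
    finally show ?thesis .
  qed
  have "(\<integral>\<omega>. \<zeta> \<omega> * E \<omega> \<partial>M) = (\<integral>\<omega>. E \<omega> * \<zeta> \<omega> \<partial>M)" by (simp add: mult.commute)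
  also have "\<dots> = (\<integral>\<omega>. E \<omega> * \<eta> \<omega> \<partial>M)"
    unfolding \<eta>_def by (rule real_cond_exp_intg(2)[symmetric])
      (use mult_int[OF E(1) zm zb'] E(2) zm in \<open>simp_all add: mult.commute\<close>)
  also have "\<dots> = (\<integral>\<omega>. \<eta> \<omega> * E \<omega> \<partial>M)" by (simp add: mult.commute)
  also have "\<dots> = (\<integral>\<omega>. \<eta> \<omega> * D \<omega> \<partial>M)"
    unfolding E_def by (rule real_cond_exp_intg(2)) (use mult_int[OF D \<eta>m \<eta>b] \<eta>F in simp_all)
  also have "\<dots> = (\<integral>s. \<integral>\<omega>. \<eta> \<omega> * \<psi> s \<omega> \<partial>M \<partial>A)" by (rule step[OF \<eta>m \<eta>b])
  also have "\<dots> = (\<integral>s. \<integral>\<omega>. \<zeta> \<omega> * \<psi> s \<omega> \<partial>M \<partial>A)"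
  proof (rule integral_cong_AE)
    have "AE s in A. integrable M (\<psi> s)" using P.AE_integrable_snd[OF int] .
    with AE_space show "AE s in A. (\<integral>\<omega>. \<eta> \<omega> * \<psi> s \<omega> \<partial>M) = (\<integral>\<omega>. \<zeta> \<omega> * \<psi> s \<omega> \<partial>M)"
    proof eventually_elim
      case (elim s)
      have "(\<integral>\<omega>. \<psi> s \<omega> * \<eta> \<omega> \<partial>M) = (\<integral>\<omega>. \<psi> s \<omega> * \<zeta> \<omega> \<partial>M)"
        unfolding \<eta>_def by (rule real_cond_exp_intg(2))
          (use mult_int[OF elim(2) zm zb'] adapted[OF elim(1)] in \<open>simp_all add: mult.commute\<close>)
      then show ?case by (simp add: mult.commute)
    qed
  qed (use P.integrable_snd[OF ki[OF \<eta>m \<eta>b]] P.integrable_snd[OF ki[OF zm zb']] in auto)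
  also have "\<dots> = (\<integral>\<omega>. \<zeta> \<omega> * D \<omega> \<partial>M)" by (rule step[OF zm zb', symmetric])
  finally have "(\<integral>\<omega>. \<zeta> \<omega> * (D \<omega> - E \<omega>) \<partial>M) = 0"
    using mult_int[OF D zm zb'] mult_int[OF E(1) zm zb'] by (simp add: right_diff_distrib)
  moreover have "\<zeta> \<omega> * (D \<omega> - E \<omega>) = \<bar>D \<omega> - E \<omega>\<bar>" for \<omega>
    by (simp add: \<zeta>_def sgn_if abs_if)
  ultimately have "(\<integral>\<omega>. \<bar>D \<omega> - E \<omega>\<bar> \<partial>M) = 0" by simp
  then have "AE \<omega> in M. \<bar>D \<omega> - E \<omega>\<bar> = 0"
    using D E(1) by (subst (asm) integral_nonneg_eq_0_iff_AE) auto
  then show ?thesis by eventually_elim (simp add: E_def D_def[abs_def])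
qed

lemma (in prob_space) vec_cond_exp_inner:
  fixes X Y :: "'a \<Rightarrow> 'h::euclidean_space"
  assumes G: "subalgebra M G" and X: "sq_integrable M X" and Y: "sq_integrable M Y" "Y \<in> borel_measurable G"
  shows "integrable M (\<lambda>\<omega>. vec_cond_exp M G X \<omega> \<bullet> Y \<omega>)"
    and "expectation (\<lambda>\<omega>. vec_cond_exp M G X \<omega> \<bullet> Y \<omega>) = expectation (\<lambda>\<omega>. X \<omega> \<bullet> Y \<omega>)"
proof -
  interpret finite_measure_subalgebra M G by unfold_locales fact
  have i: "integrable M (\<lambda>\<omega>. (Y \<omega> \<bullet> b) * (X \<omega> \<bullet> b))" for b
    using integrable_inner[OF sq_integrable_inner_const[OF Y(1), of b] sq_integrable_inner_const[OF X, of b]]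
    by (simp add: mult.commute)
  have Yb: "(\<lambda>\<omega>. Y \<omega> \<bullet> b) \<in> borel_measurable G" and Xb: "(\<lambda>\<omega>. X \<omega> \<bullet> b) \<in> borel_measurable M" for b
    using Y(2) X by (auto simp: sq_integrable_def)
  have eq: "vec_cond_exp M G X \<omega> \<bullet> Y \<omega> = (\<Sum>b\<in>Basis. (Y \<omega> \<bullet> b) * real_cond_exp M G (\<lambda>\<omega>'. X \<omega>' \<bullet> b) \<omega>)" for \<omega>
    by (simp add: vec_cond_exp_def inner_sum_left) (simp add: inner_commute mult.commute)
  note c = real_cond_exp_intg[OF i Yb Xb]
  show "integrable M (\<lambda>\<omega>. vec_cond_exp M G X \<omega> \<bullet> Y \<omega>)"
    unfolding eq by (intro Bochner_Integration.integrable_sum c)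
  have "expectation (\<lambda>\<omega>. vec_cond_exp M G X \<omega> \<bullet> Y \<omega>) = (\<Sum>b\<in>Basis. expectation (\<lambda>\<omega>. (Y \<omega> \<bullet> b) * (X \<omega> \<bullet> b)))"
    unfolding eq using c by (simp add: Bochner_Integration.integral_sum)
  also have "\<dots> = expectation (\<lambda>\<omega>. \<Sum>b\<in>Basis. (Y \<omega> \<bullet> b) * (X \<omega> \<bullet> b))"
    using i by (simp add: Bochner_Integration.integral_sum)
  also have "\<dots> = expectation (\<lambda>\<omega>. X \<omega> \<bullet> Y \<omega>)"
    by (intro Bochner_Integration.integral_cong refl)
      (subst (2) euclidean_inner, simp add: mult.commute)
  finally show "expectation (\<lambda>\<omega>. vec_cond_exp M G X \<omega> \<bullet> Y \<omega>) = expectation (\<lambda>\<omega>. X \<omega> \<bullet> Y \<omega>)" .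
qed

section \<open>Delayed and advanced processes\<close>

text \<open>The kernel and the processes are given only from time \<open>- \<delta>\<close> on, so the delay measure is restricted to
  \<open>[- \<delta>, T]\<close>, and the window \<open>[t - \<delta>, t]\<close> becomes a factor of the integrand.\<close>

locale delay_kernel = brownian_interval M W T for M :: "'w measure" and W :: "real \<Rightarrow> 'w \<Rightarrow> real^'d" and T +
  fixes \<delta> :: real and \<alpha> :: "real measure" and K :: "real \<Rightarrow> real \<Rightarrow> 'w \<Rightarrow> real" and C :: real
  assumes delay_nonneg: "0 \<le> \<delta>"
    and sets_\<alpha> [measurable_cong]: "sets \<alpha> = sets borel"
    and sigma_finite_\<alpha>: "sigma_finite_measure \<alpha>"
    and ac_\<alpha>: "absolutely_continuous lborel \<alpha>"
    and K_measurable: "(\<lambda>(t, s, \<omega>). K t s \<omega>) \<in> borel_measurable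
      (interval_measure 0 T \<Otimes>\<^sub>M restrict_space \<alpha> {-\<delta>..T} \<Otimes>\<^sub>M M)"
    and K_adapted: "\<And>t s. t \<in> {0..T} \<Longrightarrow> s \<in> {-\<delta>..T} \<Longrightarrow> K t s \<in> borel_measurable (F s)"
    and K_bounded: "\<And>t s \<omega>. t \<in> {0..T} \<Longrightarrow> s \<in> {-\<delta>..T} \<Longrightarrow> \<omega> \<in> space M \<Longrightarrow> \<bar>K t s \<omega>\<bar> \<le> C"
begin

abbreviation "A \<equiv> restrict_space \<alpha> {-\<delta>..T}"

sublocale A: sigma_finite_measure A
  by (rule sigma_finite_measure_restrict_space[OF sigma_finite_\<alpha>]) (simp add: sets_\<alpha>)

sublocale NA: pair_sigma_finite "LM" A ..

lemma space_A [simp]: "space A = {-\<delta>..T}"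
  using sets_eq_imp_space_eq[OF sets_\<alpha>] by (simp add: space_restrict_space)

lemma id_A: "(\<lambda>s. s) \<in> borel_measurable A"
  by (rule measurable_restrict_space1) (simp add: measurable_cong_sets[OF sets_\<alpha> refl])

text \<open>Time and outcome form one argument, so that Fubini's theorem applies to the product of their joint
  space with the delay measure.\<close>

definition delay_integrand :: "(real \<Rightarrow> 'w \<Rightarrow> 'h::euclidean_space) \<Rightarrow> real \<times> 'w \<Rightarrow> real \<Rightarrow> 'h" where
  "delay_integrand x n s = of_bool (fst n - \<delta> \<le> s \<and> s \<le> fst n) *\<^sub>R (K (fst n) s (snd n) *\<^sub>R x s (snd n))"

definition delay_integral :: "(real \<Rightarrow> 'w \<Rightarrow> 'h::euclidean_space) \<Rightarrow> real \<Rightarrow> 'w \<Rightarrow> 'h" where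
  "delay_integral x t \<omega> = (\<integral>s. delay_integrand x (t, \<omega>) s \<partial>A)"

definition delayable :: "(real \<Rightarrow> 'w \<Rightarrow> 'h::euclidean_space) \<Rightarrow> bool" where
  "delayable x \<longleftrightarrow> case_prod x \<in> borel_measurable (A \<Otimes>\<^sub>M M) \<and>
    (\<integral>\<^sup>+n. (\<integral>\<^sup>+s. ennreal (norm (delay_integrand x n s)) \<partial>A)\<^sup>2 \<partial>LM) < \<infinity>"

lemma kernel_window_measurable:
  "(\<lambda>(n, s). of_bool (fst n - \<delta> \<le> s \<and> s \<le> fst n) * K (fst n) s (snd n)) \<in> borel_measurable (LM \<Otimes>\<^sub>M A)"
proof -
  have [measurable]: "(\<lambda>x. fst (fst x)) \<in> borel_measurable (LM \<Otimes>\<^sub>M A)"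
    by (rule measurable_compose[OF _ interval_id_measurable]) measurable
  have [measurable]: "(\<lambda>x. snd x) \<in> borel_measurable (LM \<Otimes>\<^sub>M A)"
    by (rule measurable_compose[OF measurable_snd id_A])
  have "(\<lambda>x. (fst (fst x), snd x, snd (fst x))) \<in> LM \<Otimes>\<^sub>M A \<rightarrow>\<^sub>M L \<Otimes>\<^sub>M A \<Otimes>\<^sub>M M"
    by (intro measurable_Pair measurable_compose[OF measurable_fst] measurable_fst measurable_snd)
  from measurable_compose[OF this K_measurable]
  have [measurable]: "(\<lambda>x. K (fst (fst x)) (snd x) (snd (fst x))) \<in> borel_measurable (LM \<Otimes>\<^sub>M A)"
    by simp
  show ?thesis unfolding split_beta' by measurable
qed

lemma delay_integrand_measurable:
  assumes "case_prod x \<in> borel_measurable (A \<Otimes>\<^sub>M M)"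
  shows "(\<lambda>(n, s). delay_integrand x n s) \<in> borel_measurable (LM \<Otimes>\<^sub>M A)"
proof -
  have "(\<lambda>z. (snd z, snd (fst z))) \<in> LM \<Otimes>\<^sub>M A \<rightarrow>\<^sub>M A \<Otimes>\<^sub>M M"
    by (intro measurable_Pair measurable_compose[OF measurable_fst] measurable_fst measurable_snd)
  from measurable_compose[OF this assms]
  have "(\<lambda>z. x (snd z) (snd (fst z))) \<in> borel_measurable (LM \<Otimes>\<^sub>M A)" by simp
  from borel_measurable_scaleR[OF kernel_window_measurable this]
  show ?thesis by (simp add: delay_integrand_def split_beta')
qed

lemma delayable_facts:
  assumes "delayable x"
  shows "AE n in LM. integrable A (delay_integrand x n)"
    and "sq_integrable LM (\<lambda>n. \<integral>s. norm (delay_integrand x n s) \<partial>A)"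
    and "sq_process (delay_integral x)"
proof -
  have xm: "case_prod x \<in> borel_measurable (A \<Otimes>\<^sub>M M)" using assms by (simp add: delayable_def)
  note m [measurable] = delay_integrand_measurable[OF xm]
  define \<nu> where "\<nu> n = (\<integral>\<^sup>+s. ennreal (norm (delay_integrand x n s)) \<partial>A)" for n
  have \<nu>m [measurable]: "\<nu> \<in> borel_measurable LM"
    unfolding \<nu>_def by (rule A.borel_measurable_nn_integral) (use m in \<open>simp add: split_beta'\<close>)
  have fin: "(\<integral>\<^sup>+n. (\<nu> n)\<^sup>2 \<partial>LM) < \<infinity>" using assms by (simp add: delayable_def \<nu>_def)
  then have "AE n in LM. (\<nu> n)\<^sup>2 \<noteq> \<infinity>"
    by (intro nn_integral_PInf_AE) auto
  then have \<nu>fin: "AE n in LM. \<nu> n < \<infinity>"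
    by eventually_elim (auto simp: power2_eq_square ennreal_top_mult less_top[symmetric])
  with AE_space show int: "AE n in LM. integrable A (delay_integrand x n)"
  proof eventually_elim
    case (elim n)
    have "delay_integrand x n \<in> borel_measurable A"
      using measurable_Pair2[OF m elim(1)] by simp
    then show ?case using elim(2) by (simp add: integrable_iff_bounded \<nu>_def)
  qed
  have nm: "(\<lambda>n. \<integral>s. norm (delay_integrand x n s) \<partial>A) \<in> borel_measurable LM"
    by (rule A.borel_measurable_lebesgue_integral) (use m in \<open>simp add: split_beta'\<close>)
  show sq: "sq_integrable LM (\<lambda>n. \<integral>s. norm (delay_integrand x n s) \<partial>A)"
    unfolding sq_integrable_iff_nn_integral[OF nm]
  proof (rule le_less_trans[OF nn_integral_mono_AE fin])
    show "AE n in LM. ennreal ((norm (\<integral>s. norm (delay_integrand x n s) \<partial>A))\<^sup>2) \<le> (\<nu> n)\<^sup>2"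
      using int
    proof eventually_elim
      case (elim n)
      have "\<nu> n = ennreal (\<integral>s. norm (delay_integrand x n s) \<partial>A)"
        unfolding \<nu>_def by (rule nn_integral_eq_integral) (use elim in auto)
      then show ?case by (simp add: ennreal_power)
    qed
  qed
  show "sq_process (delay_integral x)"
  proof (rule sq_integrable_norm_bound[OF _ sq])
    have "(\<lambda>n. \<integral>s. delay_integrand x n s \<partial>A) \<in> borel_measurable LM"
      by (rule A.borel_measurable_lebesgue_integral) (use m in \<open>simp add: split_beta'\<close>)
    then show "case_prod (delay_integral x) \<in> borel_measurable LM"
      by (simp add: delay_integral_def split_beta')
    show "AE n in LM. norm (case_prod (delay_integral x) n) \<le> norm (\<integral>s. norm (delay_integrand x n s) \<partial>A)"
      by (intro AE_I2) (auto simp: delay_integral_def split_beta' intro: integral_norm_bound order_trans)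
  qed
qed

lemma delayable_diff:
  assumes x: "delayable x" and x': "delayable x'"
  shows "delayable (\<lambda>s \<omega>. x s \<omega> - x' s \<omega>)"
    and "AE n in LM. case_prod (delay_integral (\<lambda>s \<omega>. x s \<omega> - x' s \<omega>)) n =
      case_prod (delay_integral x) n - case_prod (delay_integral x') n"
proof -
  have m: "case_prod x \<in> borel_measurable (A \<Otimes>\<^sub>M M)" "case_prod x' \<in> borel_measurable (A \<Otimes>\<^sub>M M)"
    using assms by (simp_all add: delayable_def)
  then have md: "case_prod (\<lambda>s \<omega>. x s \<omega> - x' s \<omega>) \<in> borel_measurable (A \<Otimes>\<^sub>M M)"
    by (simp add: split_beta')
  have d: "delay_integrand (\<lambda>s \<omega>. x s \<omega> - x' s \<omega>) n s = delay_integrand x n s - delay_integrand x' n s" for n s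
    by (simp add: delay_integrand_def algebra_simps)
  note i = delayable_facts(1)[OF x] delayable_facts(1)[OF x']
  have sq: "sq_integrable LM (\<lambda>n. (\<integral>s. norm (delay_integrand x n s) \<partial>A) + (\<integral>s. norm (delay_integrand x' n s) \<partial>A))"
    by (rule sq_integrable_add[OF delayable_facts(2)[OF x] delayable_facts(2)[OF x']])
  show "delayable (\<lambda>s \<omega>. x s \<omega> - x' s \<omega>)"
    unfolding delayable_def
  proof (intro conjI md)
    have "(\<integral>\<^sup>+n. (\<integral>\<^sup>+s. ennreal (norm (delay_integrand (\<lambda>s \<omega>. x s \<omega> - x' s \<omega>) n s)) \<partial>A)\<^sup>2 \<partial>LM) \<le>
      (\<integral>\<^sup>+n. ennreal ((norm ((\<integral>s. norm (delay_integrand x n s) \<partial>A) + (\<integral>s. norm (delay_integrand x' n s) \<partial>A)))\<^sup>2) \<partial>LM)"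
    proof (rule nn_integral_mono_AE)
      show "AE n in LM. (\<integral>\<^sup>+s. ennreal (norm (delay_integrand (\<lambda>s \<omega>. x s \<omega> - x' s \<omega>) n s)) \<partial>A)\<^sup>2 \<le>
        ennreal ((norm ((\<integral>s. norm (delay_integrand x n s) \<partial>A) + (\<integral>s. norm (delay_integrand x' n s) \<partial>A)))\<^sup>2)"
        using i
      proof eventually_elim
        case (elim n)
        have "(\<integral>\<^sup>+s. ennreal (norm (delay_integrand (\<lambda>s \<omega>. x s \<omega> - x' s \<omega>) n s)) \<partial>A) \<le>
            (\<integral>\<^sup>+s. ennreal (norm (delay_integrand x n s) + norm (delay_integrand x' n s)) \<partial>A)"
          unfolding d by (intro nn_integral_mono ennreal_leI norm_triangle_ineq4)
        also have "\<dots> = ennreal (\<integral>s. norm (delay_integrand x n s) + norm (delay_integrand x' n s) \<partial>A)"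
          by (rule nn_integral_eq_integral) (use elim in auto)
        also have "\<dots> = ennreal ((\<integral>s. norm (delay_integrand x n s) \<partial>A) + (\<integral>s. norm (delay_integrand x' n s) \<partial>A))"
          using elim by simp
        finally show ?case
          by (auto simp: ennreal_power[symmetric] intro!: power_mono)
      qed
    qed
    also have "\<dots> < \<infinity>" using sq sq_integrable_iff_nn_integral[OF sq_integrable_measurable[OF sq]] by simp
    finally show "(\<integral>\<^sup>+n. (\<integral>\<^sup>+s. ennreal (norm (delay_integrand (\<lambda>s \<omega>. x s \<omega> - x' s \<omega>) n s)) \<partial>A)\<^sup>2 \<partial>LM) < \<infinity>" .
  qed
  show "AE n in LM. case_prod (delay_integral (\<lambda>s \<omega>. x s \<omega> - x' s \<omega>)) n =
      case_prod (delay_integral x) n - case_prod (delay_integral x') n"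
    using i
  proof eventually_elim
    case (elim n)
    then show ?case by (simp add: delay_integral_def split_beta' d)
  qed
qed

text \<open>Each factor of the integrand is known at the time \<open>s \<le> t\<close> of its past argument, so
  \<open>integral_of_measurable_eq_cond_exp\<close> applies in each coordinate.\<close>

lemma delay_integral_adapted:
  fixes x :: "real \<Rightarrow> 'w \<Rightarrow> 'h::euclidean_space"
  assumes x: "delayable x" and adapted: "\<And>s. s \<in> {-\<delta>..T} \<Longrightarrow> x s \<in> borel_measurable (F s)"
  shows "AE t in L. \<exists>g\<in>borel_measurable (F t). AE \<omega> in M. delay_integral x t \<omega> = g \<omega>"
proof -
  interpret MA: pair_sigma_finite M A ..
  have xm: "case_prod x \<in> borel_measurable (A \<Otimes>\<^sub>M M)" using x by (simp add: delayable_def)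
  have sl: "AE t in L. sq_integrable M (\<lambda>\<omega>. \<integral>s. norm (delay_integrand x (t, \<omega>) s) \<partial>A)"
    using AE_sq_integrable_slice[of "\<lambda>t \<omega>. \<integral>s. norm (delay_integrand x (t, \<omega>) s) \<partial>A"] delayable_facts(2)[OF x]
    by (simp add: split_beta')
  have il: "AE t in L. AE \<omega> in M. integrable A (delay_integrand x (t, \<omega>))"
    using LM.AE_pair[OF delayable_facts(1)[OF x]] .
  from sl il AE_space show ?thesis
  proof eventually_elim
    case (elim t)
    then have t: "t \<in> {0..T}" by simp
    have "(\<lambda>z. ((t, fst z), snd z)) \<in> M \<Otimes>\<^sub>M A \<rightarrow>\<^sub>M LM \<Otimes>\<^sub>M A"
      using t by (intro measurable_Pair measurable_const measurable_fst measurable_snd) simp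
    from measurable_compose[OF this delay_integrand_measurable[OF xm]]
    have m: "(\<lambda>(\<omega>, s). delay_integrand x (t, \<omega>) s) \<in> borel_measurable (M \<Otimes>\<^sub>M A)" by (simp add: split_beta')
    have int: "integrable (M \<Otimes>\<^sub>M A) (\<lambda>(\<omega>, s). delay_integrand x (t, \<omega>) s)"
      using sq_integrable_imp_integrable[OF elim(1)] elim(2)
      by (intro MA.Fubini_integrable[OF m]) simp_all
    define \<psi> where "\<psi> b s \<omega> = delay_integrand x (t, \<omega>) s \<bullet> b" for b s \<omega>
    have \<psi>i: "integrable (M \<Otimes>\<^sub>M A) (\<lambda>(\<omega>, s). \<psi> b s \<omega>)" for b
      using integrable_inner_left[OF int, of b] by (simp add: \<psi>_def split_beta')
    have \<psi>F: "\<psi> b s \<in> borel_measurable (F t)" if s: "s \<in> {-\<delta>..T}" for b s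
    proof (cases "t - \<delta> \<le> s \<and> s \<le> t")
      case True
      have [measurable]: "K t s \<in> borel_measurable (F t)" "x s \<in> borel_measurable (F t)"
        using filtration_measurable_mono[OF K_adapted[OF t s]] filtration_measurable_mono[OF adapted[OF s]] True
        by auto
      show ?thesis unfolding \<psi>_def delay_integrand_def using True by simp
    next
      case False
      then have "\<psi> b s = (\<lambda>_. 0)" by (auto simp: \<psi>_def delay_integrand_def fun_eq_iff)
      then show ?thesis by simp
    qed
    interpret S: finite_measure_subalgebra M "F t"
      by unfold_locales (rule subalgebra_filtration)
    have comp: "AE \<omega> in M. \<forall>b\<in>Basis. (\<integral>s. \<psi> b s \<omega> \<partial>A) = real_cond_exp M (F t) (\<lambda>\<omega>. \<integral>s. \<psi> b s \<omega> \<partial>A) \<omega>"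
      by (rule AE_finite_allI[OF finite_Basis])
        (rule S.integral_of_measurable_eq_cond_exp[OF A.sigma_finite_measure_axioms \<psi>i \<psi>F], simp)
    show ?case
    proof (intro bexI)
      show "(\<lambda>\<omega>. \<Sum>b\<in>Basis. real_cond_exp M (F t) (\<lambda>\<omega>. \<integral>s. \<psi> b s \<omega> \<partial>A) \<omega> *\<^sub>R b) \<in> borel_measurable (F t)"
        by measurable
      show "AE \<omega> in M. delay_integral x t \<omega> =
          (\<Sum>b\<in>Basis. real_cond_exp M (F t) (\<lambda>\<omega>. \<integral>s. \<psi> b s \<omega> \<partial>A) \<omega> *\<^sub>R b)"
        using comp elim(2)
      proof eventually_elim
        case (elim \<omega>)
        have "delay_integral x t \<omega> = (\<Sum>b\<in>Basis. (delay_integral x t \<omega> \<bullet> b) *\<^sub>R b)"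
          by (rule euclidean_representation[symmetric])
        also have "\<dots> = (\<Sum>b\<in>Basis. (\<integral>s. \<psi> b s \<omega> \<partial>A) *\<^sub>R b)"
          unfolding delay_integral_def \<psi>_def using elim(2) by simp
        also have "\<dots> = (\<Sum>b\<in>Basis. real_cond_exp M (F t) (\<lambda>\<omega>. \<integral>s. \<psi> b s \<omega> \<partial>A) \<omega> *\<^sub>R b)"
          by (intro sum.cong refl arg_cong2[where f = scaleR]) (use elim(1) in blast)
        finally show ?case .
      qed
    qed
  qed
qed

definition advance_integral :: "(real \<Rightarrow> 'w \<Rightarrow> 'h::euclidean_space) \<Rightarrow> real \<Rightarrow> 'w \<Rightarrow> 'h" where
  "advance_integral q s \<omega> = (\<integral>t. of_bool (t - \<delta> \<le> s \<and> s \<le> t) *\<^sub>R (K t s \<omega> *\<^sub>R q t \<omega>) \<partial>L)"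

definition advance :: "(real \<Rightarrow> 'w \<Rightarrow> 'h::euclidean_space) \<Rightarrow> real \<Rightarrow> 'w \<Rightarrow> 'h" where
  "advance q s \<omega> = enn2real (RN_deriv lborel \<alpha> s) *\<^sub>R vec_cond_exp M (F s) (advance_integral q s) \<omega>"

text \<open>In the pairing of \<open>q\<close> with the delayed \<open>x\<close>, integrating over the present time \<open>t\<close> first leaves, for each
  past time \<open>s\<close>, the expected inner product of \<open>x(s)\<close> with the integral of \<open>q(t)\<close> times the kernel over
  \<open>[s, s + \<delta>]\<close>.  As \<open>x(s)\<close> is known at time \<open>s\<close>, that integral may be replaced by its conditional
  expectation; the density of \<open>\<alpha>\<close> turns the integration over \<open>s\<close> into one over ordinary time.

  The conditional expectations are chosen separately for each \<open>s\<close>, so the advanced process is not known to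
  be jointly measurable; \<open>\<kappa>\<close> is a version of its pairing with \<open>x\<close> that is integrable in time.\<close>

lemma advance_delay_duality:
  fixes q x :: "real \<Rightarrow> 'w \<Rightarrow> 'h::euclidean_space"
  assumes q: "sq_process q"
    and x: "delayable x" "sq_process x" "\<And>s. s \<in> {0..T} \<Longrightarrow> x s \<in> borel_measurable (F s)"
    and past: "\<And>s. s \<in> {-\<delta>..<0} \<Longrightarrow> AE \<omega> in M. x s \<omega> = 0"
  shows "\<exists>\<kappa>. integrable L \<kappa> \<and> (\<integral>s. \<kappa> s \<partial>L) = (\<integral>(t, \<omega>). q t \<omega> \<bullet> delay_integral x t \<omega> \<partial>LM) \<and>
    (AE s in L. integrable M (\<lambda>\<omega>. advance q s \<omega> \<bullet> x s \<omega>) \<and> expectation (\<lambda>\<omega>. advance q s \<omega> \<bullet> x s \<omega>) = \<kappa> s)"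
proof -
  have xm: "case_prod x \<in> borel_measurable (A \<Otimes>\<^sub>M M)" using x by (simp add: delayable_def)
  note xi = delayable_facts[OF x(1)]
  have qm: "case_prod q \<in> borel_measurable LM" using q by (rule sq_integrable_measurable)
  have qm1: "(\<lambda>z. case_prod q (fst z)) \<in> borel_measurable (LM \<Otimes>\<^sub>M A)"
    by (rule measurable_compose[OF measurable_fst qm])
  define \<Phi> where "\<Phi> n s = case_prod q n \<bullet> delay_integrand x n s" for n s
  define \<psi> where "\<psi> s = (\<integral>n. \<Phi> n s \<partial>LM)" for s
  have \<Phi>m: "case_prod \<Phi> \<in> borel_measurable (LM \<Otimes>\<^sub>M A)"
    using borel_measurable_inner[OF qm1 delay_integrand_measurable[OF xm]] by (simp add: \<Phi>_def split_beta')
  have \<Phi>: "integrable (LM \<Otimes>\<^sub>M A) (case_prod \<Phi>)"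
  proof (rule NA.Fubini_integrable[OF \<Phi>m])
    show "AE n in LM. integrable A (\<lambda>s. case_prod \<Phi> (n, s))"
      using xi(1) by eventually_elim (simp add: \<Phi>_def)
    show "integrable LM (\<lambda>n. \<integral>s. norm (case_prod \<Phi> (n, s)) \<partial>A)"
    proof (rule Bochner_Integration.integrable_bound[OF integrable_norm_times_norm[OF q xi(2)]])
      show "(\<lambda>n. \<integral>s. norm (case_prod \<Phi> (n, s)) \<partial>A) \<in> borel_measurable LM"
        by (rule A.borel_measurable_lebesgue_integral) (use \<Phi>m in \<open>simp add: split_beta'\<close>)
      show "AE n in LM. norm (\<integral>s. norm (case_prod \<Phi> (n, s)) \<partial>A) \<le>
          norm (norm (case_prod q n) * norm (\<integral>s. norm (delay_integrand x n s) \<partial>A))"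
        using xi(1)
      proof eventually_elim
        case (elim n)
        have "(\<integral>s. norm (case_prod \<Phi> (n, s)) \<partial>A) \<le> (\<integral>s. norm (case_prod q n) * norm (delay_integrand x n s) \<partial>A)"
          by (rule integral_mono) (use elim Cauchy_Schwarz_ineq2 in \<open>auto simp: \<Phi>_def\<close>)
        also have "\<dots> = norm (case_prod q n) * (\<integral>s. norm (delay_integrand x n s) \<partial>A)" by simp
        finally show ?case by (simp add: abs_mult)
      qed
    qed
  qed
  have \<psi>i: "integrable A \<psi>" using NA.integrable_snd[OF \<Phi>] by (simp add: \<psi>_def[abs_def])
  have RN: "(\<integral>s. indicator {0..T} s * \<psi> s \<partial>\<alpha>) =
      (\<integral>s. enn2real (RN_deriv lborel \<alpha> s) * (indicator {0..T} s * \<psi> s) \<partial>lborel)"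
    and ii: "integrable lborel (\<lambda>s. enn2real (RN_deriv lborel \<alpha> s) * (indicator {0..T} s * \<psi> s))"
  proof -
    have "integrable \<alpha> (\<lambda>s. indicator {-\<delta>..T} s *\<^sub>R \<psi> s)"
      using \<psi>i by (subst (asm) integrable_restrict_space) (simp_all add: sets_\<alpha>)
    then have "integrable \<alpha> (\<lambda>s. indicator {0..T} s *\<^sub>R (indicator {-\<delta>..T} s *\<^sub>R \<psi> s))"
      by (rule integrable_mult_indicator[rotated]) (simp add: sets_\<alpha>)
    also have "(\<lambda>s. indicator {0..T} s *\<^sub>R (indicator {-\<delta>..T} s *\<^sub>R \<psi> s)) = (\<lambda>s. indicator {0..T} s * \<psi> s)"
      using delay_nonneg by (auto simp: indicator_def fun_eq_iff)
    finally have i: "integrable \<alpha> (\<lambda>s. indicator {0..T} s * \<psi> s)" .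
    then have "(\<lambda>s. indicator {0..T} s * \<psi> s) \<in> borel_measurable \<alpha>" by auto
    then have m: "(\<lambda>s. indicator {0..T} s * \<psi> s) \<in> borel_measurable lborel"
      by (simp add: measurable_cong_sets[OF sets_\<alpha> refl])
    show "(\<integral>s. indicator {0..T} s * \<psi> s \<partial>\<alpha>) =
        (\<integral>s. enn2real (RN_deriv lborel \<alpha> s) * (indicator {0..T} s * \<psi> s) \<partial>lborel)"
      by (rule sigma_finite_measure.RN_deriv_integral[OF sigma_finite_lborel sigma_finite_\<alpha> ac_\<alpha> _ m])
          (simp add: sets_\<alpha>)
    show "integrable lborel (\<lambda>s. enn2real (RN_deriv lborel \<alpha> s) * (indicator {0..T} s * \<psi> s))"
      using sigma_finite_measure.RN_deriv_integrable[OF sigma_finite_lborel sigma_finite_\<alpha> ac_\<alpha> _ m] i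
      by (simp add: sets_\<alpha>)
  qed
  have "(\<integral>(t, \<omega>). q t \<omega> \<bullet> delay_integral x t \<omega> \<partial>LM) = (\<integral>n. \<integral>s. \<Phi> n s \<partial>A \<partial>LM)"
  proof (rule integral_cong_AE)
    show "(\<lambda>(t, \<omega>). q t \<omega> \<bullet> delay_integral x t \<omega>) \<in> borel_measurable LM"
      using inner_process_integrable[OF q xi(3)] by auto
    show "(\<lambda>n. \<integral>s. \<Phi> n s \<partial>A) \<in> borel_measurable LM" using NA.integrable_fst[OF \<Phi>] by auto
    show "AE n in LM. (case n of (t, \<omega>) \<Rightarrow> q t \<omega> \<bullet> delay_integral x t \<omega>) = (\<integral>s. \<Phi> n s \<partial>A)"
      using xi(1) by eventually_elim (auto simp: \<Phi>_def delay_integral_def split_beta')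
  qed
  also have "\<dots> = (\<integral>s. \<psi> s \<partial>A)" unfolding \<psi>_def by (rule NA.Fubini_integral[symmetric, OF \<Phi>])
  also have "\<dots> = (\<integral>s. indicator {0..T} s *\<^sub>R \<psi> s \<partial>A)"
  proof (intro Bochner_Integration.integral_cong refl)
    fix s assume "s \<in> space A"
    then have s: "s \<in> {-\<delta>..T}" by simp
    show "\<psi> s = indicator {0..T} s *\<^sub>R \<psi> s"
    proof (cases "0 \<le> s")
      case True then show ?thesis using s by simp
    next
      case False
      then have "AE n in LM. x s (snd n) = 0" using past[of s] s by (intro AE_lift) auto
      then have "AE n in LM. \<Phi> n s = 0"
        by eventually_elim (simp add: \<Phi>_def delay_integrand_def)
      then have "\<psi> s = 0" unfolding \<psi>_def by (rule integral_eq_zero_AE)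
      then show ?thesis by simp
    qed
  qed
  also have "\<dots> = (\<integral>s. indicator {-\<delta>..T} s *\<^sub>R (indicator {0..T} s *\<^sub>R \<psi> s) \<partial>\<alpha>)"
    by (rule integral_restrict_space) (simp add: sets_\<alpha>)
  also have "\<dots> = (\<integral>s. indicator {0..T} s * \<psi> s \<partial>\<alpha>)"
    using delay_nonneg by (intro Bochner_Integration.integral_cong refl) (auto simp: indicator_def)
  also note RN
  finally have eq: "(\<integral>(t, \<omega>). q t \<omega> \<bullet> delay_integral x t \<omega> \<partial>LM) =
      (\<integral>s. enn2real (RN_deriv lborel \<alpha> s) * (indicator {0..T} s * \<psi> s) \<partial>lborel)" .
  define \<kappa> where "\<kappa> s = enn2real (RN_deriv lborel \<alpha> s) * \<psi> s" for s
  have re: "enn2real (RN_deriv lborel \<alpha> s) * (indicator {0..T} s * \<psi> s) = indicator {0..T} s *\<^sub>R \<kappa> s" for s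
    by (simp add: \<kappa>_def)
  have k1: "integrable L \<kappa>"
    using ii unfolding re by (subst integrable_restrict_space) simp_all
  have k2: "(\<integral>s. \<kappa> s \<partial>L) = (\<integral>(t, \<omega>). q t \<omega> \<bullet> delay_integral x t \<omega> \<partial>LM)"
    unfolding eq re by (rule integral_restrict_space) simp
  have k3: "AE s in L. integrable M (\<lambda>\<omega>. advance q s \<omega> \<bullet> x s \<omega>) \<and> expectation (\<lambda>\<omega>. advance q s \<omega> \<bullet> x s \<omega>) = \<kappa> s"
    using AE_sq_integrable_slice[OF x(2)] AE_space
  proof eventually_elim
    case (elim s)
    then have s: "s \<in> {0..T}" "s \<in> {-\<delta>..T}" using delay_nonneg by auto
    define f where "f t \<omega> = of_bool (t - \<delta> \<le> s \<and> s \<le> t) *\<^sub>R (K t s \<omega> *\<^sub>R q t \<omega>)" for t \<omega>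
    have wm: "(\<lambda>n. of_bool (fst n - \<delta> \<le> s \<and> s \<le> fst n) * K (fst n) s (snd n)) \<in> borel_measurable LM"
      using measurable_Pair1[OF kernel_window_measurable, of s] s by simp
    have f: "sq_process f"
    proof -
      have "AE n in LM. \<bar>of_bool (fst n - \<delta> \<le> s \<and> s \<le> fst n) * K (fst n) s (snd n)\<bar> \<le> \<bar>C\<bar>"
        using K_bounded[OF _ s(2)] by (intro AE_I2) (force simp: space_pair_measure abs_mult)
      from sq_integrable_scaleR_bounded[OF q wm this] show ?thesis
        by (simp add: f_def split_beta')
    qed
    have X: "sq_integrable M (advance_integral q s)"
      using sq_integrable_integral_time(2)[OF f] by (simp add: f_def advance_integral_def[abs_def])
    note v = vec_cond_exp_inner[OF subalgebra_filtration X elim(1) x(3)[OF s(1)]]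
    have "expectation (\<lambda>\<omega>. advance_integral q s \<omega> \<bullet> x s \<omega>) = (\<integral>(t, \<omega>). x s \<omega> \<bullet> f t \<omega> \<partial>LM)"
      unfolding inner_process_lift[OF elim(1) f] by (simp add: f_def advance_integral_def inner_commute)
    also have "\<dots> = \<psi> s"
      unfolding \<psi>_def
      by (intro Bochner_Integration.integral_cong refl) (auto simp: \<Phi>_def f_def delay_integrand_def inner_commute)
    finally show ?case using v by (simp add: advance_def \<kappa>_def)
  qed
  from k1 k2 k3 show ?thesis by blast
qed

text \<open>Shared by the drift and the diffusion coefficient of the adjoint equation, where \<open>h\<close> and \<open>q\<close> are the
  gradients in a present and in the corresponding delayed variable.\<close>

lemma adjoint_coefficient_pairing:
  fixes q x b h :: "real \<Rightarrow> 'w \<Rightarrow> 'h::euclidean_space"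
  assumes b: "sq_process b" and h: "sq_process h"
    and q: "sq_process q"
    and x: "delayable x" "sq_process x" "\<And>s. s \<in> {0..T} \<Longrightarrow> x s \<in> borel_measurable (F s)"
    and past: "\<And>s. s \<in> {-\<delta>..<0} \<Longrightarrow> AE \<omega> in M. x s \<omega> = 0"
    and eq: "AE t in L. AE \<omega> in M. b t \<omega> = - h t \<omega> - advance q t \<omega>"
  shows "(\<integral>(t, \<omega>). b t \<omega> \<bullet> x t \<omega> \<partial>LM) =
    - (\<integral>(t, \<omega>). h t \<omega> \<bullet> x t \<omega> \<partial>LM) - (\<integral>(t, \<omega>). q t \<omega> \<bullet> delay_integral x t \<omega> \<partial>LM)"
proof -
  obtain \<kappa> where \<kappa>: "integrable L \<kappa>"
    "(\<integral>s. \<kappa> s \<partial>L) = (\<integral>(t, \<omega>). q t \<omega> \<bullet> delay_integral x t \<omega> \<partial>LM)"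
    "AE s in L. integrable M (\<lambda>\<omega>. advance q s \<omega> \<bullet> x s \<omega>) \<and> expectation (\<lambda>\<omega>. advance q s \<omega> \<bullet> x s \<omega>) = \<kappa> s"
    using advance_delay_duality[OF q x past] by blast
  note ib = inner_process_integrable[OF b x(2)] and ih = inner_process_integrable[OF h x(2)]
  have "(\<integral>(t, \<omega>). b t \<omega> \<bullet> x t \<omega> \<partial>LM) = (\<integral>t. expectation (\<lambda>\<omega>. b t \<omega> \<bullet> x t \<omega>) \<partial>L)"
    by (rule LM.integral_fst[symmetric, OF ib])
  also have "\<dots> = (\<integral>t. - expectation (\<lambda>\<omega>. h t \<omega> \<bullet> x t \<omega>) - \<kappa> t \<partial>L)"
  proof (rule integral_cong_AE)
    show "(\<lambda>t. expectation (\<lambda>\<omega>. b t \<omega> \<bullet> x t \<omega>)) \<in> borel_measurable L" using LM.integrable_fst[OF ib] by auto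
    show "(\<lambda>t. - expectation (\<lambda>\<omega>. h t \<omega> \<bullet> x t \<omega>) - \<kappa> t) \<in> borel_measurable L"
      using LM.integrable_fst[OF ih] \<kappa>(1) by auto
    show "AE t in L. expectation (\<lambda>\<omega>. b t \<omega> \<bullet> x t \<omega>) = - expectation (\<lambda>\<omega>. h t \<omega> \<bullet> x t \<omega>) - \<kappa> t"
      using eq \<kappa>(3) AE_sq_integrable_slice[OF b] AE_sq_integrable_slice[OF h] AE_sq_integrable_slice[OF x(2)]
    proof eventually_elim
      case (elim t)
      note i = integrable_inner[OF elim(3,5)] integrable_inner[OF elim(4,5)]
      have "expectation (\<lambda>\<omega>. b t \<omega> \<bullet> x t \<omega>) = expectation (\<lambda>\<omega>. - (h t \<omega> \<bullet> x t \<omega>) - advance q t \<omega> \<bullet> x t \<omega>)"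
      proof (rule integral_cong_AE)
        show "(\<lambda>\<omega>. b t \<omega> \<bullet> x t \<omega>) \<in> borel_measurable M" using i by auto
        show "(\<lambda>\<omega>. - (h t \<omega> \<bullet> x t \<omega>) - advance q t \<omega> \<bullet> x t \<omega>) \<in> borel_measurable M"
          using i elim(2) by auto
        show "AE \<omega> in M. b t \<omega> \<bullet> x t \<omega> = - (h t \<omega> \<bullet> x t \<omega>) - advance q t \<omega> \<bullet> x t \<omega>"
          using elim(1) by eventually_elim (simp add: inner_diff_left)
      qed
      then show ?case using i elim(2) by simp
    qed
  qed
  also have "\<dots> = - (\<integral>(t, \<omega>). h t \<omega> \<bullet> x t \<omega> \<partial>LM) - (\<integral>s. \<kappa> s \<partial>L)"
    using LM.integrable_fst[OF ih] \<kappa>(1) LM.integral_fst[OF ih] by simp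
  finally show ?thesis using \<kappa>(2) by simp
qed

end

section \<open>Gradients and concave envelopes\<close>

lemma gderiv_unique:
  assumes "GDERIV f x :> D" "GDERIV f x :> E"
  shows "D = E"
proof -
  have "(\<lambda>h. inner h D) = (\<lambda>h. inner h E)"
    using assms unfolding gderiv_def by (rule has_derivative_unique)
  then show ?thesis by (metis vector_eq_ldot)
qed

lemma gderiv_imp_grad: "GDERIV f x :> D \<Longrightarrow> grad f x = D"
  unfolding grad_def by (rule the_equality) (auto intro: gderiv_unique)

lemma has_derivative_imp_gderiv:
  fixes f :: "'a::euclidean_space \<Rightarrow> real"
  assumes "(f has_derivative f') (at x)"
  shows "GDERIV f x :> (\<Sum>b\<in>Basis. f' b *\<^sub>R b)"
proof -
  have "linear f'" using assms has_derivative_linear by blast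
  then have "f' h = inner h (\<Sum>b\<in>Basis. f' b *\<^sub>R b)" for h
    by (subst euclidean_representation[of h, symmetric])
      (simp add: linear_sum linear_scale inner_sum_left inner_sum_right inner_Basis if_distrib mult.commute
      cong: if_cong)
  then have "f' = (\<lambda>h. inner h (\<Sum>b\<in>Basis. f' b *\<^sub>R b))" by (rule ext)
  then show ?thesis using assms unfolding gderiv_def by metis
qed

lemma gderiv_directional:
  assumes "GDERIV f x :> D"
  shows "((\<lambda>r. f (x + r *\<^sub>R d)) has_real_derivative D \<bullet> d) (at 0)"
proof -
  have "(f has_derivative (\<lambda>h. inner h D)) (at (x + 0 *\<^sub>R d))" using assms by (simp add: gderiv_def)
  moreover have "((\<lambda>r. x + r *\<^sub>R d) has_derivative (\<lambda>r. r *\<^sub>R d)) (at 0)"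
    by (auto intro!: derivative_eq_intros)
  ultimately have "((\<lambda>r. f (x + r *\<^sub>R d)) has_derivative (\<lambda>r. inner (r *\<^sub>R d) D)) (at 0)"
    by (rule has_derivative_compose[rotated])
  then show ?thesis
    by (simp add: has_field_derivative_def inner_commute mult_commute_abs)
qed

text \<open>Only the minorant \<open>\<phi>\<close> is differentiable.  Extending the segment from \<open>y\<close> to \<open>x\<close>
  slightly beyond \<open>x\<close>, to \<open>w = x + r (y - x)\<close> with \<open>r < 0\<close>, makes \<open>x\<close> a convex combination of \<open>w\<close> and \<open>y\<close>.
  Concavity then bounds \<open>h(y) - h(x)\<close> by a difference quotient of \<open>h\<close> with \<open>h(w)\<close> on the side where
  replacing it by the smaller \<open>\<phi>(w)\<close> weakens the bound.\<close>

lemma concave_envelope_gradient: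
  fixes h \<phi> :: "'a::real_inner \<Rightarrow> real"
  assumes h: "concave_on UNIV h" and below: "\<And>w. \<phi> w \<le> h w" and touch: "\<phi> x = h x"
    and D: "GDERIV \<phi> x :> D"
  shows "h y - h x \<le> D \<bullet> (y - x)"
proof -
  define d where "d = y - x"
  have secant: "h y - h x \<le> (\<phi> (x + r *\<^sub>R d) - \<phi> x) / r" if r: "r < 0" for r :: real
  proof -
    define w where "w = x + r *\<^sub>R d"
    define a where "a = - r / (1 - r)"
    have a: "0 \<le> a" "a \<le> 1" "1 - a = 1 / (1 - r)" using r by (auto simp: a_def field_simps)
    have "(1 - r) *\<^sub>R ((1 - a) *\<^sub>R w + a *\<^sub>R y) = w + (- r) *\<^sub>R y"
      using r unfolding a(3) by (simp add: a_def scaleR_add_right scaleR_diff_right)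
    also have "\<dots> = (1 - r) *\<^sub>R x" by (simp add: w_def d_def algebra_simps)
    finally have x: "(1 - a) *\<^sub>R w + a *\<^sub>R y = x" using r by simp
    have "(1 - a) * h w + a * h y \<le> h x"
      using concave_onD[OF h, of a w y] a x by simp
    then have "(1 - r) * ((1 - a) * h w + a * h y) \<le> (1 - r) * h x"
      using r by (intro mult_left_mono) auto
    also have "(1 - r) * ((1 - a) * h w + a * h y) = h w + (- r) * h y"
      using r unfolding a(3) by (simp add: a_def distrib_left right_diff_distrib)
    finally have "(- r) * (h y - h x) \<le> h x - h w" by (simp add: algebra_simps)
    also have "\<dots> \<le> \<phi> x - \<phi> w" using below[of w] touch by simp
    finally show ?thesis using r by (simp add: w_def field_simps)
  qed
  have "((\<lambda>r. (\<phi> (x + r *\<^sub>R d) - \<phi> x) / r) \<longlongrightarrow> D \<bullet> d) (at_left 0)"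
    using gderiv_directional[OF D, of d] unfolding has_field_derivative_iff
    by (auto intro: filterlim_mono at_le)
  then show ?thesis
    unfolding d_def[symmetric]
    by (rule tendsto_lowerbound) (auto simp: eventually_at_filter intro!: always_eventually secant)
qed

lemma gderiv_bound:
  fixes f :: "'a::real_inner \<Rightarrow> real"
  assumes "\<And>x. \<exists>D. GDERIV f x :> D \<and> norm D \<le> C"
  shows "\<bar>f x - f y\<bar> \<le> C * norm (x - y)"
proof -
  obtain D where D: "\<And>x. GDERIV f x :> D x" "\<And>x. norm (D x) \<le> C" using assms by metis
  have "norm (f x - f y) \<le> C * norm (x - y)"
  proof (rule differentiable_bound[of UNIV f "\<lambda>x h. inner h (D x)"])
    show "onorm (\<lambda>h. inner h (D x)) \<le> C" for x
    proof (rule onorm_bound)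
      show "0 \<le> C" using D(2)[of x] norm_ge_zero[of "D x"] by linarith
      show "norm (inner h (D x)) \<le> C * norm h" for h
        using Cauchy_Schwarz_ineq2[of h "D x"] mult_right_mono[OF D(2)[of x] norm_ge_zero[of h]]
        by (simp add: mult.commute)
    qed
  qed (use D(1) in \<open>auto simp: gderiv_def\<close>)
  then show ?thesis by simp
qed

lemma gderiv_compose:
  assumes "(e has_derivative k) (at u)" "GDERIV g (e u) :> D" "\<And>h. k h \<bullet> D = h \<bullet> E"
  shows "GDERIV (\<lambda>x. g (e x)) u :> E"
  using has_derivative_compose[OF assms(1), of g "\<lambda>h. inner h D"] assms(2,3)
  by (simp add: gderiv_def)

lemma gderiv_product_components:
  fixes g :: "'a::real_inner \<times> 'b::real_inner \<times> 'c::real_inner \<times> 'd::real_inner \<Rightarrow> real"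
  assumes "GDERIV g (a, b, c, d) :> (Da, Db, Dc, Dd)"
  shows "GDERIV (\<lambda>x. g (x, b, c, d)) a :> Da" "GDERIV (\<lambda>x. g (a, x, c, d)) b :> Db"
    "GDERIV (\<lambda>x. g (a, b, x, d)) c :> Dc" "GDERIV (\<lambda>x. g (a, b, c, x)) d :> Dd"
proof -
  show "GDERIV (\<lambda>x. g (x, b, c, d)) a :> Da"
    by (rule gderiv_compose[where D = "(Da, Db, Dc, Dd)" and k = "\<lambda>h. (h, 0, 0, 0)"])
        (auto intro!: derivative_eq_intros simp: zero_prod_def assms)
  show "GDERIV (\<lambda>x. g (a, x, c, d)) b :> Db"
    by (rule gderiv_compose[where D = "(Da, Db, Dc, Dd)" and k = "\<lambda>h. (0, h, 0, 0)"])
        (auto intro!: derivative_eq_intros simp: zero_prod_def assms)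
  show "GDERIV (\<lambda>x. g (a, b, x, d)) c :> Dc"
    by (rule gderiv_compose[where D = "(Da, Db, Dc, Dd)" and k = "\<lambda>h. (0, 0, h, 0)"])
        (auto intro!: derivative_eq_intros simp: zero_prod_def assms)
  show "GDERIV (\<lambda>x. g (a, b, c, x)) d :> Dd"
    by (rule gderiv_compose[where D = "(Da, Db, Dc, Dd)" and k = "\<lambda>h. (0, 0, 0, h)"])
        (auto intro!: derivative_eq_intros simp: zero_prod_def assms)
qed

lemma norm_le_of_inner_bound:
  fixes D :: "'a::real_inner"
  assumes "\<And>h. \<bar>h \<bullet> D\<bar> \<le> C * norm h" "0 \<le> C" shows "norm D \<le> C"
proof (cases "D = 0")
  case False
  have "norm D * norm D \<le> C * norm D" using assms(1)[of D] by (simp add: dot_square_norm power2_eq_square)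
  then show ?thesis using False by simp
qed (use assms(2) in simp)

section \<open>The controlled system\<close>

lemma Lp_adapted_subinterval:
  assumes "h \<in> Lp_adapted M F p a b" "a \<le> a'"
  shows "h \<in> Lp_adapted M F p a' b"
proof -
  have "(\<lambda>t. t) \<in> restrict_space borel {a'..b} \<rightarrow>\<^sub>M restrict_space borel {a..b}"
    by (rule measurable_restrict_space3) (use assms in auto)
  then have "(\<lambda>x. (fst x, snd x)) \<in> restrict_space borel {a'..b} \<Otimes>\<^sub>M M \<rightarrow>\<^sub>M restrict_space borel {a..b} \<Otimes>\<^sub>M M"
    by (intro measurable_Pair measurable_snd measurable_compose[OF measurable_fst])
  then have id: "(\<lambda>x. x) \<in> restrict_space borel {a'..b} \<Otimes>\<^sub>M M \<rightarrow>\<^sub>M restrict_space borel {a..b} \<Otimes>\<^sub>M M"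
    by simp
  have "(\<lambda>(t, \<omega>). h t \<omega>) \<in> borel_measurable (restrict_space borel {a..b} \<Otimes>\<^sub>M M)"
    using assms by (simp add: Lp_adapted_def)
  from measurable_compose[OF id this]
  have "(\<lambda>(t, \<omega>). h t \<omega>) \<in> borel_measurable (restrict_space borel {a'..b} \<Otimes>\<^sub>M M)" .
  moreover have "(\<integral>\<^sup>+ \<omega>. (\<integral>\<^sup>+ t\<in>{a'..b}. ennreal (norm (h t \<omega>) ^ p) \<partial>lborel) \<partial>M) \<le>
      (\<integral>\<^sup>+ \<omega>. (\<integral>\<^sup>+ t\<in>{a..b}. ennreal (norm (h t \<omega>) ^ p) \<partial>lborel) \<partial>M)"
    using assms(2) by (intro nn_integral_mono) (auto simp: indicator_def)
  ultimately show ?thesis using assms by (auto simp: Lp_adapted_def intro: le_less_trans)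
qed

text \<open>A bound chosen once and for all, so that it can be a parameter of the delay kernel.\<close>

definition kernel_bound :: "('w, 'n::finite, 'd::finite, 'k::finite) control_system \<Rightarrow> real" where
  "kernel_bound S = (SOME C. \<forall>t\<in>{0..Horizon S}. \<forall>s\<in>{- Delay S..Horizon S}. \<forall>\<omega>\<in>space (Prob S).
      \<bar>Kernel S t s \<omega>\<bar> \<le> C)"

locale control_setting =
  fixes S :: "('w, 'n::finite, 'd::finite, 'k::finite) control_system"
  assumes problem: "control_problem S"
    and diff_generator: "assumption_A S"
    and diff_payoff: "assumption_B' S"

sublocale control_setting \<subseteq> delay_kernel "Prob S" "BM S" "Horizon S" "Delay S" "Delay_measure S" "Kernel S"
    "kernel_bound S"
proof -
  have "prob_space (Prob S)" using problem by (simp add: control_problem_def complete_prob_space_def)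
  then interpret prob_space "Prob S" .
  have ex: "\<exists>C. \<forall>t\<in>{0..Horizon S}. \<forall>s\<in>{- Delay S..Horizon S}. \<forall>\<omega>\<in>space (Prob S). \<bar>Kernel S t s \<omega>\<bar> \<le> C"
    using problem unfolding control_problem_def by blast
  have kb: "\<forall>t\<in>{0..Horizon S}. \<forall>s\<in>{- Delay S..Horizon S}. \<forall>\<omega>\<in>space (Prob S). \<bar>Kernel S t s \<omega>\<bar> \<le> kernel_bound S"
    unfolding kernel_bound_def by (rule someI_ex[OF ex])
  have ka: "\<forall>t\<in>{0..Horizon S}. \<forall>s\<in>{- Delay S..Horizon S}. Kernel S t s \<in> borel_measurable (Filt S s)"
    using problem unfolding control_problem_def by blast
  have sa: "sets (Delay_measure S) = sets borel" using problem by (simp add: control_problem_def)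
  have "(\<lambda>(t, s, \<omega>). Kernel S t s \<omega>) \<in> borel_measurable
      (restrict_space borel {0..Horizon S} \<Otimes>\<^sub>M restrict_space borel {- Delay S..Horizon S} \<Otimes>\<^sub>M Prob S)"
    using problem by (simp add: control_problem_def)
  also have "borel_measurable
      (restrict_space borel {0..Horizon S} \<Otimes>\<^sub>M restrict_space borel {- Delay S..Horizon S} \<Otimes>\<^sub>M Prob S)
     = borel_measurable (interval_measure 0 (Horizon S) \<Otimes>\<^sub>M restrict_space (Delay_measure S)
     {- Delay S..Horizon S} \<Otimes>\<^sub>M Prob S)"
    by (intro measurable_cong_sets sets_pair_measure_cong sets_interval_measure[symmetric]
        sets_restrict_space_cong sa[symmetric] refl)
  finally have km: "(\<lambda>(t, s, \<omega>). Kernel S t s \<omega>) \<in> borel_measurable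
     (interval_measure 0 (Horizon S) \<Otimes>\<^sub>M restrict_space (Delay_measure S) {- Delay S..Horizon S} \<Otimes>\<^sub>M Prob S)" .
  show "delay_kernel (Prob S) (BM S) (Horizon S) (Delay S) (Delay_measure S) (Kernel S) (kernel_bound S)"
  proof (intro delay_kernel.intro delay_kernel_axioms.intro brownian_interval.intro brownian_interval_axioms.intro
      brownian.intro brownian_axioms.intro \<open>prob_space (Prob S)\<close>)
    show "brownian_motion (Prob S) (BM S)" "0 \<le> Horizon S" "0 \<le> Delay S"
      "sigma_finite_measure (Delay_measure S)" "absolutely_continuous lborel (Delay_measure S)"
      using problem unfolding control_problem_def by simp_all
    show "sets (Delay_measure S) = sets borel" by (rule sa)
    show "(\<lambda>(t, s, \<omega>). Kernel S t s \<omega>) \<in> borel_measurable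
      (interval_measure 0 (Horizon S) \<Otimes>\<^sub>M restrict_space (Delay_measure S) {- Delay S..Horizon S} \<Otimes>\<^sub>M Prob S)"
      by (rule km)
    show "Kernel S t s \<in> borel_measurable (Filt S s)" if "t \<in> {0..Horizon S}" "s \<in> {- Delay S..Horizon S}" for t s
      using ka that by blast
    show "\<bar>Kernel S t s \<omega>\<bar> \<le> kernel_bound S"
      if "t \<in> {0..Horizon S}" "s \<in> {- Delay S..Horizon S}" "\<omega> \<in> space (Prob S)" for t s \<omega>
      using kb that by blast
  qed
qed

context control_setting
begin

abbreviation "M \<equiv> Prob S"
abbreviation "T \<equiv> Horizon S"
abbreviation "\<delta> \<equiv> Delay S"

lemma delayed_eq:
  assumes "t \<in> {0..T}" shows "delayed S x t \<omega> = delay_integral x t \<omega>"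
proof -
  have "delay_integral x t \<omega> = (\<integral>s. indicator {-\<delta>..T} s *\<^sub>R delay_integrand x (t, \<omega>) s \<partial>Delay_measure S)"
    unfolding delay_integral_def by (rule integral_restrict_space) (simp add: sets_\<alpha>)
  also have "\<dots> = delayed S x t \<omega>"
    unfolding delayed_def set_lebesgue_integral_def
    by (intro Bochner_Integration.integral_cong refl) (use assms in \<open>auto simp: delay_integrand_def indicator_def\<close>)
  finally show ?thesis by simp
qed

lemma advanced_eq: "advanced S q t \<omega> = advance q t \<omega>"
proof -
  have "(LINT s:{t..t + \<delta>}|lborel. (indicator {0..T} s * Kernel S s t \<omega>) *\<^sub>R q s \<omega>) = advance_integral q t \<omega>" for \<omega>
  proof -
    have "advance_integral q t \<omega> =
        (\<integral>s. indicator {0..T} s *\<^sub>R (of_bool (s - \<delta> \<le> t \<and> t \<le> s) *\<^sub>R (Kernel S s t \<omega> *\<^sub>R q s \<omega>)) \<partial>lborel)"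
      unfolding advance_integral_def by (rule integral_restrict_space) simp
    also have "\<dots> = (LINT s:{t..t + \<delta>}|lborel. (indicator {0..T} s * Kernel S s t \<omega>) *\<^sub>R q s \<omega>)"
      unfolding set_lebesgue_integral_def
      by (intro Bochner_Integration.integral_cong refl) (auto simp: indicator_def)
    finally show ?thesis by simp
  qed
  then show ?thesis by (simp add: advanced_def advance_def)
qed

lemma Lp_delay_measurable:
  assumes "x \<in> Lp S p (- \<delta>) T" shows "case_prod x \<in> borel_measurable (A \<Otimes>\<^sub>M M)"
proof -
  have "case_prod x \<in> borel_measurable (restrict_space borel {-\<delta>..T} \<Otimes>\<^sub>M M)"
    using assms by (simp add: Lp_adapted_def)
  also have "borel_measurable (restrict_space borel {-\<delta>..T} \<Otimes>\<^sub>M M) = borel_measurable (A \<Otimes>\<^sub>M M)"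
    by (intro measurable_cong_sets sets_pair_measure_cong sets_restrict_space_cong sets_\<alpha>[symmetric] refl)
  finally show ?thesis .
qed

lemma delayableI:
  assumes x: "x \<in> Lp S 2 (- \<delta>) T" "delay_square_integrable S x"
  shows "delayable x"
proof -
  note m = Lp_delay_measurable[OF x(1)]
  have nm: "(\<lambda>n. \<integral>\<^sup>+s. ennreal (norm (delay_integrand x n s)) \<partial>A) \<in> borel_measurable LM"
    by (rule A.borel_measurable_nn_integral)
      (use delay_integrand_measurable[OF m] in \<open>simp add: split_beta'\<close>)
  have inner: "(\<integral>\<^sup>+s. ennreal (norm (delay_integrand x (t, \<omega>) s)) \<partial>A) =
      (\<integral>\<^sup>+ s\<in>{t - \<delta>..t}. ennreal (norm (Kernel S t s \<omega> *\<^sub>R x s \<omega>)) \<partial>Delay_measure S)"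
    if "t \<in> {0..T}" for t \<omega>
    by (subst nn_integral_restrict_space)
      (use that in \<open>auto simp: sets_\<alpha> delay_integrand_def indicator_def intro!: nn_integral_cong\<close>)
  have "(\<integral>\<^sup>+n. (\<integral>\<^sup>+s. ennreal (norm (delay_integrand x n s)) \<partial>A)\<^sup>2 \<partial>LM) =
    (\<integral>\<^sup>+\<omega>. (\<integral>\<^sup>+t\<in>{0..T}. (\<integral>\<^sup>+s. ennreal (norm (delay_integrand x (t, \<omega>) s)) \<partial>A)\<^sup>2 \<partial>lborel) \<partial>M)"
    by (rule nn_integral_interval_product[OF prob_space_axioms]) (use nm in measurable)
  also have "\<dots> = (\<integral>\<^sup>+\<omega>. (\<integral>\<^sup>+t\<in>{0..T}. (\<integral>\<^sup>+ s\<in>{t - \<delta>..t}. ennreal (norm (Kernel S t s \<omega> *\<^sub>R x s \<omega>))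
      \<partial>Delay_measure S)\<^sup>2 \<partial>lborel) \<partial>M)"
    by (intro nn_integral_cong) (use inner in \<open>auto simp: indicator_def\<close>)
  also have "\<dots> < \<infinity>" using x(2) by (simp add: delay_square_integrable_def)
  finally show ?thesis using m by (simp add: delayable_def)
qed

lemma lower_set_integral:
  "t \<in> {0..T} \<Longrightarrow> (LINT s:{0..t}|lborel. f s) = (\<integral>s. of_bool (s \<le> t) *\<^sub>R f s \<partial>L)"
  for f :: "real \<Rightarrow> 'b::{banach, second_countable_topology}"
  unfolding set_lebesgue_integral_def
  by (subst integral_restrict_space)
    (auto simp: indicator_def intro!: Bochner_Integration.integral_cong)

lemma upper_set_integral:
  "t \<in> {0..T} \<Longrightarrow> (LINT s:{t..T}|lborel. f s) = (\<integral>s. of_bool (t \<le> s) *\<^sub>R f s \<partial>L)"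
  for f :: "real \<Rightarrow> 'b::{banach, second_countable_topology}"
  unfolding set_lebesgue_integral_def
  by (subst integral_restrict_space)
    (auto simp: indicator_def intro!: Bochner_Integration.integral_cong)

lemma coefficient_measurable:
  assumes g: "measurable_adapted_coefficient S g"
    and \<theta>: "case_prod \<theta> \<in> borel_measurable LM" and w: "case_prod w \<in> borel_measurable LM"
  shows "(\<lambda>(t, \<omega>). g \<omega> t (\<theta> t \<omega>) (w t \<omega>)) \<in> borel_measurable LM"
proof -
  have g': "(\<lambda>(\<omega>, t, \<theta>, v). g \<omega> t \<theta> v)
      \<in> borel_measurable (M \<Otimes>\<^sub>M restrict_space borel {0..T} \<Otimes>\<^sub>M borel \<Otimes>\<^sub>M borel)"
    using g by (simp add: measurable_adapted_coefficient_def)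
  have id: "(\<lambda>t. t) \<in> L \<rightarrow>\<^sub>M restrict_space borel {0..T}"
    by (rule measurable_ident_sets) (rule sets_interval_measure)
  have "(\<lambda>n. (snd n, fst n, case_prod \<theta> n, case_prod w n)) \<in>
      LM \<rightarrow>\<^sub>M M \<Otimes>\<^sub>M restrict_space borel {0..T} \<Otimes>\<^sub>M borel \<Otimes>\<^sub>M borel"
    by (intro measurable_Pair measurable_snd measurable_compose[OF measurable_fst id] \<theta> w)
  from measurable_compose[OF this g'] show ?thesis by (simp add: split_beta')
qed

lemma coefficient_adapted:
  assumes g: "measurable_adapted_coefficient S g" and t: "t \<in> {0..T}"
    and \<theta>: "\<theta> \<in> borel_measurable (F t)" and w: "w \<in> borel_measurable (F t)"
  shows "(\<lambda>\<omega>. g \<omega> t (\<theta> \<omega>) (w \<omega>)) \<in> borel_measurable (F t)"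
proof -
  have g': "(\<lambda>(\<omega>, \<theta>, v). g \<omega> t \<theta> v) \<in> borel_measurable (F t \<Otimes>\<^sub>M borel \<Otimes>\<^sub>M borel)"
    using g t by (simp add: measurable_adapted_coefficient_def)
  have "(\<lambda>\<omega>. (\<omega>, \<theta> \<omega>, w \<omega>)) \<in> F t \<rightarrow>\<^sub>M F t \<Otimes>\<^sub>M borel \<Otimes>\<^sub>M borel"
    by (intro measurable_Pair \<theta> w) simp
  from measurable_compose[OF this g'] show ?thesis by simp
qed

lemma generator_derivative:
  "\<exists>C\<ge>0. \<forall>\<omega>\<in>space M. \<forall>t\<in>{0..T}. \<exists>Df.
    \<forall>x. ((\<lambda>(\<theta>, v). Generator S \<omega> t \<theta> v) has_derivative blinfun_apply (Df x)) (at x) \<and> norm (Df x) \<le> C"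
proof -
  obtain C where C: "\<forall>\<omega>\<in>space M. \<forall>t\<in>{0..T}. \<exists>Df :: ('n, 'd) state \<times> (real^'k) \<Rightarrow> (('n, 'd) state \<times> (real^'k)) \<Rightarrow>\<^sub>L
      (real^'n).
    continuous_on UNIV Df \<and>
    (\<forall>x. ((\<lambda>(\<theta>, v). Generator S \<omega> t \<theta> v) has_derivative blinfun_apply (Df x)) (at x) \<and> norm (Df x) \<le> C)"
    using diff_generator unfolding assumption_A_def by blast
  show ?thesis
  proof (intro exI[of _ "\<bar>C\<bar>"] conjI ballI)
    fix \<omega> t assume "\<omega> \<in> space M" "t \<in> {0..T}"
    then obtain Df :: "('n, 'd) state \<times> (real^'k) \<Rightarrow> (('n, 'd) state \<times> (real^'k)) \<Rightarrow>\<^sub>L (real^'n)" where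
      Df: "\<And>x. ((\<lambda>(\<theta>, v). Generator S \<omega> t \<theta> v) has_derivative blinfun_apply (Df x)) (at x)" "\<And>x. norm (Df x) \<le> C"
      using C by blast
    show "\<exists>Df. \<forall>x. ((\<lambda>(\<theta>, v). Generator S \<omega> t \<theta> v) has_derivative blinfun_apply (Df x)) (at x) \<and> norm (Df x) \<le> \<bar>C\<bar>"
      by (intro exI[of _ Df] allI conjI Df(1) order_trans[OF Df(2)]) simp
  qed simp
qed

lemma generator_growth:
  "\<exists>C\<ge>0. \<forall>\<omega>\<in>space M. \<forall>t\<in>{0..T}. \<forall>\<theta> v.
    norm (Generator S \<omega> t \<theta> v) \<le> norm (Generator S \<omega> t 0 0) + C * norm (\<theta>, v)"
proof -
  obtain C where C: "0 \<le> C" "\<forall>\<omega>\<in>space M. \<forall>t\<in>{0..T}. \<exists>Df.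
    \<forall>x. ((\<lambda>(\<theta>, v). Generator S \<omega> t \<theta> v) has_derivative blinfun_apply (Df x)) (at x) \<and> norm (Df x) \<le> C"
    using generator_derivative by blast
  show ?thesis
  proof (intro exI[of _ C] conjI ballI allI C(1))
    fix \<omega> t \<theta> v assume "\<omega> \<in> space M" "t \<in> {0..T}"
    then obtain Df where Df: "\<And>x. ((\<lambda>(\<theta>, v). Generator S \<omega> t \<theta> v) has_derivative blinfun_apply (Df x)) (at x)"
      "\<And>x. norm (Df x) \<le> C" using C(2) by blast
    have "norm ((\<lambda>(\<theta>, v). Generator S \<omega> t \<theta> v) (\<theta>, v) - (\<lambda>(\<theta>, v). Generator S \<omega> t \<theta> v) (0, 0)) \<le>
        C * norm ((\<theta>, v) - (0, 0))"
      by (rule differentiable_bound[of UNIV _ "\<lambda>x. blinfun_apply (Df x)"])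
        (use Df in \<open>auto simp: norm_blinfun.rep_eq\<close>)
    then have "norm (Generator S \<omega> t \<theta> v - Generator S \<omega> t 0 0) \<le> C * norm (\<theta>, v)" by simp
    then show "norm (Generator S \<omega> t \<theta> v) \<le> norm (Generator S \<omega> t 0 0) + C * norm (\<theta>, v)"
      using norm_triangle_ineq2[of "Generator S \<omega> t \<theta> v" "Generator S \<omega> t 0 0"] by linarith
  qed
qed

text \<open>The bound is affine in \<open>p\<close>, so along a trajectory the gradient is square integrable because \<open>p\<close> is.\<close>

lemma Ham_gradient:
  "\<exists>C1\<ge>0. \<exists>C2\<ge>0. \<forall>\<omega>\<in>space M. \<forall>t\<in>{0..T}. \<forall>\<theta> v p. \<exists>D.
    GDERIV (\<lambda>\<theta>. Ham S \<omega> t \<theta> v p) \<theta> :> D \<and> norm D \<le> C1 + C2 * norm p"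
proof -
  obtain C1 where C1: "\<forall>\<omega>\<in>space M. \<forall>t\<in>{0..T}. \<forall>\<theta> v. \<exists>D. GDERIV (\<lambda>\<theta>'. Running S \<omega> t \<theta>' v) \<theta> :> D \<and> norm D \<le> C1"
    using diff_payoff unfolding assumption_B'_def by blast
  obtain C2 where C2: "0 \<le> C2" "\<forall>\<omega>\<in>space M. \<forall>t\<in>{0..T}. \<exists>Df.
    \<forall>x. ((\<lambda>(\<theta>, v). Generator S \<omega> t \<theta> v) has_derivative blinfun_apply (Df x)) (at x) \<and> norm (Df x) \<le> C2"
    using generator_derivative by blast
  show ?thesis
  proof (rule exI[of _ "\<bar>C1\<bar>"], rule conjI, simp, rule exI[of _ C2], intro conjI ballI allI C2(1))
    fix \<omega> t \<theta> v and p :: "real^'n" assume w: "\<omega> \<in> space M" and t: "t \<in> {0..T}"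
    obtain D1 where D1: "GDERIV (\<lambda>\<theta>'. Running S \<omega> t \<theta>' v) \<theta> :> D1" "norm D1 \<le> C1" using C1 w t by blast
    obtain Df where Df: "\<And>x. ((\<lambda>(\<theta>, v). Generator S \<omega> t \<theta> v) has_derivative blinfun_apply (Df x)) (at x)"
      "\<And>x. norm (Df x) \<le> C2" using C2(2) w t by blast
    have "((\<lambda>\<theta>. (\<theta>, v)) has_derivative (\<lambda>h. (h, 0))) (at \<theta>)" by (auto intro!: derivative_eq_intros)
    from has_derivative_compose[OF this Df(1)]
    have "((\<lambda>\<theta>. Generator S \<omega> t \<theta> v) has_derivative (\<lambda>h. Df (\<theta>, v) (h, 0))) (at \<theta>)" by simp
    then have fp: "((\<lambda>\<theta>. Generator S \<omega> t \<theta> v \<bullet> p) has_derivative (\<lambda>h. Df (\<theta>, v) (h, 0) \<bullet> p)) (at \<theta>)"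
      by (rule has_derivative_inner_left)
    then obtain D2 where D2: "GDERIV (\<lambda>\<theta>. Generator S \<omega> t \<theta> v \<bullet> p) \<theta> :> D2"
      using has_derivative_imp_gderiv by blast
    then have D2eq: "(\<lambda>h. Df (\<theta>, v) (h, 0) \<bullet> p) = (\<lambda>h. h \<bullet> D2)"
      using fp unfolding gderiv_def by (metis has_derivative_unique)
    have "norm D2 \<le> C2 * norm p"
    proof (rule norm_le_of_inner_bound)
      fix h
      have "\<bar>h \<bullet> D2\<bar> = \<bar>Df (\<theta>, v) (h, 0) \<bullet> p\<bar>" using fun_cong[OF D2eq, of h] by simp
      also have "\<dots> \<le> norm (Df (\<theta>, v) (h, 0)) * norm p" by (rule Cauchy_Schwarz_ineq2)
      also have "\<dots> \<le> (norm (Df (\<theta>, v)) * norm (h, 0 :: real^'k)) * norm p"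
        by (intro mult_right_mono norm_blinfun) simp
      also have "\<dots> \<le> (C2 * norm h) * norm p"
        using Df(2)[of "(\<theta>, v)"] by (intro mult_right_mono) (auto simp: norm_Pair intro!: mult_right_mono)
      finally show "\<bar>h \<bullet> D2\<bar> \<le> C2 * norm p * norm h" by (simp add: mult_ac)
    qed (use C2 in simp)
    then have "norm (D1 - D2) \<le> \<bar>C1\<bar> + C2 * norm p"
      using norm_triangle_ineq4[of D1 D2] D1(2) by linarith
    moreover have "GDERIV (\<lambda>\<theta>. Ham S \<omega> t \<theta> v p) \<theta> :> D1 - D2"
      unfolding Ham_def by (rule GDERIV_diff[OF D1(1) D2])
    ultimately show "\<exists>D. GDERIV (\<lambda>\<theta>. Ham S \<omega> t \<theta> v p) \<theta> :> D \<and> norm D \<le> \<bar>C1\<bar> + C2 * norm p" by blast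
  qed
qed

lemma payoff_gradient:
  "\<exists>C\<ge>0. \<forall>y. \<exists>D. GDERIV (Initial_payoff S) y :> D \<and> norm D \<le> C"
proof -
  obtain C where C: "\<forall>y. \<exists>D. GDERIV (Initial_payoff S) y :> D \<and> norm D \<le> C"
    using diff_payoff unfolding assumption_B'_def by blast
  then show ?thesis by (intro exI[of _ "\<bar>C\<bar>"]) (auto intro: order_trans[OF _ abs_ge_self])
qed

lemma payoff_measurable: "Initial_payoff S \<in> borel_measurable borel"
proof (rule borel_measurable_continuous_onI)
  have "isCont (Initial_payoff S) y" for y
    using payoff_gradient unfolding gderiv_def by (metis has_derivative_continuous)
  then show "continuous_on UNIV (Initial_payoff S)" by (simp add: continuous_at_imp_continuous_on)
qed

lemma payoff_integrable:
  assumes "sq_integrable M X" shows "integrable M (\<lambda>\<omega>. Initial_payoff S (X \<omega>))"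
proof -
  obtain C where C: "0 \<le> C" "\<And>y. \<exists>D. GDERIV (Initial_payoff S) y :> D \<and> norm D \<le> C"
    using payoff_gradient by blast
  have Xm: "X \<in> borel_measurable M" using assms by (rule sq_integrable_measurable)
  show ?thesis
  proof (rule Bochner_Integration.integrable_bound)
    show "integrable M (\<lambda>\<omega>. \<bar>Initial_payoff S 0\<bar> + C * norm (X \<omega>))"
      using sq_integrable_imp_integrable[OF assms] by simp
    show "(\<lambda>\<omega>. Initial_payoff S (X \<omega>)) \<in> borel_measurable M"
      by (rule measurable_compose[OF Xm payoff_measurable])
    show "AE \<omega> in M. norm (Initial_payoff S (X \<omega>)) \<le> norm (\<bar>Initial_payoff S 0\<bar> + C * norm (X \<omega>))"
    proof (rule AE_I2)
      fix \<omega>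
      have "\<bar>Initial_payoff S (X \<omega>) - Initial_payoff S 0\<bar> \<le> C * norm (X \<omega> - 0)"
        by (rule gderiv_bound[OF C(2)])
      then show "norm (Initial_payoff S (X \<omega>)) \<le> norm (\<bar>Initial_payoff S 0\<bar> + C * norm (X \<omega>))" by simp
    qed
  qed
qed

end

locale state_trajectory = control_setting S
  for S :: "('w, 'n::finite, 'd::finite, 'k::finite) control_system" +
  fixes v :: "real \<Rightarrow> 'w \<Rightarrow> real^'k" and y :: "real \<Rightarrow> 'w \<Rightarrow> real^'n" and z :: "real \<Rightarrow> 'w \<Rightarrow> real^'d^'n"
  assumes admissible: "v \<in> admissible S"
    and solution: "state_solution S v y z"
begin

abbreviation "\<Theta> \<equiv> Theta S y z"

definition "generator_process t \<omega> = Generator S \<omega> t (\<Theta> t \<omega>) (v t \<omega>)"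

definition "running_process t \<omega> = Running S \<omega> t (\<Theta> t \<omega>) (v t \<omega>)"

lemma y_Lp: "y \<in> Lp S 2 (- \<delta>) T" and z_Lp: "z \<in> Lp S 2 (- \<delta>) T"
  using solution by (simp_all add: state_solution_def)

lemma y_delayable: "delayable y" and z_delayable: "delayable z"
  using delayableI[OF y_Lp] delayableI[OF z_Lp] solution by (simp_all add: state_solution_def)

lemma y_sq: "sq_process y"
  and z_sq: "sq_process z"
  using Lp_adapted_2_sq_integrable[OF prob_space_axioms Lp_adapted_subinterval[OF y_Lp]]
    Lp_adapted_2_sq_integrable[OF prob_space_axioms Lp_adapted_subinterval[OF z_Lp]] delay_nonneg by auto

lemma v_sq: "sq_process v"
  using admissible Lp_adapted_2_sq_integrable[OF prob_space_axioms, of v F 0 T] by (simp add: admissible_def)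

lemma y_adapted: "t \<in> {-\<delta>..T} \<Longrightarrow> y t \<in> borel_measurable (F t)"
  and z_adapted: "t \<in> {-\<delta>..T} \<Longrightarrow> z t \<in> borel_measurable (F t)"
  using Lp_adapted_adapted[OF y_Lp] Lp_adapted_adapted[OF z_Lp] by blast+

lemma v_adapted: "t \<in> {0..T} \<Longrightarrow> v t \<in> borel_measurable (F t)"
  using admissible by (auto simp: admissible_def Lp_adapted_def)

lemma v_in_control_set: "t \<in> {0..T} \<Longrightarrow> AE \<omega> in M. v t \<omega> \<in> Control_set S"
  using admissible by (auto simp: admissible_def)

lemma delayed_sq:
  "delayable x \<Longrightarrow> sq_process (delayed S x)"
  using delayable_facts(3)[of x]
  by (subst sq_integrable_cong[of _ _ "case_prod (delay_integral x)"])
    (auto simp: space_pair_measure delayed_eq)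

lemma Theta_sq: "sq_process \<Theta>"
proof -
  have "sq_integrable LM (\<lambda>n. (case_prod y n, case_prod (delayed S y) n, case_prod z n, case_prod (delayed S z) n))"
    by (intro sq_integrable_Pair y_sq z_sq delayed_sq y_delayable z_delayable)
  then show ?thesis by (simp add: Theta_def split_beta')
qed

lemma Theta_adapted: "AE t in L. \<exists>\<theta>\<in>borel_measurable (F t). AE \<omega> in M. \<Theta> t \<omega> = \<theta> \<omega>"
proof -
  have "AE t in L. \<exists>g\<in>borel_measurable (F t). AE \<omega> in M. delay_integral y t \<omega> = g \<omega>"
    "AE t in L. \<exists>g\<in>borel_measurable (F t). AE \<omega> in M. delay_integral z t \<omega> = g \<omega>"
    by (rule delay_integral_adapted[OF y_delayable y_adapted] delay_integral_adapted[OF z_delayable z_adapted];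
        assumption)+
  with AE_space show ?thesis
  proof eventually_elim
    case (elim t)
    then have t: "t \<in> {0..T}" "t \<in> {-\<delta>..T}" using delay_nonneg by auto
    obtain g1 g2 where g: "g1 \<in> borel_measurable (F t)" "AE \<omega> in M. delay_integral y t \<omega> = g1 \<omega>"
      "g2 \<in> borel_measurable (F t)" "AE \<omega> in M. delay_integral z t \<omega> = g2 \<omega>"
      using elim(2,3) by blast
    show ?case
    proof (intro bexI)
      show "(\<lambda>\<omega>. (y t \<omega>, g1 \<omega>, z t \<omega>, g2 \<omega>)) \<in> borel_measurable (F t)"
        by (intro borel_measurable_Pair y_adapted z_adapted g t)
      show "AE \<omega> in M. \<Theta> t \<omega> = (y t \<omega>, g1 \<omega>, z t \<omega>, g2 \<omega>)"
        using g(2,4) by eventually_elim (simp add: Theta_def delayed_eq[OF t(1)])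
    qed
  qed
qed

lemma generator_coefficient: "measurable_adapted_coefficient S (Generator S)"
  and running_coefficient: "measurable_adapted_coefficient S (Running S)"
  using problem unfolding control_problem_def by simp_all

lemma generator_sq: "sq_process generator_process"
proof -
  obtain C where C: "0 \<le> C" "\<forall>\<omega>\<in>space M. \<forall>t\<in>{0..T}. \<forall>\<theta> v.
    norm (Generator S \<omega> t \<theta> v) \<le> norm (Generator S \<omega> t 0 0) + C * norm (\<theta>, v)"
    using generator_growth by blast
  have "(\<lambda>t \<omega>. Generator S \<omega> t 0 0) \<in> Lp S 2 0 T"
    using problem unfolding control_problem_def by simp
  from Lp_adapted_2_sq_integrable[OF prob_space_axioms this]
  have f0: "sq_integrable LM (\<lambda>(t, \<omega>). Generator S \<omega> t 0 0)" .
  have tv: "sq_integrable LM (\<lambda>n. (case_prod \<Theta> n, case_prod v n))"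
    by (rule sq_integrable_Pair[OF Theta_sq v_sq])
  have "sq_integrable LM (\<lambda>n. norm (case_prod (\<lambda>t \<omega>. Generator S \<omega> t 0 0) n) + C *\<^sub>R norm
      (case_prod \<Theta> n, case_prod v n))"
    by (intro sq_integrable_add sq_integrable_norm f0
        sq_integrable_scaleR_bounded[where g = "\<lambda>_. C" and C = C, OF sq_integrable_norm[OF tv]])
      (use C in auto)
  then show ?thesis
  proof (rule sq_integrable_norm_bound[rotated])
    show "case_prod generator_process \<in> borel_measurable LM"
      using coefficient_measurable[OF generator_coefficient sq_integrable_measurable[OF Theta_sq]
        sq_integrable_measurable[OF v_sq]]
      by (simp add: generator_process_def[abs_def])
    show "AE n in LM. norm (case_prod generator_process n) \<le>
        norm (norm (case_prod (\<lambda>t \<omega>. Generator S \<omega> t 0 0) n) + C *\<^sub>R norm (case_prod \<Theta> n, case_prod v n))"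
    proof (rule AE_I2)
      fix n assume "n \<in> space LM"
      then obtain t \<omega> where n: "n = (t, \<omega>)" "t \<in> {0..T}" "\<omega> \<in> space M" by (auto simp: space_pair_measure)
      have "norm (generator_process t \<omega>) \<le> norm (Generator S \<omega> t 0 0) + C * norm (\<Theta> t \<omega>, v t \<omega>)"
        unfolding generator_process_def using C(2) n by blast
      also have "\<dots> \<le> \<bar>norm (Generator S \<omega> t 0 0) + C * norm (\<Theta> t \<omega>, v t \<omega>)\<bar>" by (rule abs_ge_self)
      finally show "norm (case_prod generator_process n) \<le>
        norm (norm (case_prod (\<lambda>t \<omega>. Generator S \<omega> t 0 0) n) + C *\<^sub>R norm (case_prod \<Theta> n, case_prod v n))"
        by (simp add: n)
    qed
  qed
qed

lemma generator_adapted: "AE t in L. \<exists>g\<in>borel_measurable (F t). AE \<omega> in M. generator_process t \<omega> = g \<omega>"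
  using Theta_adapted AE_space
proof eventually_elim
  case (elim t)
  then have t: "t \<in> {0..T}" by simp
  obtain \<theta> where \<theta>: "\<theta> \<in> borel_measurable (F t)" "AE \<omega> in M. \<Theta> t \<omega> = \<theta> \<omega>" using elim(1) by blast
  show ?case
  proof (intro bexI)
    show "(\<lambda>\<omega>. Generator S \<omega> t (\<theta> \<omega>) (v t \<omega>)) \<in> borel_measurable (F t)"
      by (rule coefficient_adapted[OF generator_coefficient t \<theta>(1) v_adapted[OF t]])
    show "AE \<omega> in M. generator_process t \<omega> = Generator S \<omega> t (\<theta> \<omega>) (v t \<omega>)"
      using \<theta>(2) by eventually_elim (simp add: generator_process_def)
  qed
qed

lemma running_integrable: "integrable LM (case_prod running_process)"
proof -
  have "(\<lambda>t \<omega>. Running S \<omega> t (\<Theta> t \<omega>) (v t \<omega>)) \<in> Lp S 1 0 T"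
    using diff_payoff admissible solution unfolding assumption_B'_def by blast
  from Lp_adapted_1_integrable[OF prob_space_axioms this] show ?thesis
    by (simp add: running_process_def[abs_def])
qed

lemma state_equation:
  "\<exists>I. is_ito_integral M (BM S) T z I \<and> (\<forall>t\<in>{0..T}. AE \<omega> in M.
    y t \<omega> = Terminal S \<omega> + (\<integral>s. of_bool (t \<le> s) *\<^sub>R generator_process s \<omega> \<partial>L) - (I T \<omega> - I t \<omega>))"
proof -
  obtain I where I: "is_ito_integral M (BM S) T z I" "\<forall>t\<in>{0..T}. AE \<omega> in M.
        y t \<omega> = Terminal S \<omega> + (LINT s:{t..T}|lborel. Generator S \<omega> s (\<Theta> s \<omega>) (v s \<omega>)) - (I T \<omega> - I t \<omega>)"
    using solution unfolding state_solution_def by blast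
  have "\<forall>t\<in>{0..T}. AE \<omega> in M.
    y t \<omega> = Terminal S \<omega> + (\<integral>s. of_bool (t \<le> s) *\<^sub>R generator_process s \<omega> \<partial>L) - (I T \<omega> - I t \<omega>)"
  proof
    fix t assume t: "t \<in> {0..T}"
    show "AE \<omega> in M. y t \<omega> = Terminal S \<omega> + (\<integral>s. of_bool (t \<le> s) *\<^sub>R generator_process s \<omega> \<partial>L) - (I T \<omega> - I t \<omega>)"
      using bspec[OF I(2) t] by (simp only: generator_process_def upper_set_integral[OF t])
  qed
  with I(1) show ?thesis by blast
qed

lemma generator_time_integrable: "AE \<omega> in M. integrable L (\<lambda>s. generator_process s \<omega>)"
  using LM.AE_integrable_snd[of generator_process] LMf.sq_integrable_imp_integrable[OF generator_sq] by simp

lemma terminal_sq: "sq_integrable M (Terminal S)"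
proof -
  have "Terminal S \<in> borel_measurable (F T)" "integrable M (\<lambda>\<omega>. (norm (Terminal S \<omega>))\<^sup>2)"
    using problem unfolding control_problem_def by blast+
  then show ?thesis
    unfolding sq_integrable_def by (intro conjI filtration_measurable_imp_measurable)
qed

text \<open>Square integrability on the product space says nothing about a single time; at time zero it is read
  off from the state equation.\<close>

lemma initial_state_sq: "sq_integrable M (y 0)"
proof -
  have z: "0 \<in> {0..T}" "T \<in> {0..T}" "0 \<in> {-\<delta>..T}" using horizon_nonneg delay_nonneg by auto
  obtain I where I: "is_ito_integral M (BM S) T z I" "AE \<omega> in M.
    y 0 \<omega> = Terminal S \<omega> + (\<integral>s. of_bool (0 \<le> s) *\<^sub>R generator_process s \<omega> \<partial>L) - (I T \<omega> - I 0 \<omega>)"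
    using state_equation z(1) by blast
  interpret ito_integral M "BM S" T z I by unfold_locales fact
  have "sq_integrable M (\<lambda>\<omega>. Terminal S \<omega> + (\<integral>s. of_bool (0 \<le> s) *\<^sub>R generator_process s \<omega> \<partial>L) - (I T \<omega> - I 0 \<omega>))"
    using sq_integrable_partial_integral(2)[OF generator_sq interval_le_pred(1), of 0] z
    by (intro sq_integrable_add sq_integrable_diff terminal_sq integral_sq) auto
  then show ?thesis
  proof (rule sq_integrable_cong_AE)
    show "y 0 \<in> borel_measurable M" by (rule filtration_measurable_imp_measurable[OF y_adapted[OF z(3)]])
  qed (use I(2) in auto)
qed

definition "total_payoff = (\<integral>n. case_prod running_process n \<partial>LM) + expectation (\<lambda>\<omega>. Initial_payoff S (y 0 \<omega>))"

lemma total_payoff_eq: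
  "(LINT \<omega>|M. (LINT t:{0..T}|lborel. Running S \<omega> t (\<Theta> t \<omega>) (v t \<omega>)) + Initial_payoff S (y 0 \<omega>)) = total_payoff"
proof -
  have i: "integrable M (\<lambda>\<omega>. \<integral>t. running_process t \<omega> \<partial>L)"
    using LM.integrable_snd[OF running_integrable] .
  have "(LINT \<omega>|M. (LINT t:{0..T}|lborel. Running S \<omega> t (\<Theta> t \<omega>) (v t \<omega>)) + Initial_payoff S (y 0 \<omega>)) =
      expectation (\<lambda>\<omega>. (\<integral>t. running_process t \<omega> \<partial>L) + Initial_payoff S (y 0 \<omega>))"
    by (simp add: set_lebesgue_integral_interval running_process_def)
  also have "\<dots> = expectation (\<lambda>\<omega>. \<integral>t. running_process t \<omega> \<partial>L) + expectation (\<lambda>\<omega>. Initial_payoff S (y 0 \<omega>))"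
    by (rule Bochner_Integration.integral_add[OF i payoff_integrable[OF initial_state_sq]])
  also have "expectation (\<lambda>\<omega>. \<integral>t. running_process t \<omega> \<partial>L) = (\<integral>n. case_prod running_process n \<partial>LM)"
    using LM.integral_snd[OF running_integrable] by simp
  finally show ?thesis by (simp add: total_payoff_def)
qed

end

context control_setting
begin

lemma J_eq_total_payoff:
  assumes v: "v \<in> admissible S"
  shows "\<exists>y z. state_solution S v y z \<and> J S v = state_trajectory.total_payoff S v y z"
proof -
  obtain y z where yz: "trajectory S v = (y, z)" by (cases "trajectory S v")
  have "\<exists>w. case w of (y, z) \<Rightarrow> state_solution S v y z"
    using problem v unfolding control_problem_def uniquely_solvable_def by auto
  then have "case trajectory S v of (y, z) \<Rightarrow> state_solution S v y z"
    unfolding trajectory_def by (rule someI_ex)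
  then have sol: "state_solution S v y z" by (simp add: yz)
  interpret state_trajectory S v y z by unfold_locales fact+
  show ?thesis using sol total_payoff_eq by (intro exI[of _ y] exI[of _ z]) (simp add: J_def yz)
qed

text \<open>Solutions are unique only almost everywhere on the product space, whereas the payoff evaluates
  the state at time zero; the equation itself, through the isometry, transfers uniqueness to that
  single time.\<close>

lemma total_payoff_unique:
  assumes v: "v \<in> admissible S" and sol: "state_solution S v y z" and sol': "state_solution S v y' z'"
  shows "state_trajectory.total_payoff S v y z = state_trajectory.total_payoff S v y' z'"
proof -
  interpret A: state_trajectory S v y z by unfold_locales fact+
  interpret B: state_trajectory S v y' z' by unfold_locales fact+
  have eq: "AE (t, \<omega>) in lborel \<Otimes>\<^sub>M M. t \<in> {-\<delta>..T} \<longrightarrow> y t \<omega> = y' t \<omega> \<and> z t \<omega> = z' t \<omega>"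
    using problem v sol sol' unfolding control_problem_def uniquely_solvable_def by blast
  have sf: "sigma_finite_measure M" by unfold_locales
  have sl: "AE \<omega> in M. AE t in lborel. t \<in> {-\<delta>..T} \<longrightarrow> y t \<omega> = y' t \<omega> \<and> z t \<omega> = z' t \<omega>"
    using AE_pair_swap[OF sigma_finite_lborel sf eq] by simp
  have delays: "AE \<omega> in M. \<forall>t\<in>{0..T}. delayed S y t \<omega> = delayed S y' t \<omega> \<and> delayed S z t \<omega> = delayed S z' t \<omega>"
    using sl AE_space
  proof eventually_elim
    case (elim \<omega>)
    have "AE s in Delay_measure S. s \<in> {-\<delta>..T} \<longrightarrow> y s \<omega> = y' s \<omega> \<and> z s \<omega> = z' s \<omega>"
      by (rule absolutely_continuous_AE[OF _ ac_\<alpha> elim(1)]) (simp add: sets_\<alpha>)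
    then have ae: "AE s in A. y s \<omega> = y' s \<omega> \<and> z s \<omega> = z' s \<omega>"
      by (subst AE_restrict_space_iff) (simp_all add: sets_\<alpha>)
    have gen: "delay_integral x t \<omega> = delay_integral x' t \<omega>"
      if "case_prod x \<in> borel_measurable (A \<Otimes>\<^sub>M M)" "case_prod x' \<in> borel_measurable (A \<Otimes>\<^sub>M M)"
        "AE s in A. x s \<omega> = x' s \<omega>" "t \<in> {0..T}" "\<omega> \<in> space M" for x x' :: "real \<Rightarrow> 'w \<Rightarrow> 'h::euclidean_space" and t
      unfolding delay_integral_def
    proof (rule integral_cong_AE)
      have n: "(t, \<omega>) \<in> space LM" using that by (simp add: space_pair_measure)
      show "delay_integrand x (t, \<omega>) \<in> borel_measurable A" "delay_integrand x' (t, \<omega>) \<in> borel_measurable A"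
        using measurable_Pair2[OF delay_integrand_measurable[OF that(1)] n]
          measurable_Pair2[OF delay_integrand_measurable[OF that(2)] n] by simp_all
      show "AE s in A. delay_integrand x (t, \<omega>) s = delay_integrand x' (t, \<omega>) s"
        using that(3) by eventually_elim (simp add: delay_integrand_def)
    qed
    show ?case
    proof
      fix t assume t: "t \<in> {0..T}"
      have "AE s in A. y s \<omega> = y' s \<omega>" "AE s in A. z s \<omega> = z' s \<omega>" using ae by auto
      then show "delayed S y t \<omega> = delayed S y' t \<omega> \<and> delayed S z t \<omega> = delayed S z' t \<omega>"
        using gen[OF Lp_delay_measurable[OF A.y_Lp] Lp_delay_measurable[OF B.y_Lp] _ t elim(2)]
          gen[OF Lp_delay_measurable[OF A.z_Lp] Lp_delay_measurable[OF B.z_Lp] _ t elim(2)]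
        by (simp add: delayed_eq[OF t])
    qed
  qed
  have Theta_time: "AE \<omega> in M. AE t in L. A.\<Theta> t \<omega> = B.\<Theta> t \<omega>"
    using sl delays
  proof eventually_elim
    case (elim \<omega>)
    have "AE t in L. y t \<omega> = y' t \<omega> \<and> z t \<omega> = z' t \<omega>"
      unfolding AE_interval_measure using elim(1) by eventually_elim (use delay_nonneg in auto)
    with AE_space show ?case
      by eventually_elim (use elim(2) in \<open>auto simp: Theta_def\<close>)
  qed
  have [measurable]: "case_prod A.\<Theta> \<in> borel_measurable LM" "case_prod B.\<Theta> \<in> borel_measurable LM"
    using A.Theta_sq B.Theta_sq by (simp_all add: sq_integrable_def)
  have set: "{n \<in> space LM. case_prod A.\<Theta> n = case_prod B.\<Theta> n} \<in> sets LM"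
    by measurable
  have "AE t in L. AE \<omega> in M. A.\<Theta> t \<omega> = B.\<Theta> t \<omega>"
    using Theta_time set by (subst LM.AE_commute) (simp_all add: split_beta')
  then have Theta_eq: "AE n in LM. case_prod A.\<Theta> n = case_prod B.\<Theta> n"
    using set by (intro LM.AE_pair_measure) simp_all
  have "AE n in LM. case_prod z n = case_prod z' n"
    using Theta_eq by eventually_elim (auto simp: Theta_def)
  note z_eq = this
  have running: "(\<integral>n. case_prod A.running_process n \<partial>LM) = (\<integral>n. case_prod B.running_process n \<partial>LM)"
  proof (rule integral_cong_AE)
    show "AE n in LM. case_prod A.running_process n = case_prod B.running_process n"
      using Theta_eq by eventually_elim (auto simp: A.running_process_def B.running_process_def split_beta')
  qed (use A.running_integrable B.running_integrable in auto)
  obtain I where I: "is_ito_integral M (BM S) T z I" "\<forall>t\<in>{0..T}. AE \<omega> in M.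
    y t \<omega> = Terminal S \<omega> + (\<integral>s. of_bool (t \<le> s) *\<^sub>R A.generator_process s \<omega> \<partial>L) - (I T \<omega> - I t \<omega>)"
    using A.state_equation by blast
  obtain I' where I': "is_ito_integral M (BM S) T z' I'" "\<forall>t\<in>{0..T}. AE \<omega> in M.
    y' t \<omega> = Terminal S \<omega> + (\<integral>s. of_bool (t \<le> s) *\<^sub>R B.generator_process s \<omega> \<partial>L) - (I' T \<omega> - I' t \<omega>)"
    using B.state_equation by blast
  interpret IA: ito_integral M "BM S" T z I by unfold_locales fact
  interpret IB: ito_integral M "BM S" T z' I' by unfold_locales fact
  have all: "(\<integral>s. of_bool (0 \<le> s) *\<^sub>R f s \<partial>L) = (\<integral>s. f s \<partial>L)" for f :: "real \<Rightarrow> real^'n"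
    by (intro Bochner_Integration.integral_cong refl) simp
  have gen: "AE \<omega> in M. (\<integral>s. A.generator_process s \<omega> \<partial>L) = (\<integral>s. B.generator_process s \<omega> \<partial>L)"
    using Theta_time A.generator_time_integrable B.generator_time_integrable
  proof eventually_elim
    case (elim \<omega>)
    show ?case
    proof (rule integral_cong_AE)
      show "AE s in L. A.generator_process s \<omega> = B.generator_process s \<omega>"
        using elim(1) by eventually_elim (simp add: A.generator_process_def B.generator_process_def)
    qed (use elim(2,3) in auto)
  qed
  have zero: "0 \<in> {0..T}" using horizon_nonneg by simp
  have "AE \<omega> in M. y 0 \<omega> = y' 0 \<omega>"
    using bspec[OF I(2) zero] bspec[OF I'(2) zero] gen IA.integral_start[OF horizon_nonneg]
      IB.integral_start[OF horizon_nonneg] ito_integral_unique[OF I(1) I'(1) z_eq]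
    by eventually_elim (simp add: all)
  then have initial: "expectation (\<lambda>\<omega>. Initial_payoff S (y 0 \<omega>)) = expectation (\<lambda>\<omega>. Initial_payoff S (y' 0 \<omega>))"
    by (intro integral_cong_AE)
      (use payoff_integrable[OF A.initial_state_sq] payoff_integrable[OF B.initial_state_sq] in auto)
  show ?thesis by (simp add: A.total_payoff_def B.total_payoff_def running initial)
qed

end

section \<open>The adjoint process and sufficiency\<close>

locale adjoint_state = state_trajectory S u y z
  for S :: "('w, 'n::finite, 'd::finite, 'k::finite) control_system"
    and u :: "real \<Rightarrow> 'w \<Rightarrow> real^'k" and y :: "real \<Rightarrow> 'w \<Rightarrow> real^'n" and z :: "real \<Rightarrow> 'w \<Rightarrow> real^'d^'n" +
  fixes p :: "real \<Rightarrow> 'w \<Rightarrow> real^'n"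
  assumes adjoint: "adjoint_solution S u y z p"
begin

definition "Ham_gradient_process t \<omega> = grad (\<lambda>\<theta>. Ham S \<omega> t \<theta> (u t \<omega>) (p t \<omega>)) (\<Theta> t \<omega>)"

definition "Hy t \<omega> = Ham_y S \<omega> t (\<Theta> t \<omega>) (u t \<omega>) (p t \<omega>)"
definition "Hyd t \<omega> = Ham_yd S \<omega> t (\<Theta> t \<omega>) (u t \<omega>) (p t \<omega>)"
definition "Hz t \<omega> = Ham_z S \<omega> t (\<Theta> t \<omega>) (u t \<omega>) (p t \<omega>)"
definition "Hzd t \<omega> = Ham_zd S \<omega> t (\<Theta> t \<omega>) (u t \<omega>) (p t \<omega>)"

lemma p_Lp: "p \<in> Lp S 2 0 T"
  using adjoint by (simp add: adjoint_solution_def)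

lemma p_sq: "sq_process p"
  using Lp_adapted_2_sq_integrable[OF prob_space_axioms p_Lp] .

lemma p_adapted: "t \<in> {0..T} \<Longrightarrow> p t \<in> borel_measurable (F t)"
  using Lp_adapted_adapted[OF p_Lp] .

lemma Ham_gradient_process:
  assumes "t \<in> {0..T}" "\<omega> \<in> space M"
  shows "GDERIV (\<lambda>\<theta>. Ham S \<omega> t \<theta> (u t \<omega>) (p t \<omega>)) (\<Theta> t \<omega>) :> Ham_gradient_process t \<omega>"
proof -
  obtain D where "GDERIV (\<lambda>\<theta>. Ham S \<omega> t \<theta> (u t \<omega>) (p t \<omega>)) (\<Theta> t \<omega>) :> D"
    using Ham_gradient assms by blast
  then show ?thesis unfolding Ham_gradient_process_def using gderiv_imp_grad by metis
qed

lemma Ham_gradient_process_components: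
  assumes "t \<in> {0..T}" "\<omega> \<in> space M"
  shows "Ham_gradient_process t \<omega> = (Hy t \<omega>, Hyd t \<omega>, Hz t \<omega>, Hzd t \<omega>)"
proof -
  obtain Da Db Dc Dd where D: "Ham_gradient_process t \<omega> = (Da, Db, Dc, Dd)" by (cases "Ham_gradient_process t \<omega>")
  have "GDERIV (\<lambda>\<theta>. Ham S \<omega> t \<theta> (u t \<omega>) (p t \<omega>)) (y t \<omega>, delayed S y t \<omega>, z t \<omega>, delayed S z t \<omega>) :> (Da, Db, Dc, Dd)"
    using Ham_gradient_process[OF assms] by (simp add: D Theta_def)
  from gderiv_product_components[OF this, THEN gderiv_imp_grad] show ?thesis
    unfolding D Hy_def Hyd_def Hz_def Hzd_def Theta_def by simp
qed

lemma Ham_measurable: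
  assumes "case_prod \<theta> \<in> borel_measurable LM"
  shows "(\<lambda>(t, \<omega>). Ham S \<omega> t (\<theta> t \<omega>) (u t \<omega>) (p t \<omega>)) \<in> borel_measurable LM"
proof -
  note um = sq_integrable_measurable[OF v_sq] and pm = sq_integrable_measurable[OF p_sq]
  have "(\<lambda>n. (case n of (t, \<omega>) \<Rightarrow> Running S \<omega> t (\<theta> t \<omega>) (u t \<omega>)) -
      (case n of (t, \<omega>) \<Rightarrow> Generator S \<omega> t (\<theta> t \<omega>) (u t \<omega>)) \<bullet> case_prod p n) \<in> borel_measurable LM"
    by (intro borel_measurable_diff borel_measurable_inner pm
        coefficient_measurable[OF running_coefficient assms um]
        coefficient_measurable[OF generator_coefficient assms um])
  then show ?thesis by (simp add: Ham_def split_beta')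
qed

text \<open>Along each basis vector the gradient is a sequential limit of difference quotients, which are
  jointly measurable because the coefficients are.\<close>

lemma Ham_gradient_process_measurable: "case_prod Ham_gradient_process \<in> borel_measurable LM"
proof (subst borel_measurable_euclidean_space, intro ballI)
  fix b :: "('n, 'd) state" assume "b \<in> Basis"
  define q where "q i n = (case n of (t, \<omega>) \<Rightarrow>
    (Ham S \<omega> t (\<Theta> t \<omega> + (1 / real (Suc i)) *\<^sub>R b) (u t \<omega>) (p t \<omega>) - Ham S \<omega> t (\<Theta> t \<omega>) (u t \<omega>) (p t \<omega>))
      / (1 / real (Suc i)))" for i n
  show "(\<lambda>n. case_prod Ham_gradient_process n \<bullet> b) \<in> borel_measurable LM"
  proof (rule borel_measurable_LIMSEQ_real[of _ q])
    fix i
    have m: "case_prod \<Theta> \<in> borel_measurable LM" using Theta_sq by (rule sq_integrable_measurable)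
    have m': "case_prod (\<lambda>t \<omega>. \<Theta> t \<omega> + (1 / real (Suc i)) *\<^sub>R b) \<in> borel_measurable LM"
      using borel_measurable_add[OF m borel_measurable_const, of "(1 / real (Suc i)) *\<^sub>R b"]
      by (simp add: split_beta')
    show "q i \<in> borel_measurable LM"
      using borel_measurable_divide[OF borel_measurable_diff[OF Ham_measurable[OF m'] Ham_measurable[OF m]]
          borel_measurable_const, of "1 / real (Suc i)"]
      by (simp add: q_def[abs_def] split_beta')
  next
    fix n assume "n \<in> space LM"
    then obtain t \<omega> where n: "n = (t, \<omega>)" "t \<in> {0..T}" "\<omega> \<in> space M" by (auto simp: space_pair_measure)
    have "((\<lambda>r. (Ham S \<omega> t (\<Theta> t \<omega> + r *\<^sub>R b) (u t \<omega>) (p t \<omega>) - Ham S \<omega> t (\<Theta> t \<omega>) (u t \<omega>) (p t \<omega>)) / r)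
        \<longlongrightarrow> Ham_gradient_process t \<omega> \<bullet> b) (at 0)"
      using gderiv_directional[OF Ham_gradient_process[OF n(2,3)], of b]
      unfolding has_field_derivative_iff by simp
    moreover have "filterlim (\<lambda>i. 1 / real (Suc i)) (at 0) sequentially"
      unfolding filterlim_at using LIMSEQ_Suc[OF lim_1_over_n] by simp
    ultimately have "(\<lambda>i. (Ham S \<omega> t (\<Theta> t \<omega> + (1 / real (Suc i)) *\<^sub>R b) (u t \<omega>) (p t \<omega>)
        - Ham S \<omega> t (\<Theta> t \<omega>) (u t \<omega>) (p t \<omega>)) / (1 / real (Suc i))) \<longlonglongrightarrow> Ham_gradient_process t \<omega> \<bullet> b"
      by (rule filterlim_compose)
    then show "(\<lambda>i. q i n) \<longlonglongrightarrow> case_prod Ham_gradient_process n \<bullet> b"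
      unfolding q_def n(1) by simp
  qed
qed

lemma Ham_gradient_process_sq: "sq_process Ham_gradient_process"
proof -
  obtain C1 C2 where C: "0 \<le> C1" "0 \<le> C2" "\<forall>\<omega>\<in>space M. \<forall>t\<in>{0..T}. \<forall>\<theta> v p. \<exists>D.
    GDERIV (\<lambda>\<theta>. Ham S \<omega> t \<theta> v p) \<theta> :> D \<and> norm D \<le> C1 + C2 * norm p"
    using Ham_gradient by blast
  have "sq_integrable LM (\<lambda>n. C1 + C2 *\<^sub>R norm (case_prod p n))"
    by (intro sq_integrable_add LMf.sq_integrable_bounded[where C = C1]
        sq_integrable_scaleR_bounded[where g = "\<lambda>_. C2" and C = C2, OF sq_integrable_norm[OF p_sq]])
      (use C in auto)
  then show ?thesis
  proof (rule sq_integrable_norm_bound[OF Ham_gradient_process_measurable])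
    show "AE n in LM. norm (case_prod Ham_gradient_process n) \<le> norm (C1 + C2 *\<^sub>R norm (case_prod p n))"
    proof (rule AE_I2)
      fix n assume "n \<in> space LM"
      then obtain t \<omega> where n: "n = (t, \<omega>)" "t \<in> {0..T}" "\<omega> \<in> space M" by (auto simp: space_pair_measure)
      obtain D where D: "GDERIV (\<lambda>\<theta>. Ham S \<omega> t \<theta> (u t \<omega>) (p t \<omega>)) (\<Theta> t \<omega>) :> D" "norm D \<le> C1 + C2 * norm (p t \<omega>)"
        using C(3) n by blast
      have "D = Ham_gradient_process t \<omega>" by (rule gderiv_unique[OF D(1) Ham_gradient_process[OF n(2,3)]])
      then show "norm (case_prod Ham_gradient_process n) \<le> norm (C1 + C2 *\<^sub>R norm (case_prod p n))"
        using D(2) by (simp add: n(1))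
    qed
  qed
qed

lemma Ham_component_sq:
  "sq_process Hy" "sq_process Hyd"
  "sq_process Hz" "sq_process Hzd"
proof -
  note g = Ham_gradient_process_sq
  note g2 = sq_integrable_fst_snd(2)[OF g]
  note g3 = sq_integrable_fst_snd(2)[OF g2]
  have c: "case_prod Ham_gradient_process n = (case_prod Hy n, case_prod Hyd n, case_prod Hz n, case_prod Hzd n)"
    if "n \<in> space LM" for n
    using that Ham_gradient_process_components by (auto simp: space_pair_measure)
  show "sq_process Hy"
    by (rule sq_integrable_cong[THEN iffD1, OF _ sq_integrable_fst_snd(1)[OF g]]) (simp add: c)
  show "sq_process Hyd"
    by (rule sq_integrable_cong[THEN iffD1, OF _ sq_integrable_fst_snd(1)[OF g2]]) (simp add: c)
  show "sq_process Hz"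
    by (rule sq_integrable_cong[THEN iffD1, OF _ sq_integrable_fst_snd(1)[OF g3]]) (simp add: c)
  show "sq_process Hzd"
    by (rule sq_integrable_cong[THEN iffD1, OF _ sq_integrable_fst_snd(2)[OF g3]]) (simp add: c)
qed

lemma initial_adjoint:
  shows "sq_integrable M (p 0)" "p 0 \<in> borel_measurable (F 0)"
    and "AE \<omega> in M. p 0 \<omega> = - grad (Initial_payoff S) (y 0 \<omega>)"
proof -
  have zero: "0 \<in> {0..T}" using horizon_nonneg by simp
  show F: "p 0 \<in> borel_measurable (F 0)" by (rule p_adapted[OF zero])
  show eq: "AE \<omega> in M. p 0 \<omega> = - grad (Initial_payoff S) (y 0 \<omega>)"
    using adjoint unfolding adjoint_solution_def by blast
  obtain C where C: "\<And>y. \<exists>D. GDERIV (Initial_payoff S) y :> D \<and> norm D \<le> C"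
    using payoff_gradient by blast
  have bound: "norm (grad (Initial_payoff S) x) \<le> C" for x
    using C[of x] gderiv_imp_grad by metis
  have "AE \<omega> in M. norm (p 0 \<omega>) \<le> C" using eq by eventually_elim (simp add: bound)
  then show "sq_integrable M (p 0)"
    by (rule sq_integrable_bounded[OF filtration_measurable_imp_measurable[OF F]])
qed

text \<open>The adjoint equation enters only here.  The product rule for the adjoint process and the
  difference of two trajectories produces the drift and diffusion coefficients of the adjoint
  equation paired with the differences of \<open>y\<close> and \<open>z\<close>; the exchange of advance and delay converts the
  advanced terms into the two delayed components of the gradient.  Both trajectories have the same
  terminal value and the same initial paths, so the state difference vanishes at \<open>T\<close> and before
  time zero.\<close>

lemma adjoint_duality:
  assumes V: "state_trajectory S v yv zv"
  shows "(\<integral>n. case_prod Ham_gradient_process n \<bullet> (case_prod (Theta S yv zv) n - case_prod \<Theta> n) \<partial>LM)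
    + (\<integral>(t, \<omega>). p t \<omega> \<bullet> (state_trajectory.generator_process S v yv zv t \<omega> - generator_process t \<omega>) \<partial>LM)
    = expectation (\<lambda>\<omega>. p 0 \<omega> \<bullet> (yv 0 \<omega> - y 0 \<omega>))"
proof -
  interpret V: state_trajectory S v yv zv by (rule V)
  have zero: "0 \<in> {0..T}" "0 \<in> {-\<delta>..T}" "{0..T} \<subseteq> {-\<delta>..T}" using horizon_nonneg delay_nonneg by auto
  define Y where "Y t \<omega> = yv t \<omega> - y t \<omega>" for t \<omega>
  define Z where "Z t \<omega> = zv t \<omega> - z t \<omega>" for t \<omega>
  define g where "g t \<omega> = V.generator_process t \<omega> - generator_process t \<omega>" for t \<omega>
  have Y: "sq_process Y" "delayable Y"
    using sq_integrable_diff[OF V.y_sq y_sq] delayable_diff(1)[OF V.y_delayable y_delayable]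
    by (simp_all add: Y_def[abs_def] split_beta')
  have Z: "sq_process Z" "delayable Z"
    using sq_integrable_diff[OF V.z_sq z_sq] delayable_diff(1)[OF V.z_delayable z_delayable]
    by (simp_all add: Z_def[abs_def] split_beta')
  have YF: "Y t \<in> borel_measurable (F t)" and ZF: "Z t \<in> borel_measurable (F t)" if "t \<in> {0..T}" for t
    unfolding Y_def[abs_def] Z_def[abs_def]
    using that zero(3) by (intro borel_measurable_diff V.y_adapted y_adapted V.z_adapted z_adapted; blast)+
  have past: "AE \<omega> in M. Y t \<omega> = 0" "AE \<omega> in M. Z t \<omega> = 0" if t: "t \<in> {-\<delta>..<0}" for t
  proof -
    have a: "AE \<omega> in M. y t \<omega> = Y_init S t \<and> z t \<omega> = Z_init S t"
      using solution t unfolding state_solution_def by blast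
    have b: "AE \<omega> in M. yv t \<omega> = Y_init S t \<and> zv t \<omega> = Z_init S t"
      using V.solution t unfolding state_solution_def by blast
    show "AE \<omega> in M. Y t \<omega> = 0" "AE \<omega> in M. Z t \<omega> = 0"
      using a b by (eventually_elim, simp add: Y_def Z_def)+
  qed
  have g: "sq_process g"
    using sq_integrable_diff[OF V.generator_sq generator_sq] by (simp add: g_def[abs_def] split_beta')
  have gF: "AE t in L. \<exists>g'\<in>borel_measurable (F t). AE \<omega> in M. g t \<omega> = g' \<omega>"
    using V.generator_adapted generator_adapted
  proof eventually_elim
    case (elim t)
    then obtain g1 g2 where "g1 \<in> borel_measurable (F t)" "AE \<omega> in M. V.generator_process t \<omega> = g1 \<omega>"
      "g2 \<in> borel_measurable (F t)" "AE \<omega> in M. generator_process t \<omega> = g2 \<omega>" by blast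
    note gg = this
    show ?case
    proof (intro bexI)
      show "(\<lambda>\<omega>. g1 \<omega> - g2 \<omega>) \<in> borel_measurable (F t)" by (intro borel_measurable_diff gg)
      show "AE \<omega> in M. g t \<omega> = g1 \<omega> - g2 \<omega>" using gg(2,4) by eventually_elim (simp add: g_def)
    qed
  qed
  obtain I where I: "is_ito_integral M (BM S) T z I" "\<forall>t\<in>{0..T}. AE \<omega> in M.
    y t \<omega> = Terminal S \<omega> + (\<integral>s. of_bool (t \<le> s) *\<^sub>R generator_process s \<omega> \<partial>L) - (I T \<omega> - I t \<omega>)"
    using state_equation by blast
  obtain Iv where Iv: "is_ito_integral M (BM S) T zv Iv" "\<forall>t\<in>{0..T}. AE \<omega> in M.
    yv t \<omega> = Terminal S \<omega> + (\<integral>s. of_bool (t \<le> s) *\<^sub>R V.generator_process s \<omega> \<partial>L) - (Iv T \<omega> - Iv t \<omega>)"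
    using V.state_equation by blast
  obtain b \<sigma> I\<sigma> where
    b: "b \<in> Lp S 2 0 T" and s: "\<sigma> \<in> Lp S 2 0 T" and
    coef: "AE t in lborel. t \<in> {0..T} \<longrightarrow> (AE \<omega> in M.
        b t \<omega> = - Ham_y S \<omega> t (\<Theta> t \<omega>) (u t \<omega>) (p t \<omega>)
          - advanced S (\<lambda>s \<omega>. Ham_yd S \<omega> s (\<Theta> s \<omega>) (u s \<omega>) (p s \<omega>)) t \<omega> \<and>
        \<sigma> t \<omega> = - Ham_z S \<omega> t (\<Theta> t \<omega>) (u t \<omega>) (p t \<omega>)
          - advanced S (\<lambda>s \<omega>. Ham_zd S \<omega> s (\<Theta> s \<omega>) (u s \<omega>) (p s \<omega>)) t \<omega>)" and
    I\<sigma>: "is_ito_integral M (BM S) T \<sigma> I\<sigma>" and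
    peq: "\<forall>t\<in>{0..T}. AE \<omega> in M. p t \<omega> = p 0 \<omega> + (LINT s:{0..t}|lborel. b s \<omega>) + I\<sigma> t \<omega>"
    using adjoint unfolding adjoint_solution_def by blast
  have bs: "sq_process b" "sq_process \<sigma>"
    using Lp_adapted_2_sq_integrable[OF prob_space_axioms b] Lp_adapted_2_sq_integrable[OF prob_space_axioms s]
    by simp_all
  have coef': "AE t in L. AE \<omega> in M. b t \<omega> = - Hy t \<omega> - advance Hyd t \<omega> \<and> \<sigma> t \<omega> = - Hz t \<omega> - advance Hzd t \<omega>"
    using coef unfolding AE_interval_measure advanced_eq Hy_def Hz_def Hyd_def[abs_def] Hzd_def[abs_def] .
  have coefb: "AE t in L. AE \<omega> in M. b t \<omega> = - Hy t \<omega> - advance Hyd t \<omega>"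
    and coefs: "AE t in L. AE \<omega> in M. \<sigma> t \<omega> = - Hz t \<omega> - advance Hzd t \<omega>"
    using coef' by (eventually_elim, auto)+
  have pb: "(\<integral>(t, \<omega>). b t \<omega> \<bullet> Y t \<omega> \<partial>LM) =
    - (\<integral>(t, \<omega>). Hy t \<omega> \<bullet> Y t \<omega> \<partial>LM) - (\<integral>(t, \<omega>). Hyd t \<omega> \<bullet> delay_integral Y t \<omega> \<partial>LM)"
    by (rule adjoint_coefficient_pairing[OF bs(1) Ham_component_sq(1,2) Y(2,1) YF past(1) coefb])
  have ps: "(\<integral>(t, \<omega>). \<sigma> t \<omega> \<bullet> Z t \<omega> \<partial>LM) =
    - (\<integral>(t, \<omega>). Hz t \<omega> \<bullet> Z t \<omega> \<partial>LM) - (\<integral>(t, \<omega>). Hzd t \<omega> \<bullet> delay_integral Z t \<omega> \<partial>LM)"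
    by (rule adjoint_coefficient_pairing[OF bs(2) Ham_component_sq(3,4) Z(2,1) ZF past(2) coefs])
  have dual: "(\<integral>(t, \<omega>). b t \<omega> \<bullet> Y t \<omega> \<partial>LM) - (\<integral>(t, \<omega>). p t \<omega> \<bullet> g t \<omega> \<partial>LM)
    + (\<integral>(t, \<omega>). \<sigma> t \<omega> \<bullet> (zv t \<omega> - z t \<omega>) \<partial>LM) = - expectation (\<lambda>\<omega>. p 0 \<omega> \<bullet> Y 0 \<omega>)"
  proof (rule backward_forward_duality(1)[OF p_sq bs(1) _ g gF Y(1) YF[OF zero(1)] initial_adjoint(1,2) I\<sigma> Iv(1)
      I(1)])
    show "b t \<in> borel_measurable (F t)" if "t \<in> {0..T}" for t by (rule Lp_adapted_adapted[OF b that])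
    show "AE \<omega> in M. p t \<omega> = p 0 \<omega> + (\<integral>s. of_bool (s \<le> t) *\<^sub>R b s \<omega> \<partial>L) + I\<sigma> t \<omega>" if "t \<in> {0..T}" for t
      using bspec[OF peq that] by (simp only: lower_set_integral[OF that])
    show "AE \<omega> in M. Y t \<omega> = (\<integral>s. of_bool (t \<le> s) *\<^sub>R g s \<omega> \<partial>L) - ((Iv T \<omega> - I T \<omega>) - (Iv t \<omega> - I t \<omega>))"
      if t: "t \<in> {0..T}" for t
      using bspec[OF I(2) t] bspec[OF Iv(2) t] generator_time_integrable V.generator_time_integrable
    proof eventually_elim
      case (elim \<omega>)
      have ob: "integrable L (\<lambda>s. of_bool (t \<le> s) *\<^sub>R f s)" if f: "integrable L f" for f :: "real \<Rightarrow> real^'n"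
      proof (rule Bochner_Integration.integrable_bound[OF f])
        have "Measurable.pred L (\<lambda>s. t \<le> s)"
          using measurable_Pair2[OF interval_le_pred(1), of t 0 T] t by simp
        then show "(\<lambda>s. of_bool (t \<le> s) *\<^sub>R f s) \<in> borel_measurable L" using f by measurable
      qed simp
      have gs: "(\<integral>s. of_bool (t \<le> s) *\<^sub>R g s \<omega> \<partial>L) =
        (\<integral>s. of_bool (t \<le> s) *\<^sub>R V.generator_process s \<omega> \<partial>L) - (\<integral>s. of_bool (t \<le> s) *\<^sub>R generator_process s \<omega> \<partial>L)"
        using ob[OF elim(3)] ob[OF elim(4)] by (simp add: g_def scaleR_diff_right)
      show ?case unfolding Y_def gs elim(1) elim(2) by (simp add: algebra_simps)
    qed
  qed
  have dY: "sq_process (delay_integral Y)" and dZ: "sq_process (delay_integral Z)"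
    by (rule delayable_facts(3)[OF Y(2)] delayable_facts(3)[OF Z(2)])+
  note ip = inner_process_integrable[OF Ham_component_sq(1) Y(1)] inner_process_integrable[OF Ham_component_sq(2) dY]
    inner_process_integrable[OF Ham_component_sq(3) Z(1)] inner_process_integrable[OF Ham_component_sq(4) dZ]
  have dYd: "AE n in LM. case_prod (delay_integral Y) n =
      case_prod (delay_integral yv) n - case_prod (delay_integral y) n"
    using delayable_diff(2)[OF V.y_delayable y_delayable] by (simp add: Y_def[abs_def])
  have dZd: "AE n in LM. case_prod (delay_integral Z) n =
      case_prod (delay_integral zv) n - case_prod (delay_integral z) n"
    using delayable_diff(2)[OF V.z_delayable z_delayable] by (simp add: Z_def[abs_def])
  have "(\<integral>n. case_prod Ham_gradient_process n \<bullet> (case_prod (Theta S yv zv) n - case_prod \<Theta> n) \<partial>LM) =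
    (\<integral>n. (case n of (t, \<omega>) \<Rightarrow> Hy t \<omega> \<bullet> Y t \<omega>) + (case n of (t, \<omega>) \<Rightarrow> Hyd t \<omega> \<bullet> delay_integral Y t \<omega>)
      + (case n of (t, \<omega>) \<Rightarrow> Hz t \<omega> \<bullet> Z t \<omega>) + (case n of (t, \<omega>) \<Rightarrow> Hzd t \<omega> \<bullet> delay_integral Z t \<omega>) \<partial>LM)"
  proof (rule integral_cong_AE)
    show "(\<lambda>n. case_prod Ham_gradient_process n \<bullet> (case_prod (Theta S yv zv) n - case_prod \<Theta> n)) \<in>
        borel_measurable LM"
      using integrable_inner[OF Ham_gradient_process_sq sq_integrable_diff[OF V.Theta_sq Theta_sq]] by auto
    show "(\<lambda>n. (case n of (t, \<omega>) \<Rightarrow> Hy t \<omega> \<bullet> Y t \<omega>) + (case n of (t, \<omega>) \<Rightarrow> Hyd t \<omega> \<bullet> delay_integral Y t \<omega>)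
      + (case n of (t, \<omega>) \<Rightarrow> Hz t \<omega> \<bullet> Z t \<omega>) + (case n of (t, \<omega>) \<Rightarrow> Hzd t \<omega> \<bullet> delay_integral Z t \<omega>)) \<in>
      borel_measurable LM"
      using ip by (intro borel_measurable_add) (auto dest: borel_measurable_integrable)
    show "AE n in LM. case_prod Ham_gradient_process n \<bullet> (case_prod (Theta S yv zv) n - case_prod \<Theta> n) =
      (case n of (t, \<omega>) \<Rightarrow> Hy t \<omega> \<bullet> Y t \<omega>) + (case n of (t, \<omega>) \<Rightarrow> Hyd t \<omega> \<bullet> delay_integral Y t \<omega>)
      + (case n of (t, \<omega>) \<Rightarrow> Hz t \<omega> \<bullet> Z t \<omega>) + (case n of (t, \<omega>) \<Rightarrow> Hzd t \<omega> \<bullet> delay_integral Z t \<omega>)"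
      using dYd dZd AE_space
    proof eventually_elim
      case (elim n)
      obtain t \<omega> where n: "n = (t, \<omega>)" "t \<in> {0..T}" "\<omega> \<in> space M" using elim(3) by (auto simp: space_pair_measure)
      show ?case
        using elim(1,2) unfolding n(1)
        by (simp add: Ham_gradient_process_components[OF n(2,3)] Theta_def Y_def Z_def delayed_eq[OF n(2)])
    qed
  qed
  also have "\<dots> = (\<integral>(t, \<omega>). Hy t \<omega> \<bullet> Y t \<omega> \<partial>LM) + (\<integral>(t, \<omega>). Hyd t \<omega> \<bullet> delay_integral Y t \<omega> \<partial>LM)
      + (\<integral>(t, \<omega>). Hz t \<omega> \<bullet> Z t \<omega> \<partial>LM) + (\<integral>(t, \<omega>). Hzd t \<omega> \<bullet> delay_integral Z t \<omega> \<partial>LM)"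
    using ip by (simp add: Bochner_Integration.integral_add Bochner_Integration.integrable_add)
  finally show ?thesis
    using pb ps dual unfolding Z_def g_def Y_def by linarith
qed

end

theorem theorem3p4:
  fixes S :: "('w, 'n::finite, 'd::finite, 'k::finite) control_system"
    and u :: "real \<Rightarrow> 'w \<Rightarrow> real^'k"
    and y p :: "real \<Rightarrow> 'w \<Rightarrow> real^'n"
    and z :: "real \<Rightarrow> 'w \<Rightarrow> real^'d^'n"
    and H_hat :: "'w \<Rightarrow> real \<Rightarrow> ('n, 'd) state \<Rightarrow> real"
  assumes "control_problem S"
    and "assumption_A S"
    and "assumption_B' S"
    and "u \<in> admissible S"
    and "state_solution S u y z"
    and "adjoint_solution S u y z p"
    and "\<forall>t\<in>{0..Horizon S}. AE \<omega> in Prob S.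
      is_maximum (\<lambda>v. Ham S \<omega> t (Theta S y z t \<omega>) v (p t \<omega>)) (Control_set S)
        (Ham S \<omega> t (Theta S y z t \<omega>) (u t \<omega>) (p t \<omega>))"
    and "\<forall>t\<in>{0..Horizon S}. AE \<omega> in Prob S.
      (\<forall>\<theta>. is_maximum (\<lambda>v. Ham S \<omega> t \<theta> v (p t \<omega>)) (Control_set S) (H_hat \<omega> t \<theta>)) \<and>
      concave_on UNIV (H_hat \<omega> t)"
    and "concave_on UNIV (Initial_payoff S)"
  shows "optimal_control S u"
proof -
  interpret adjoint_state S u y z p by unfold_locales fact+
  have "J S v \<le> J S u" if v: "v \<in> admissible S" for v
  proof -
    obtain y' z' where u': "state_solution S u y' z'" "J S u = state_trajectory.total_payoff S u y' z'"
      using J_eq_total_payoff[OF admissible] by blast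
    have Ju: "J S u = total_payoff"
      using u'(2) total_payoff_unique[OF admissible u'(1) solution] by simp
    obtain yv zv where v': "state_solution S v yv zv" "J S v = state_trajectory.total_payoff S v yv zv"
      using J_eq_total_payoff[OF v] by blast
    interpret V: state_trajectory S v yv zv by unfold_locales fact+
    define g where "g t \<omega> = V.generator_process t \<omega> - generator_process t \<omega>" for t \<omega>
    define G where "G n = case_prod Ham_gradient_process n \<bullet> (case_prod V.\<Theta> n - case_prod \<Theta> n)" for n
    have g: "sq_integrable LM (case_prod g)"
      using sq_integrable_diff[OF V.generator_sq generator_sq] by (simp add: g_def[abs_def] split_beta')
    have Gi: "integrable LM G"
      unfolding G_def[abs_def] by
        (rule integrable_inner[OF Ham_gradient_process_sq sq_integrable_diff[OF V.Theta_sq Theta_sq]])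
    note pg = inner_process_integrable[OF p_sq g]
    define \<Delta> where "\<Delta> n = case_prod V.running_process n - case_prod running_process n -
        (case n of (t, \<omega>) \<Rightarrow> p t \<omega> \<bullet> g t \<omega>)" for n
    have \<Delta>i: "integrable LM \<Delta>"
      unfolding \<Delta>_def[abs_def] by (intro Bochner_Integration.integrable_diff V.running_integrable
        running_integrable pg)
    have pointwise: "AE \<omega> in M. \<Delta> (t, \<omega>) \<le> G (t, \<omega>)" if t: "t \<in> {0..T}" for t
    proof -
      have m1: "AE \<omega> in M. is_maximum (\<lambda>v. Ham S \<omega> t (\<Theta> t \<omega>) v (p t \<omega>)) (Control_set S)
        (Ham S \<omega> t (\<Theta> t \<omega>) (u t \<omega>) (p t \<omega>))" using assms(7) t by blast
      have m2: "AE \<omega> in M. (\<forall>\<theta>. is_maximum (\<lambda>v. Ham S \<omega> t \<theta> v (p t \<omega>)) (Control_set S) (H_hat \<omega> t \<theta>)) \<and>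
        concave_on UNIV (H_hat \<omega> t)" using assms(8) t by blast
      show ?thesis
        using m1 m2 v_in_control_set[OF t] V.v_in_control_set[OF t] AE_space
      proof eventually_elim
        case (elim \<omega>)
        let ?H = "\<lambda>\<theta> w. Ham S \<omega> t \<theta> w (p t \<omega>)"
        have mx: "is_maximum (?H \<theta>) (Control_set S) (H_hat \<omega> t \<theta>)" for \<theta> using elim(2) by blast
        \<comment> \<open>the envelope lies above every \<open>H(\<cdot>, w)\<close> and, by the maximum condition, touches \<open>H(\<cdot>, u)\<close> at \<open>\<Theta>\<close>\<close>
        have below: "?H \<theta> w \<le> H_hat \<omega> t \<theta>" if "w \<in> Control_set S" for \<theta> w
          using mx[of \<theta>] that by (simp add: is_maximum_def)
        have "H_hat \<omega> t (\<Theta> t \<omega>) \<in> ?H (\<Theta> t \<omega>) ` Control_set S"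
          using mx by (simp add: is_maximum_def)
        then have "H_hat \<omega> t (\<Theta> t \<omega>) \<le> ?H (\<Theta> t \<omega>) (u t \<omega>)"
          using elim(1) by (auto simp: is_maximum_def)
        then have touch: "?H (\<Theta> t \<omega>) (u t \<omega>) = H_hat \<omega> t (\<Theta> t \<omega>)"
          using below[OF elim(3)] by (rule antisym[rotated])
        have "?H (V.\<Theta> t \<omega>) (v t \<omega>) - ?H (\<Theta> t \<omega>) (u t \<omega>) \<le> H_hat \<omega> t (V.\<Theta> t \<omega>) - H_hat \<omega> t (\<Theta> t \<omega>)"
          using below[OF elim(4), of "V.\<Theta> t \<omega>"] touch by simp
        also have "\<dots> \<le> Ham_gradient_process t \<omega> \<bullet> (V.\<Theta> t \<omega> - \<Theta> t \<omega>)"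
          using elim(2) by (intro concave_envelope_gradient[OF _ below[OF elim(3)] touch
            Ham_gradient_process[OF t elim(5)]]) simp
        finally show ?case
          by (simp add: \<Delta>_def G_def Ham_def V.running_process_def running_process_def g_def
              V.generator_process_def generator_process_def inner_diff_right inner_commute)
      qed
    qed
    have "(\<integral>n. \<Delta> n \<partial>LM) = (\<integral>t. \<integral>\<omega>. \<Delta> (t, \<omega>) \<partial>M \<partial>L)" by (rule LM.integral_fst'[symmetric, OF \<Delta>i])
    also have "\<dots> \<le> (\<integral>t. \<integral>\<omega>. G (t, \<omega>) \<partial>M \<partial>L)"
    proof (rule integral_mono_AE[OF LM.integrable_fst'[OF \<Delta>i] LM.integrable_fst'[OF Gi]])
      show "AE t in L. (\<integral>\<omega>. \<Delta> (t, \<omega>) \<partial>M) \<le> (\<integral>\<omega>. G (t, \<omega>) \<partial>M)"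
        using LM.AE_integrable_fst'[OF \<Delta>i] LM.AE_integrable_fst'[OF Gi] AE_space
        by eventually_elim (intro integral_mono_AE, auto intro: pointwise)
    qed
    also have "\<dots> = (\<integral>n. G n \<partial>LM)" by (rule LM.integral_fst'[OF Gi])
    finally have main: "(\<integral>n. \<Delta> n \<partial>LM) \<le> (\<integral>n. G n \<partial>LM)" .
    have \<Delta>eq: "(\<integral>n. \<Delta> n \<partial>LM) = (\<integral>n. case_prod V.running_process n \<partial>LM) - (\<integral>n. case_prod running_process n \<partial>LM)
        - (\<integral>(t, \<omega>). p t \<omega> \<bullet> g t \<omega> \<partial>LM)"
      unfolding \<Delta>_def
      by (simp only: Bochner_Integration.integral_diff Bochner_Integration.integrable_diff
          V.running_integrable running_integrable pg)
    have dual: "(\<integral>n. G n \<partial>LM) + (\<integral>(t, \<omega>). p t \<omega> \<bullet> g t \<omega> \<partial>LM) = expectation (\<lambda>\<omega>. p 0 \<omega> \<bullet> (yv 0 \<omega> - y 0 \<omega>))"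
      unfolding G_def g_def by (rule adjoint_duality) unfold_locales
    have initial: "expectation (\<lambda>\<omega>. Initial_payoff S (yv 0 \<omega>)) - expectation (\<lambda>\<omega>. Initial_payoff S (y 0 \<omega>)) \<le>
        - expectation (\<lambda>\<omega>. p 0 \<omega> \<bullet> (yv 0 \<omega> - y 0 \<omega>))"
    proof -
      note i = payoff_integrable[OF V.initial_state_sq] payoff_integrable[OF initial_state_sq]
      note ip = integrable_inner[OF initial_adjoint(1) sq_integrable_diff[OF V.initial_state_sq initial_state_sq]]
      have "expectation (\<lambda>\<omega>. Initial_payoff S (yv 0 \<omega>) - Initial_payoff S (y 0 \<omega>)) \<le>
          expectation (\<lambda>\<omega>. - (p 0 \<omega> \<bullet> (yv 0 \<omega> - y 0 \<omega>)))"
      proof (rule integral_mono_AE)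
        show "AE \<omega> in M. Initial_payoff S (yv 0 \<omega>) - Initial_payoff S (y 0 \<omega>) \<le> - (p 0 \<omega> \<bullet> (yv 0 \<omega> - y 0 \<omega>))"
          using initial_adjoint(3)
        proof eventually_elim
          case (elim \<omega>)
          obtain D where D: "GDERIV (Initial_payoff S) (y 0 \<omega>) :> D" using payoff_gradient by blast
          have "Initial_payoff S (yv 0 \<omega>) - Initial_payoff S (y 0 \<omega>) \<le> D \<bullet> (yv 0 \<omega> - y 0 \<omega>)"
            by (rule concave_envelope_gradient[OF assms(9) order_refl refl D])
          then show ?case using elim gderiv_imp_grad[OF D] by simp
        qed
      qed (use i ip in auto)
      then show ?thesis using i ip by simp
    qed
    show "J S v \<le> J S u"
      using main \<Delta>eq dual initial
      unfolding Ju v'(2) V.total_payoff_def total_payoff_def by linarith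
  qed
  then show ?thesis using admissible by (simp add: optimal_control_def)
qed

end
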